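(* Let $n\ge3$, $d\ge2$, let $\Omega\subset\mathbb{R}^n$ be open and connected, $R>0$, $B_r=B(0,r)$, and assume $B_{4R}\subset\Omega$. Let $a^{\alpha\beta}$ ($1\le\alpha,\beta\le n$) be real-valued bounded measurable functions on $\mathbb{R}^n$ such that $A^{\alpha\beta}=a^{\alpha\beta}I_d$ satisfies the ellipticity and boundedness conditions with constants $0<\lambda,\Lambda<\infty$, and let $V\in L^{n/2}_{loc}(\mathbb{R}^n)\cap\mathcal{ND}$. Let $\vec f\in L^\ell(B_{2R})$ for some $\ell>\frac n2$, and let $\vec u\in W^{1,2}_V(B_{4R})$ satisfy $\mathcal{L}_V\vec u=-D_\alpha(a^{\alpha\beta}D_\beta\vec u)+V\vec u=\vec f$ in the weak sense on $B_{2R}$, i.e. for every $\vec\phi\in W^{1,2}_{V,0}(B_{2R})$, $$\int_{B_{2R}}a^{\alpha\beta}\langle D_\beta\vec u,D_\alpha\vec\phi\rangle+\int_{B_{2R}}\langle V\vec u,\vec\phi\rangle=\int_{B_{2R}}\langle\vec f,\vec\phi\rangle .$$ Then for any $q\ge1$, $$\|\vec u\|_{L^\infty(B_R)}\le C\left[R^{-n/q}\|\vec u\|_{L^q(B_{2R})}+R^{2-n/\ell}\|\vec f\|_{L^\ell(B_{2R})}\right],$$ where the constant $C$ depends only on $n,d,\lambda,\Lambda,q,\ell$.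
   Context: Summation over repeated indices is used. Ellipticity: $\sum_{i,j,\alpha,\beta}A^{\alpha\beta}_{ij}(x)\xi^j_\beta\xi^i_\alpha\ge\lambda|\xi|^2$; boundedness: $\sum_{i,j,\alpha,\beta}A^{\alpha\beta}_{ij}(x)\xi^j_\beta\zeta^i_\alpha\le\Lambda|\xi||\zeta|$, for all $x\in\mathbb{R}^n$, $\xi,\zeta\in\mathbb{R}^{d\times n}$. Here $V$ is a matrix weight, i.e. a $d\times d$ real symmetric, a.e. positive semidefinite measurable matrix function on $\mathbb{R}^n$; $V\in\mathcal{ND}$ means $\int_EV$ is positive definite for every measurable $E$ with $|E|>0$. $\|\vec u\|^2_{W^{1,2}_V(\Omega)}=\int_\Omega\langle V\vec u,\vec u\rangle+|D\vec u|^2$; $W^{1,2}_{V,0}(\Omega)$ is the completion of $C_c^\infty(\Omega)^d$ in this norm, whose elements are identified with functions $\vec u\in L^{2n/(n-2)}(\Omega)$ with weak gradient in $L^2(\Omega)$ and $V^{1/2}\vec u\in L^2(\Omega)$; $W^{1,2}_V(\Omega)=\{\vec u|_\Omega:\vec u\in W^{1,2}_{V,0}(\mathbb{R}^n)\}$. *)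

theory Defs
  imports "HOL-Analysis.Analysis" "HOL-Probability.Essential_Supremum"
begin

subsection \<open>Lebesgue spaces\<close>

definition Lp_space :: "real \<Rightarrow> 'a::euclidean_space set \<Rightarrow> ('a \<Rightarrow> 'b::euclidean_space) set" where
  "Lp_space p \<Omega> = {f \<in> borel_measurable (lebesgue_on \<Omega>).
      integrable (lebesgue_on \<Omega>) (\<lambda>x. norm (f x) powr p)}"

text \<open>The norms take values in the extended nonnegative reals, so that they may be written
  down (and equal \<open>\<infinity>\<close>) for functions outside the space.\<close>

definition Lp_norm :: "real \<Rightarrow> 'a::euclidean_space set \<Rightarrow> ('a \<Rightarrow> 'b::euclidean_space) \<Rightarrow> ennreal" where
  "Lp_norm p \<Omega> f =
     (let I = (\<integral>\<^sup>+ x. ennreal (norm (f x) powr p) \<partial>lebesgue_on \<Omega>)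
      in if I = \<infinity> then \<infinity> else ennreal (enn2real I powr (1 / p)))"

definition Linf_norm :: "'a::euclidean_space set \<Rightarrow> ('a \<Rightarrow> 'b::euclidean_space) \<Rightarrow> ennreal" where
  "Linf_norm \<Omega> f = esssup (lebesgue_on \<Omega>) (\<lambda>x. ennreal (norm (f x)))"

definition Lp_loc :: "real \<Rightarrow> ('a::euclidean_space \<Rightarrow> 'b::euclidean_space) set" where
  "Lp_loc p = {f \<in> borel_measurable lebesgue. \<forall>K. compact K \<longrightarrow> f \<in> Lp_space p K}"

definition locally_integrable_on :: "('a::euclidean_space \<Rightarrow> 'b::euclidean_space) \<Rightarrow> 'a set \<Rightarrow> bool" where
  "locally_integrable_on f \<Omega> \<longleftrightarrow>
     (\<forall>K. compact K \<longrightarrow> K \<subseteq> \<Omega> \<longrightarrow> set_integrable lebesgue K f)"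


subsection \<open>Test functions and weak gradients\<close>

primrec Ck :: "nat \<Rightarrow> ('a::euclidean_space \<Rightarrow> 'b::real_normed_vector) \<Rightarrow> bool" where
  "Ck 0 f \<longleftrightarrow> continuous_on UNIV f"
| "Ck (Suc k) f \<longleftrightarrow> (\<forall>x. f differentiable (at x)) \<and>
     (\<forall>b\<in>Basis. Ck k (\<lambda>x. frechet_derivative f (at x) b))"

definition Cc_smooth :: "'a::euclidean_space set \<Rightarrow> ('a \<Rightarrow> 'b::real_normed_vector) set" where
  "Cc_smooth \<Omega> = {\<phi>. (\<forall>k. Ck k \<phi>) \<and>
      compact (closure {x. \<phi> x \<noteq> 0}) \<and> closure {x. \<phi> x \<noteq> 0} \<subseteq> \<Omega>}"

text \<open>Gradients are \<open>d \<times> n\<close> matrices: \<open>D x $ i $ \<alpha>\<close> is \<open>D\<^sub>\<alpha> u\<^sup>i(x)\<close>, so that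
  \<open>column \<alpha> (D x)\<close> is \<open>D\<^sub>\<alpha> u(x)\<close>, and the norm on \<open>real^'n^'d\<close> is the Frobenius norm.
  For smooth functions the gradient is the library's \<^const>\<open>jacobian\<close>.\<close>

definition has_weak_gradient ::
  "(real^'n::finite \<Rightarrow> real^'d::finite) \<Rightarrow> (real^'n \<Rightarrow> real^'n^'d) \<Rightarrow> (real^'n) set \<Rightarrow> bool" where
  "has_weak_gradient u Du \<Omega> \<longleftrightarrow>
     locally_integrable_on u \<Omega> \<and> locally_integrable_on Du \<Omega> \<and>
     (\<forall>\<phi>::real^'n \<Rightarrow> real. \<phi> \<in> Cc_smooth \<Omega> \<longrightarrow> (\<forall>\<alpha>.
        (LINT x:\<Omega>|lebesgue. frechet_derivative \<phi> (at x) (axis \<alpha> 1) *\<^sub>R u x)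
        = - (LINT x:\<Omega>|lebesgue. \<phi> x *\<^sub>R column \<alpha> (Du x))))"


subsection \<open>Coefficients\<close>

definition elliptic :: "(real^'n::finite \<Rightarrow> 'n \<Rightarrow> 'n \<Rightarrow> real^'d::finite^'d) \<Rightarrow> real \<Rightarrow> bool" where
  "elliptic A lam \<longleftrightarrow> (\<forall>x. \<forall>\<xi>::real^'n^'d.
     (\<Sum>i\<in>UNIV. \<Sum>j\<in>UNIV. \<Sum>\<alpha>\<in>UNIV. \<Sum>\<beta>\<in>UNIV.
        A x \<alpha> \<beta> $ i $ j * \<xi> $ j $ \<beta> * \<xi> $ i $ \<alpha>) \<ge> lam * (norm \<xi>)\<^sup>2)"

definition bounded_form :: "(real^'n::finite \<Rightarrow> 'n \<Rightarrow> 'n \<Rightarrow> real^'d::finite^'d) \<Rightarrow> real \<Rightarrow> bool" where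
  "bounded_form A Lam \<longleftrightarrow> (\<forall>x. \<forall>\<xi> \<zeta>::real^'n^'d.
     (\<Sum>i\<in>UNIV. \<Sum>j\<in>UNIV. \<Sum>\<alpha>\<in>UNIV. \<Sum>\<beta>\<in>UNIV.
        A x \<alpha> \<beta> $ i $ j * \<xi> $ j $ \<beta> * \<zeta> $ i $ \<alpha>) \<le> Lam * norm \<xi> * norm \<zeta>)"


subsection \<open>Matrix weights\<close>

definition pos_semidef :: "real^'d::finite^'d \<Rightarrow> bool" where
  "pos_semidef M \<longleftrightarrow> transpose M = M \<and> (\<forall>\<xi>. (M *v \<xi>) \<bullet> \<xi> \<ge> 0)"

definition pos_def :: "real^'d::finite^'d \<Rightarrow> bool" where
  "pos_def M \<longleftrightarrow> transpose M = M \<and> (\<forall>\<xi>. \<xi> \<noteq> 0 \<longrightarrow> (M *v \<xi>) \<bullet> \<xi> > 0)"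

definition matrix_weight :: "(real^'n::finite \<Rightarrow> real^'d::finite^'d) \<Rightarrow> bool" where
  "matrix_weight V \<longleftrightarrow> V \<in> borel_measurable lebesgue \<and>
     (\<forall>x. transpose (V x) = V x) \<and> (AE x in lebesgue. pos_semidef (V x))"

text \<open>The integral of \<open>V\<close> is a matrix only over sets on which \<open>V\<close> is integrable (elsewhere the
  Bochner integral is \<open>0\<close> by convention), hence the guard. For locally integrable weights it
  loses nothing: every set of positive measure contains a bounded subset of positive measure.\<close>

definition nondegenerate :: "(real^'n::finite \<Rightarrow> real^'d::finite^'d) \<Rightarrow> bool" where
  "nondegenerate V \<longleftrightarrow> (\<forall>E\<in>sets lebesgue. emeasure lebesgue E > 0 \<longrightarrow>
     set_integrable lebesgue E V \<longrightarrow> pos_def (LINT x:E|lebesgue. V x))"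


subsection \<open>Weighted Sobolev spaces and weak solutions\<close>

definition W12_normsq ::
  "(real^'n::finite \<Rightarrow> real^'d::finite^'d) \<Rightarrow> (real^'n) set \<Rightarrow>
   (real^'n \<Rightarrow> real^'d) \<Rightarrow> (real^'n \<Rightarrow> real^'n^'d) \<Rightarrow> ennreal" where
  "W12_normsq V \<Omega> u Du =
     (\<integral>\<^sup>+ x. ennreal ((V x *v u x) \<bullet> u x + (norm (Du x))\<^sup>2) \<partial>lebesgue_on \<Omega>)"

text \<open>The completion of the test functions, realised by functions: the function belonging to
  a Cauchy sequence of test functions is its limit in \<open>L\<^bsup>2n/(n-2)\<^esup>\<close>, which exists by the
  Sobolev inequality (\<open>n \<ge> 3\<close>). Membership of \<open>V\<^bsup>1/2\<^esup>u\<close> in \<open>L\<^sup>2\<close> is integrability of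
  \<open>\<langle>Vu,u\<rangle> = |V\<^bsup>1/2\<^esup>u|\<^sup>2\<close>. Values outside \<open>\<Omega>\<close> play no role.\<close>

definition W12V0 ::
  "(real^'n::finite \<Rightarrow> real^'d::finite^'d) \<Rightarrow> (real^'n) set \<Rightarrow> (real^'n \<Rightarrow> real^'d) set" where
  "W12V0 V \<Omega> = {u. let p = 2 * real CARD('n) / (real CARD('n) - 2) in
     u \<in> Lp_space p \<Omega> \<and>
     integrable (lebesgue_on \<Omega>) (\<lambda>x. (V x *v u x) \<bullet> u x) \<and>
     (\<exists>Du. has_weak_gradient u Du \<Omega> \<and> Du \<in> Lp_space 2 \<Omega> \<and>
        (\<exists>\<phi>::nat \<Rightarrow> real^'n \<Rightarrow> real^'d. (\<forall>k. \<phi> k \<in> Cc_smooth \<Omega>) \<and>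
           (\<lambda>k. Lp_norm p \<Omega> (\<lambda>x. u x - \<phi> k x)) \<longlonglongrightarrow> 0 \<and>
           (\<lambda>k. W12_normsq V \<Omega> (\<lambda>x. u x - \<phi> k x) (\<lambda>x. Du x - jacobian (\<phi> k) (at x)))
             \<longlonglongrightarrow> 0))}"

definition W12V ::
  "(real^'n::finite \<Rightarrow> real^'d::finite^'d) \<Rightarrow> (real^'n) set \<Rightarrow> (real^'n \<Rightarrow> real^'d) set" where
  "W12V V \<Omega> = {u. \<exists>U\<in>W12V0 V UNIV. AE x in lebesgue_on \<Omega>. u x = U x}"

text \<open>Weak gradients are unique up to null sets, so the choices of \<open>Du\<close> and \<open>D\<phi>\<close> are immaterial.\<close>

definition weak_solution ::
  "('n::finite \<Rightarrow> 'n \<Rightarrow> real^'n \<Rightarrow> real) \<Rightarrow> (real^'n \<Rightarrow> real^'d::finite^'d) \<Rightarrow>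
   (real^'n \<Rightarrow> real^'d) \<Rightarrow> (real^'n) set \<Rightarrow> (real^'n \<Rightarrow> real^'d) \<Rightarrow> bool" where
  "weak_solution a V f \<Omega> u \<longleftrightarrow>
     (\<exists>Du. has_weak_gradient u Du \<Omega> \<and>
       (\<forall>\<phi> D\<phi>. \<phi> \<in> W12V0 V \<Omega> \<longrightarrow> has_weak_gradient \<phi> D\<phi> \<Omega> \<longrightarrow>
          (LINT x:\<Omega>|lebesgue. (\<Sum>\<alpha>\<in>UNIV. \<Sum>\<beta>\<in>UNIV.
              a \<alpha> \<beta> x * (column \<beta> (Du x) \<bullet> column \<alpha> (D\<phi> x))))
          + (LINT x:\<Omega>|lebesgue. (V x *v u x) \<bullet> \<phi> x)
          = (LINT x:\<Omega>|lebesgue. f x \<bullet> \<phi> x)))"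

end

theory Submission
  imports Defs
begin

text \<open>
  The principal part of the system is diagonal and its potential has the good sign; for this reason the
  length of a solution behaves like a subsolution of a scalar elliptic equation, and Moser's iteration
  applies. Let \<open>t = |u|\<^sup>2 + \<kappa>\<^sup>2\<close> with \<open>\<kappa> > 0\<close>, and test the system with \<open>\<eta>\<^sup>2 h(t) u\<close>, where \<open>\<eta>\<close> is a cut-off
  function and \<open>h \<ge> 0\<close> is increasing. The potential contributes \<open>\<eta>\<^sup>2 h(t) \<langle>Vu,u\<rangle> \<ge> 0\<close> and is dropped, so
  the weight leaves no trace in the constants. Since \<open>a\<^bsup>\<alpha>\<beta>\<^esup> D\<^sub>\<beta>u \<bullet> u\<close> is half of \<open>a\<^bsup>\<alpha>\<beta>\<^esup> D\<^sub>\<beta>t\<close>, what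
  remains is an energy inequality for powers of \<open>t\<close> (\<open>energy_pointwise\<close>, \<open>Sobolev_energy\<close>). For
  \<open>\<kappa>\<close> slightly larger than \<open>R\<^bsup>2-n/l\<^esup>\<close> times the norm of \<open>f\<close>, the term \<open>f \<bullet> u\<close> is at most
  \<open>(|f|/\<kappa>) t\<close>, a potential whose norm in \<open>L\<^sup>l\<close> is bounded in a scale-invariant way; as \<open>l > n/2\<close>, the
  inequalities of Hoelder, Sobolev and Young absorb it (\<open>moser_step_truncated\<close>).

  The result is a reverse Hoelder inequality that raises the exponent of \<open>t\<close> by the factor \<open>n/(n-2)\<close>
  (\<open>moser_step_balls\<close>). Its iteration on shrinking balls bounds \<open>t\<close> on a ball by the mean of \<open>t\<close> on a
  larger one (\<open>local_boundedness_L2\<close>). Writing \<open>t\<close> as the product of two factors \<open>sqrt(t)\<close> and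
  estimating one of them by its supremum improves this to a bound by the mean of \<open>sqrt(t)\<close>
  (\<open>local_boundedness_L1\<close>). Hoelder's inequality replaces the mean by the norm in \<open>L\<^sup>q\<close>, and finally
  \<open>\<kappa>\<close> decreases to \<open>R\<^bsup>2-n/l\<^esup>\<close> times the norm of \<open>f\<close>.

  Powers of \<open>t\<close> are not admissible as test functions as long as \<open>u\<close> may be unbounded. They are replaced
  by the smooth truncations \<open>t\<^sup>s (1 + e t)\<^bsup>-s\<^esup>\<close>, and \<open>e\<close> tends to \<open>0\<close> in the end. With them the test
  function is \<open>\<eta>\<^sup>2 G(u)\<close> for a smooth map \<open>G\<close> with bounded derivative. If test functions \<open>\<phi>\<^sub>k\<close> converge
  to \<open>u\<close>, then the test functions \<open>\<eta>\<^sup>2 G(\<phi>\<^sub>k)\<close> converge to \<open>\<eta>\<^sup>2 G(u)\<close> in every norm that matters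
  (\<open>smooth_limit_chain\<close>), also in the weighted one since \<open>V\<close> is locally in \<open>L\<^bsup>n/2\<^esup>\<close>
  (\<open>smooth_limit_in_W12V0\<close>). The Sobolev inequality itself is proved for continuously differentiable
  functions by the method of Gagliardo and Nirenberg, from the inequality of Loomis and Whitney
  (\<open>Loomis_Whitney\<close>, \<open>Sobolev_C1\<close>), and carried over to these limits (\<open>smooth_limit_Sobolev\<close>).
\<close>

section \<open>Powers of extended nonnegative numbers and the inequality of Hoelder\<close>

text \<open>Powers of extended nonnegative numbers with \<open>\<infinity>\<close> a fixed point of every power. With this
  convention Hoelder's inequality needs no integrability hypotheses, and \<open>Lp_norm\<close> is
  \<open>epow\<close> of an integral.\<close>
definition epow :: "ennreal \<Rightarrow> real \<Rightarrow> ennreal" where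
  "epow x r = (if x = \<infinity> then \<infinity> else ennreal (enn2real x powr r))"

lemma epow_top [simp]: "epow \<infinity> r = \<infinity>" "epow top r = top"
  by (simp_all add: epow_def)

lemma epow_ennreal [simp]: "x \<ge> 0 \<Longrightarrow> epow (ennreal x) r = ennreal (x powr r)"
  by (simp add: epow_def)

lemma epow_0 [simp]: "epow 0 r = 0"
  by (simp add: epow_def)

lemma epow_one [simp]: "epow 1 r = 1"
  by (simp add: epow_def)

lemma epow_1 [simp]: "epow x 1 = x"
  by (cases x) auto

lemma epow_mono: "x \<le> y \<Longrightarrow> r \<ge> 0 \<Longrightarrow> epow x r \<le> epow y r"
  by (cases x; cases y) (auto simp: top_unique intro!: powr_mono2 ennreal_leI)

lemma epow_eq_0_iff [simp]: "epow x r = 0 \<longleftrightarrow> x = 0"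
  by (cases x) auto

lemma epow_eq_top_iff [simp]: "epow x r = top \<longleftrightarrow> x = top"
  by (cases x) auto

lemma epow_mult: "r > 0 \<Longrightarrow> epow (x * y) r = epow x r * epow y r"
  by (cases x; cases y) (auto simp: ennreal_mult[symmetric] powr_mult ennreal_mult_top ennreal_top_mult
      ennreal_mult_eq_top_iff)

lemma epow_epow: "epow (epow x r) s = epow x (r * s)"
  by (cases x) (auto simp: powr_powr)

lemma epow_measurable [measurable]: "f \<in> borel_measurable M \<Longrightarrow> (\<lambda>x. epow (f x) r) \<in> borel_measurable M"
  unfolding epow_def by (intro measurable_If) (auto simp: pred_def[symmetric])

lemma epow_less_top: "x < top \<Longrightarrow> epow x r < top"
  by (metis epow_eq_top_iff top.not_eq_extremum)

text \<open>Convexity of the exponential function, applied to the logarithms of the factors; a factor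
  \<open>0\<close> or \<open>\<infinity>\<close> decides the inequality by itself.\<close>
lemma weighted_arith_geo_mean_ennreal:
  assumes S: "finite S" "S \<noteq> {}" and w: "\<And>i. i \<in> S \<Longrightarrow> w i > 0" and s: "(\<Sum>i\<in>S. w i) = 1"
  shows "(\<Prod>i\<in>S. epow (x i) (w i)) \<le> (\<Sum>i\<in>S. ennreal (w i) * x i)"
proof -
  consider "\<exists>i\<in>S. x i = 0" | "\<exists>i\<in>S. x i = top" | "\<forall>i\<in>S. x i \<noteq> 0 \<and> x i \<noteq> top" by blast
  then show ?thesis
  proof cases
    case 1 then have "(\<Prod>i\<in>S. epow (x i) (w i)) = 0" using S by (intro prod_zero) auto
    then show ?thesis by (simp only: zero_le)
  next
    case 2 then obtain i where i: "i \<in> S" "x i = top" by blast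
    then have "ennreal (w i) * x i = top" using w[OF i(1)] by (simp add: ennreal_mult_top ennreal_eq_0_iff)
    then have "(\<Sum>i\<in>S. ennreal (w i) * x i) = top" using i S
        member_le_sum[of i S "\<lambda>i. ennreal (w i) * x i"] by (auto simp: top_unique)
    then show ?thesis by simp
  next
    case 3
    define y where "y i = enn2real (x i)" for i
    have y: "x i = ennreal (y i)" "y i > 0" if "i \<in> S" for i
      using 3 that by (auto simp: y_def enn2real_positive_iff top.not_eq_extremum zero_less_iff_neq_zero)
    have "(\<Prod>i\<in>S. y i powr w i) = exp (\<Sum>i\<in>S. w i * ln (y i))"
      using S y by (simp add: exp_sum powr_def mult.commute cong: prod.cong)
        (rule prod.cong, auto dest: y(2))
    also have "\<dots> \<le> (\<Sum>i\<in>S. w i * exp (ln (y i)))"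
      using convex_on_sum[OF S exp_convex s, of "\<lambda>i. ln (y i)"] w by (auto simp: less_imp_le)
    also have "\<dots> = (\<Sum>i\<in>S. w i * y i)"
      using y by (intro sum.cong) auto
    finally have "(\<Prod>i\<in>S. y i powr w i) \<le> (\<Sum>i\<in>S. w i * y i)" .
    then have "ennreal (\<Prod>i\<in>S. y i powr w i) \<le> ennreal (\<Sum>i\<in>S. w i * y i)" by (rule ennreal_leI)
    moreover have "ennreal (\<Prod>i\<in>S. y i powr w i) = (\<Prod>i\<in>S. epow (x i) (w i))"
      using y by (subst prod_ennreal[symmetric]) (auto intro!: prod.cong simp: less_imp_le)
    moreover have "ennreal (\<Sum>i\<in>S. w i * y i) = (\<Sum>i\<in>S. ennreal (w i) * x i)"
      using y w by (subst sum_ennreal[symmetric]) (auto intro!: sum.cong simp: less_imp_le ennreal_mult)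
    ultimately show ?thesis by simp
  qed
qed

text \<open>Once every factor is divided by its integral, the weighted arithmetic-geometric mean inequality
  can be integrated term by term. Any number of factors is needed for the inequality of Loomis and
  Whitney, three factors for the potential term in the energy estimate.\<close>
lemma nn_integral_Hoelder:
  assumes S: "finite S" "S \<noteq> {}" and w: "\<And>i. i \<in> S \<Longrightarrow> w i > 0" and s: "(\<Sum>i\<in>S. w i) = 1"
    and f[measurable]: "\<And>i. i \<in> S \<Longrightarrow> f i \<in> borel_measurable M"
  shows "(\<integral>\<^sup>+x. (\<Prod>i\<in>S. epow (f i x) (w i)) \<partial>M) \<le> (\<Prod>i\<in>S. epow (\<integral>\<^sup>+x. f i x \<partial>M) (w i))"
proof -
  define A where "A i = (\<integral>\<^sup>+x. f i x \<partial>M)" for i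
  consider "\<exists>i\<in>S. A i = 0" | "\<forall>i\<in>S. A i \<noteq> 0" "\<exists>i\<in>S. A i = top" | "\<forall>i\<in>S. A i \<noteq> 0 \<and> A i \<noteq> top" by blast
  then show ?thesis
  proof cases
    case 1
    then obtain i where i: "i \<in> S" "A i = 0" by blast
    then have "AE x in M. f i x = 0" unfolding A_def by (subst nn_integral_0_iff_AE[symmetric]) auto
    then have "AE x in M. (\<Prod>i\<in>S. epow (f i x) (w i)) = 0"
      by eventually_elim (use i S in auto)
    then have "(\<integral>\<^sup>+x. (\<Prod>i\<in>S. epow (f i x) (w i)) \<partial>M) = 0"
      by (subst nn_integral_0_iff_AE) auto
    then show ?thesis by simp
  next
    case 2
    then have "(\<Prod>i\<in>S. epow (A i) (w i)) = top"
      using S by (subst ennreal_prod_eq_top) auto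
    then show ?thesis by (simp add: A_def)
  next
    case 3
    have eq: "(\<Prod>i\<in>S. epow (f i x) (w i)) = (\<Prod>i\<in>S. epow (A i) (w i)) * (\<Prod>i\<in>S. epow (f i x / A i) (w i))" for x
    proof -
      have "f i x = A i * (f i x / A i)" if "i \<in> S" for i
        using 3 that by (simp add: ennreal_times_divide mult.commute[of "A i"] ennreal_mult_divide_eq)
      then have "(\<Prod>i\<in>S. epow (f i x) (w i)) = (\<Prod>i\<in>S. epow (A i * (f i x / A i)) (w i))" by simp
      also have "\<dots> = (\<Prod>i\<in>S. epow (A i) (w i) * epow (f i x / A i) (w i))"
        using w by (intro prod.cong refl epow_mult) auto
      finally show ?thesis by (simp add: prod.distrib)
    qed
    have "(\<integral>\<^sup>+x. (\<Prod>i\<in>S. epow (f i x) (w i)) \<partial>M)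
       \<le> (\<integral>\<^sup>+x. (\<Prod>i\<in>S. epow (A i) (w i)) * (\<Sum>i\<in>S. ennreal (w i) * (f i x / A i)) \<partial>M)"
      unfolding eq by (intro nn_integral_mono mult_left_mono weighted_arith_geo_mean_ennreal[OF S w s]) auto
    also have "\<dots> = (\<Prod>i\<in>S. epow (A i) (w i)) * (\<Sum>i\<in>S. ennreal (w i) * (A i / A i))"
      by (simp add: nn_integral_cmult nn_integral_sum nn_integral_divide A_def)
    also have "(\<Sum>i\<in>S. ennreal (w i) * (A i / A i)) = (\<Sum>i\<in>S. ennreal (w i))"
      using 3 by (intro sum.cong refl) (simp add: ennreal_divide_self top.not_eq_extremum)
    also have "\<dots> = 1" using w s by (subst sum_ennreal) (auto simp: less_imp_le)
    finally show ?thesis by (simp add: A_def)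
  qed
qed

lemma nn_integral_Hoelder2:
  assumes "a > 0" "b > 0" "a + b = (1::real)"
    and [measurable]: "f \<in> borel_measurable M" "g \<in> borel_measurable M"
  shows "(\<integral>\<^sup>+x. epow (f x) a * epow (g x) b \<partial>M) \<le> epow (\<integral>\<^sup>+x. f x \<partial>M) a * epow (\<integral>\<^sup>+x. g x \<partial>M) b"
  using nn_integral_Hoelder[of "UNIV::bool set" "\<lambda>i. if i then a else b" "\<lambda>i. if i then f else g" M] assms
  by (simp add: UNIV_bool mult.commute add.commute split: if_splits)

lemma nn_integral_Hoelder3:
  assumes "a > 0" "b > 0" "c > 0" "a + b + c = (1::real)"
    and [measurable]: "f \<in> borel_measurable M" "g \<in> borel_measurable M" "h \<in> borel_measurable M"
  shows "(\<integral>\<^sup>+x. epow (f x) a * epow (g x) b * epow (h x) c \<partial>M)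
    \<le> epow (\<integral>\<^sup>+x. f x \<partial>M) a * epow (\<integral>\<^sup>+x. g x \<partial>M) b * epow (\<integral>\<^sup>+x. h x \<partial>M) c"
  using nn_integral_Hoelder[of "{0,1,2::nat}" "\<lambda>i. if i = 0 then a else if i = 1 then b else c"
     "\<lambda>i. if i = 0 then f else if i = 1 then g else h" M] assms
  by (simp add: mult.assoc add.assoc split: if_splits)

section \<open>Smooth functions and cut-off functions\<close>

text \<open>All derivatives are available at once through \<open>Ck\<close>, so the closure properties are proved for
  every order by induction; the product rule turns a statement of order \<open>k + 1\<close> about two functions
  into statements of order \<open>k\<close> about their derivatives.\<close>
definition smooth :: "('a::euclidean_space \<Rightarrow> 'b::real_normed_vector) \<Rightarrow> bool" where
  "smooth f \<longleftrightarrow> (\<forall>k. Ck k f)"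

lemma Ck_SucI:
  assumes "\<And>x. (f has_derivative f' x) (at x)" "\<And>b. b \<in> Basis \<Longrightarrow> Ck k (\<lambda>x. f' x b)"
  shows "Ck (Suc k) f"
proof -
  have "frechet_derivative f (at x) = f' x" for x
    using frechet_derivative_at[OF assms(1)] by simp
  then show ?thesis using assms by (auto simp: differentiable_def)
qed

lemma Ck_SucD:
  assumes "Ck (Suc k) f"
  shows "(f has_derivative frechet_derivative f (at x)) (at x)"
    "b \<in> Basis \<Longrightarrow> Ck k (\<lambda>x. frechet_derivative f (at x) b)"
  using assms by (auto simp: frechet_derivative_works[symmetric])

lemma Ck_Suc_imp_Ck: "Ck (Suc k) f \<Longrightarrow> Ck k f"
proof (induction k arbitrary: f)
  case 0
  then show ?case by (auto intro!: continuous_at_imp_continuous_on differentiable_imp_continuous_within)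
next
  case (Suc k)
  show ?case
    by (rule Ck_SucI[OF Ck_SucD(1)[OF Suc.prems]]) (rule Suc.IH[OF Ck_SucD(2)[OF Suc.prems]])
qed

lemma Ck_const: "Ck k (\<lambda>x. c)"
  by (induction k arbitrary: c) (auto simp: frechet_derivative_const)

lemma Ck_bounded_linear: "bounded_linear L \<Longrightarrow> Ck k L"
proof (cases k)
  case (Suc j)
  assume "bounded_linear L"
  then show ?thesis unfolding Suc
    by (intro Ck_SucI[where f'="\<lambda>_. L"] Ck_const bounded_linear_imp_has_derivative)
qed (simp add: linear_continuous_on)

lemma Ck_add: "Ck k f \<Longrightarrow> Ck k g \<Longrightarrow> Ck k (\<lambda>x. f x + g x)"
proof (induction k arbitrary: f g)
  case 0 then show ?case by (auto intro: continuous_on_add)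
next
  case (Suc k)
  note D = Ck_SucD[OF Suc.prems(1)] Ck_SucD[OF Suc.prems(2)]
  show ?case
    by (rule Ck_SucI[OF has_derivative_add[OF D(1) D(3)]]) (intro Suc.IH D(2,4))
qed

lemma (in bounded_bilinear) Ck_bilinear: "Ck k f \<Longrightarrow> Ck k g \<Longrightarrow> Ck k (\<lambda>x. prod (f x) (g x))"
proof (induction k arbitrary: f g)
  case 0 then show ?case using continuous_on[of UNIV f g] by simp
next
  case (Suc k)
  note D = Ck_SucD[OF Suc.prems(1)] Ck_SucD[OF Suc.prems(2)]
  show ?case
    by (rule Ck_SucI[OF FDERIV[OF D(1) D(3)]])
      (intro Ck_add Suc.IH D(2,4) Ck_Suc_imp_Ck[OF Suc.prems(1)] Ck_Suc_imp_Ck[OF Suc.prems(2)])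
qed

lemmas Ck_mult = bounded_bilinear.Ck_bilinear[OF bounded_bilinear_mult]
lemmas Ck_scaleR = bounded_bilinear.Ck_bilinear[OF bounded_bilinear_scaleR]
lemmas Ck_inner = bounded_bilinear.Ck_bilinear[OF bounded_bilinear_inner]

lemma Ck_powr:
  fixes f :: "'a::euclidean_space \<Rightarrow> real"
  assumes "\<And>x. f x > 0"
  shows "Ck k f \<Longrightarrow> Ck k (\<lambda>x. f x powr r)"
proof (induction k arbitrary: r)
  case 0 then show ?case using assms by (auto intro!: continuous_on_powr simp: less_imp_neq[THEN not_sym])
next
  case (Suc k)
  note D = Ck_SucD[OF Suc.prems]
  have "((\<lambda>x. f x powr r) has_derivative
      (\<lambda>h. r * f x powr (r - 1) * frechet_derivative f (at x) h)) (at x)" for x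
    by (rule DERIV_compose_FDERIV[OF _ D(1), where f="\<lambda>y. y powr r", THEN has_derivative_eq_rhs])
      (use assms[of x] in \<open>auto intro!: derivative_eq_intros simp: mult.commute\<close>)
  then show ?case
    by (rule Ck_SucI) (intro Ck_mult Ck_const Suc.IH D(2) Ck_Suc_imp_Ck[OF Suc.prems])
qed

text \<open>A function of one real variable is given here together with the sequence of all its derivatives;
  the induction moves along that sequence.\<close>
lemma Ck_compose_real:
  fixes f :: "'a::euclidean_space \<Rightarrow> real"
  assumes S: "\<And>i s. ((S i) has_real_derivative S (Suc i) s) (at s)"
  shows "Ck k f \<Longrightarrow> Ck k (\<lambda>x. S i (f x))"
proof (induction k arbitrary: i)
  case 0
  have "continuous_on UNIV (S i)" by (intro continuous_at_imp_continuous_on ballI DERIV_isCont[OF S])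
  with 0 show ?case by (auto intro: continuous_on_compose2)
next
  case (Suc k)
  note D = Ck_SucD[OF Suc.prems]
  have "((\<lambda>x. S i (f x)) has_derivative (\<lambda>h. S (Suc i) (f x) * frechet_derivative f (at x) h)) (at x)" for x
    by (rule DERIV_compose_FDERIV[OF S D(1), THEN has_derivative_eq_rhs]) (auto simp: mult.commute)
  then show ?case
    by (rule Ck_SucI) (intro Ck_mult Suc.IH D(2) Ck_Suc_imp_Ck[OF Suc.prems])
qed

lemma smooth_imp_Ck: "smooth f \<Longrightarrow> Ck k f" by (simp add: smooth_def)

lemma smooth_const: "smooth (\<lambda>x. c)"
  by (simp add: smooth_def Ck_const)

lemma smooth_bounded_linear: "bounded_linear L \<Longrightarrow> smooth L"
  by (simp add: smooth_def Ck_bounded_linear)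

lemma smooth_add: "smooth f \<Longrightarrow> smooth g \<Longrightarrow> smooth (\<lambda>x. f x + g x)"
  by (simp add: smooth_def Ck_add)

lemma smooth_mult: "smooth f \<Longrightarrow> smooth g \<Longrightarrow> smooth (\<lambda>x. f x * g x)"
  for f g :: "'a::euclidean_space \<Rightarrow> real"
  by (simp add: smooth_def Ck_mult)

lemma smooth_scaleR: "smooth f \<Longrightarrow> smooth g \<Longrightarrow> smooth (\<lambda>x. f x *\<^sub>R g x)"
  by (simp add: smooth_def Ck_scaleR)

lemma smooth_inner: "smooth f \<Longrightarrow> smooth g \<Longrightarrow> smooth (\<lambda>x. f x \<bullet> g x)"
  by (simp add: smooth_def Ck_inner)

lemma smooth_powr: "smooth f \<Longrightarrow> (\<And>x. f x > 0) \<Longrightarrow> smooth (\<lambda>x. f x powr r)"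
  for f :: "'a::euclidean_space \<Rightarrow> real"
  by (auto simp: smooth_def Ck_powr)

lemma smooth_prod: "finite I \<Longrightarrow> (\<And>i. i \<in> I \<Longrightarrow> smooth (f i)) \<Longrightarrow> smooth (\<lambda>x. \<Prod>i\<in>I. f i x)"
  for f :: "'i \<Rightarrow> 'a::euclidean_space \<Rightarrow> real"
  by (induction I rule: finite_induct) (auto intro: smooth_const smooth_mult)

lemma smooth_has_derivative:
  "smooth f \<Longrightarrow> (f has_derivative frechet_derivative f (at x)) (at x)"
  using Ck_SucD(1) smooth_imp_Ck by blast

lemma smooth_continuous_on: "smooth f \<Longrightarrow> continuous_on S f"
  using smooth_imp_Ck[of f 0] by (auto intro: continuous_on_subset)

lemma bounded_linear_frechet_derivative: "smooth f \<Longrightarrow> bounded_linear (frechet_derivative f (at x))"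
  using smooth_has_derivative has_derivative_bounded_linear by blast

lemma smooth_frechet_derivative:
  assumes "smooth f"
  shows "smooth (\<lambda>x. frechet_derivative f (at x) v)"
proof -
  have *: "frechet_derivative f (at x) v = (\<Sum>b\<in>Basis. (v \<bullet> b) *\<^sub>R frechet_derivative f (at x) b)" for x
  proof -
    interpret bounded_linear "frechet_derivative f (at x)" using assms by (rule bounded_linear_frechet_derivative)
    have "frechet_derivative f (at x) v = frechet_derivative f (at x) (\<Sum>b\<in>Basis. (v \<bullet> b) *\<^sub>R b)"
      by (simp add: euclidean_representation)
    then show ?thesis by (simp add: sum scaleR)
  qed
  have "smooth (\<lambda>x. \<Sum>b\<in>B. (v \<bullet> b) *\<^sub>R frechet_derivative f (at x) b)" if "finite B" "B \<subseteq> Basis" for B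
    using that
  proof (induction B rule: finite_induct)
    case (insert b B)
    have "smooth (\<lambda>x. frechet_derivative f (at x) b)"
      using assms insert.prems Ck_SucD(2)[of _ f b] unfolding smooth_def by blast
    with insert show ?case by (auto intro!: smooth_add smooth_scaleR smooth_const)
  qed (auto intro: smooth_const)
  from this[of Basis] show ?thesis unfolding * by auto
qed

text \<open>The functions \<open>p(1/s) exp(-1/s)\<close>, extended by \<open>0\<close>, form a class closed under differentiation;
  the case \<open>p = 1\<close> is therefore smooth, including at the origin.\<close>
definition expoly :: "real poly \<Rightarrow> real \<Rightarrow> real" where
  "expoly p s = (if s > 0 then poly p (1 / s) * exp (- (1 / s)) else 0)"

lemma tendsto_poly_exp_neg: "((\<lambda>y. poly p y * exp (- y)) \<longlongrightarrow> 0) (at_top :: real filter)"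
proof -
  have *: "((\<lambda>y. y ^ k * poly p y * exp (- y)) \<longlongrightarrow> 0) (at_top :: real filter)" for k
  proof (induction p arbitrary: k)
    case (pCons a p)
    have "((\<lambda>y. a * (y ^ k / exp y) + y ^ Suc k * poly p y * exp (- y)) \<longlongrightarrow> a * 0 + 0) (at_top :: real filter)"
      by (intro tendsto_intros tendsto_power_div_exp_0 pCons.IH)
    then show ?case
      by (rule filterlim_mono_eventually) (auto simp: algebra_simps exp_minus divide_simps)
  qed simp
  from *[of 0] show ?thesis by simp
qed

lemma expoly_has_derivative:
  "(expoly p has_real_derivative expoly ([:0, 0, 1:] * (p - pderiv p)) s) (at s)"
proof -
  consider "s > 0" | "s < 0" | "s = 0" by linarith
  then show ?thesis
  proof cases
    case 1
    have "((\<lambda>s. poly p (1 / s) * exp (- (1 / s))) has_real_derivative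
        expoly ([:0, 0, 1:] * (p - pderiv p)) s) (at s)"
      using 1 by (auto intro!: derivative_eq_intros DERIV_chain2[OF poly_DERIV]
          simp: expoly_def field_simps power2_eq_square)
    then show ?thesis
      by (rule has_field_derivative_transform_within_open[where S="{0<..}"]) (use 1 in \<open>auto simp: expoly_def\<close>)
  next
    case 2
    have "((\<lambda>s. 0) has_real_derivative 0) (at s)" by simp
    then have "(expoly p has_real_derivative 0) (at s)"
      by (rule has_field_derivative_transform_within_open[where S="{..<0}"]) (use 2 in \<open>auto simp: expoly_def\<close>)
    with 2 show ?thesis by (simp add: expoly_def)
  next
    case 3
    have "((\<lambda>h. poly (pCons 0 p) (inverse h) * exp (- inverse h)) \<longlongrightarrow> 0) (at_right 0)"
      by (rule filterlim_compose[OF tendsto_poly_exp_neg filterlim_inverse_at_top_right])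
    then have r: "((\<lambda>h. expoly p h / h) \<longlongrightarrow> 0) (at_right 0)"
      by (rule filterlim_mono_eventually)
        (auto simp: expoly_def eventually_at_filter inverse_eq_divide)
    have l: "((\<lambda>h. expoly p h / h) \<longlongrightarrow> 0) (at_left 0)"
      by (rule tendsto_eventually) (auto simp: expoly_def eventually_at_filter)
    have "((\<lambda>h. expoly p h / h) \<longlongrightarrow> 0) (at 0)"
      using l r by (rule filterlim_split_at)
    then show ?thesis using 3 by (simp add: DERIV_def expoly_def)
  qed
qed

primrec expolys :: "nat \<Rightarrow> real poly" where
  "expolys 0 = 1"
| "expolys (Suc i) = [:0, 0, 1:] * (expolys i - pderiv (expolys i))"

text \<open>The \<open>i\<close>-th derivative of \<open>exp(-1/s)\<close>.\<close>
definition flat_exp :: "nat \<Rightarrow> real \<Rightarrow> real" where "flat_exp i = expoly (expolys i)"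

lemma flat_exp_deriv: "(flat_exp i has_real_derivative flat_exp (Suc i) s) (at s)"
  using expoly_has_derivative[of "expolys i" s] by (simp add: flat_exp_def)

lemma flat_exp_0: "s \<le> 0 \<Longrightarrow> flat_exp i s = 0" "s > 0 \<Longrightarrow> flat_exp 0 s > 0" "flat_exp 0 s \<ge> 0"
  by (auto simp: flat_exp_def expoly_def)

text \<open>A smooth transition from \<open>0\<close> on \<open>s \<le> 0\<close> to \<open>1\<close> on \<open>s \<ge> 1\<close>. The two summands of the denominator
  never vanish together.\<close>
definition step :: "real \<Rightarrow> real" where
  "step s = flat_exp 0 s * (flat_exp 0 s + flat_exp 0 (1 - s)) powr (-1)"

lemma step_denom_pos: "flat_exp 0 s + flat_exp 0 (1 - s) > 0"
  using flat_exp_0(2,3)[of s] flat_exp_0(2,3)[of "1-s"] by (cases "s > 0") auto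

lemma step_0: "s \<le> 0 \<Longrightarrow> step s = 0" and step_1: "s \<ge> 1 \<Longrightarrow> step s = 1"
  and step_nonneg: "step s \<ge> 0" and step_le_1: "step s \<le> 1"
proof -
  have *: "step s = flat_exp 0 s / (flat_exp 0 s + flat_exp 0 (1 - s))" for s
    using step_denom_pos[of s] by (simp add: step_def powr_minus_divide)
  show "s \<le> 0 \<Longrightarrow> step s = 0" "s \<ge> 1 \<Longrightarrow> step s = 1" "step s \<ge> 0" "step s \<le> 1"
    using step_denom_pos[of s] flat_exp_0(3)[of s] flat_exp_0(3)[of "1-s"]
    by (auto simp: * flat_exp_0 divide_le_eq)
      (auto simp: flat_exp_0 flat_exp_0(2)[THEN less_imp_neq, THEN not_sym])
qed

lemma smooth_step: "smooth f \<Longrightarrow> smooth (\<lambda>x. step (f x))"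
proof -
  assume f: "smooth f"
  have 1: "smooth (\<lambda>x. flat_exp 0 (g x))" if "smooth g" for g :: "'a \<Rightarrow> real"
    using that Ck_compose_real[of flat_exp, OF flat_exp_deriv, where i=0] by (auto simp: smooth_def)
  have "smooth (\<lambda>x. 1 + (-1) * f x)" by (intro smooth_add smooth_mult smooth_const f)
  then have 2: "smooth (\<lambda>x. 1 - f x)" by simp
  show ?thesis unfolding step_def
    by (intro smooth_mult smooth_powr smooth_add 1 f 2 step_denom_pos)
qed

lemma step_deriv_bounded:
  "\<exists>step' c. c > 0 \<and> (\<forall>s. (step has_real_derivative step' s) (at s)) \<and> (\<forall>s. \<bar>step' s\<bar> \<le> c) \<and> (\<forall>s<0. step' s = 0)"
proof -
  let ?e = "flat_exp 0" and ?e' = "flat_exp 1"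
  let ?d = "\<lambda>s. ?e s + ?e (1 - s)"
  define step' where "step' s = ?e' s * ?d s powr (-1) - ?e s * ?d s powr (-2) * (?e' s - ?e' (1 - s))" for s
  have e': "(?e has_real_derivative ?e' s) (at s)" for s using flat_exp_deriv[of 0 s] by simp
  have D: "(step has_real_derivative step' s) (at s)" for s
    unfolding step_def[abs_def] step'_def
    by (rule derivative_eq_intros e' DERIV_chain2[OF e'] refl step_denom_pos | simp add: algebra_simps)+
  have cont: "continuous_on UNIV (flat_exp i)" for i
    by (intro continuous_at_imp_continuous_on ballI DERIV_isCont[OF flat_exp_deriv])
  have "continuous_on UNIV step'" unfolding step'_def
    by (intro continuous_intros continuous_on_compose2[OF cont]) (use step_denom_pos in \<open>auto simp: less_imp_neq[THEN not_sym]\<close>)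
  then have "bounded (step' ` {0..1})"
    by (intro compact_imp_bounded compact_continuous_image) (auto intro: continuous_on_subset)
  then obtain c where c: "c > 0" "\<And>s. s \<in> {0..1} \<Longrightarrow> \<bar>step' s\<bar> \<le> c"
    by (auto simp: bounded_pos)
  have neg: "step' s = 0" if "s < 0" for s using that by (simp add: step'_def flat_exp_0)
  have pos: "step' s = 0" if "s > 1" for s
    using that flat_exp_0(2)[of s]
    by (simp add: step'_def flat_exp_0 powr_minus_divide powr_numeral power2_eq_square)
  have "\<bar>step' s\<bar> \<le> c" for s
    using c neg[of s] pos[of s] by (cases "s < 0"; cases "s > 1") auto
  with c D neg show ?thesis by blast
qed

text \<open>A single constant must serve all pairs of radii, since infinitely many of them occur in one
  iteration. It comes from composing one fixed transition function with
  \<open>(\<rho>\<^sup>2 - |x|\<^sup>2) / (\<rho>\<^sup>2 - r\<^sup>2)\<close>, whose gradient is at most \<open>2 / (\<rho> - r)\<close> on the ball of radius \<open>\<rho>\<close>.\<close>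
lemma cutoff_exists:
  "\<exists>c>0. \<forall>r \<rho>. 0 < r \<longrightarrow> r < \<rho> \<longrightarrow> (\<exists>\<eta>::'a::euclidean_space \<Rightarrow> real. smooth \<eta> \<and> (\<forall>x. 0 \<le> \<eta> x \<and> \<eta> x \<le> 1) \<and>
     (\<forall>x. norm x \<le> r \<longrightarrow> \<eta> x = 1) \<and> (\<forall>x. \<rho> \<le> norm x \<longrightarrow> \<eta> x = 0) \<and>
     (\<forall>x v. \<bar>frechet_derivative \<eta> (at x) v\<bar> \<le> c / (\<rho> - r) * norm v))"
proof -
  obtain step' c where c: "c > 0" and D: "\<And>s. (step has_real_derivative step' s) (at s)"
    and b: "\<And>s. \<bar>step' s\<bar> \<le> c" and neg: "\<And>s. s < 0 \<Longrightarrow> step' s = 0"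
    using step_deriv_bounded by blast
  have "\<exists>\<eta>::'a::euclidean_space \<Rightarrow> real. smooth \<eta> \<and> (\<forall>x. 0 \<le> \<eta> x \<and> \<eta> x \<le> 1) \<and>
     (\<forall>x. norm x \<le> r \<longrightarrow> \<eta> x = 1) \<and> (\<forall>x. \<rho> \<le> norm x \<longrightarrow> \<eta> x = 0) \<and>
     (\<forall>x v. \<bar>frechet_derivative \<eta> (at x) v\<bar> \<le> (2 * c) / (\<rho> - r) * norm v)" if r: "0 < r" "r < \<rho>" for r \<rho>
  proof -
    define K where "K = 1 / (\<rho>\<^sup>2 - r\<^sup>2)"
    have K: "K > 0" using r by (simp add: K_def power_strict_mono)
    define g :: "'a \<Rightarrow> real" where "g x = K * (\<rho>\<^sup>2 + (-1) * (x \<bullet> x))" for x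
    define \<eta> where "\<eta> x = step (g x)" for x
    have "smooth g" unfolding g_def
      by (intro smooth_mult smooth_add smooth_const smooth_inner smooth_bounded_linear bounded_linear_ident)
    then have "smooth \<eta>" unfolding \<eta>_def by (rule smooth_step)
    moreover have "\<eta> x = 1" if "norm x \<le> r" for x
    proof -
      have "x \<bullet> x \<le> r\<^sup>2" using that by (simp add: power2_norm_eq_inner[symmetric] power_mono)
      then have "1 \<le> g x" using r K by (simp add: g_def K_def field_simps power_strict_mono)
      then show ?thesis by (simp add: \<eta>_def step_1)
    qed
    moreover have "\<eta> x = 0" if "norm x \<ge> \<rho>" for x
    proof -
      have "x \<bullet> x \<ge> \<rho>\<^sup>2" using that r by (simp add: power2_norm_eq_inner[symmetric] power_mono)
      then have "g x \<le> 0" using K by (simp add: g_def mult_le_0_iff)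
      then show ?thesis by (simp add: \<eta>_def step_0)
    qed
    moreover have "\<bar>frechet_derivative \<eta> (at x) v\<bar> \<le> (2 * c) / (\<rho> - r) * norm v" for x v
    proof -
      have g': "(g has_derivative (\<lambda>h. K * (- 2 * (x \<bullet> h)))) (at x)"
        unfolding g_def by (auto intro!: derivative_eq_intros simp: inner_commute)
      have "(\<eta> has_derivative (\<lambda>h. step' (g x) * (K * (- 2 * (x \<bullet> h))))) (at x)"
        unfolding \<eta>_def by (rule DERIV_compose_FDERIV[OF D g', THEN has_derivative_eq_rhs]) (auto simp: mult.commute)
      then have eq: "frechet_derivative \<eta> (at x) v = step' (g x) * (K * (- 2 * (x \<bullet> v)))"
        by (metis frechet_derivative_at)
      show ?thesis
      proof (cases "norm x \<le> \<rho>")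
        case True
        have "\<bar>frechet_derivative \<eta> (at x) v\<bar> = \<bar>step' (g x)\<bar> * (K * (2 * \<bar>x \<bullet> v\<bar>))"
          using K by (simp add: eq abs_mult)
        also have "\<dots> \<le> c * (K * (2 * (\<rho> * norm v)))"
          using b[of "g x"] K c True Cauchy_Schwarz_ineq2[of x v] mult_right_mono[OF True norm_ge_zero[of v]]
          by (intro mult_mono) auto
        also have "\<dots> = (2 * c) * (K * \<rho>) * norm v" by simp
        also have "\<dots> \<le> (2 * c) * (1 / (\<rho> - r)) * norm v"
        proof (intro mult_right_mono mult_left_mono)
          have "K = 1 / ((\<rho> - r) * (\<rho> + r))" by (simp add: K_def power2_eq_square algebra_simps)
          then have "K * \<rho> = 1 / (\<rho> - r) * (\<rho> / (\<rho> + r))" by simp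
          also have "\<dots> \<le> 1 / (\<rho> - r) * 1" using r by (intro mult_left_mono) auto
          finally show "K * \<rho> \<le> 1 / (\<rho> - r)" by simp
        qed (use c in auto)
        finally show ?thesis by simp
      next
        case False
        then have "x \<bullet> x > \<rho>\<^sup>2" using r by (simp add: power2_norm_eq_inner[symmetric] power_strict_mono)
        then have "g x < 0" using K by (simp add: g_def mult_less_0_iff)
        then show ?thesis using neg c r by (simp add: eq)
      qed
    qed
    ultimately show ?thesis using step_nonneg step_le_1 unfolding \<eta>_def by blast
  qed
  then show ?thesis using c by (intro exI[of _ "2 * c"]) auto
qed

text \<open>Boxes, rather than balls, are approximated because they form an intersection-stable generator of
  the Borel sets.\<close>
lemma box_smooth_approx:
  fixes l u :: "'a::euclidean_space"
  shows "\<exists>\<zeta>::nat \<Rightarrow> 'a \<Rightarrow> real. (\<forall>m. smooth (\<zeta> m)) \<and> (\<forall>m x. 0 \<le> \<zeta> m x \<and> \<zeta> m x \<le> 1) \<and>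
     (\<forall>m x. x \<notin> box l u \<longrightarrow> \<zeta> m x = 0) \<and> (\<forall>x. (\<lambda>m. \<zeta> m x) \<longlonglongrightarrow> indicator (box l u) x)"
proof -
  define \<zeta> :: "nat \<Rightarrow> 'a \<Rightarrow> real" where
    "\<zeta> m x = (\<Prod>b\<in>Basis. step (real m * ((x \<bullet> b) + - (l \<bullet> b))) * step (real m * ((u \<bullet> b) + (-1) * (x \<bullet> b))))" for m x
  have "smooth (\<zeta> m)" for m
    unfolding \<zeta>_def by (intro smooth_prod smooth_mult smooth_step smooth_add smooth_const
        smooth_inner smooth_bounded_linear bounded_linear_ident finite_Basis)
  moreover have "0 \<le> \<zeta> m x" "\<zeta> m x \<le> 1" for m x
    unfolding \<zeta>_def by (auto intro!: prod_nonneg prod_le_1 mult_le_one simp: step_nonneg step_le_1)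
  moreover have z: "\<zeta> m x = 0" if "x \<notin> box l u" for m x
  proof -
    obtain b where "b \<in> Basis" "x \<bullet> b \<le> l \<bullet> b \<or> u \<bullet> b \<le> x \<bullet> b" using \<open>x \<notin> box l u\<close>
      by (auto simp: mem_box not_less)
    then show ?thesis unfolding \<zeta>_def
      by (intro prod_zero) (auto intro!: bexI[of _ b] step_0 simp: mult_nonneg_nonpos)
  qed
  moreover have "(\<lambda>m. \<zeta> m x) \<longlonglongrightarrow> indicator (box l u) x" for x
  proof (cases "x \<in> box l u")
    case True
    have st: "(\<lambda>m. step (real m * s)) \<longlonglongrightarrow> 1" if "s > 0" for s
    proof (rule tendsto_eventually)
      show "\<forall>\<^sub>F m in sequentially. step (real m * s) = 1"
        using eventually_ge_at_top[of "nat \<lceil>1 / s\<rceil>"]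
      proof eventually_elim
        case (elim m)
        then have "1 / s \<le> real m" by linarith
        then show ?case using that by (intro step_1) (simp add: field_simps)
      qed
    qed
    have "(\<lambda>m. \<zeta> m x) \<longlonglongrightarrow> (\<Prod>b\<in>(Basis::'a set). 1 * 1)"
      unfolding \<zeta>_def using True by (intro tendsto_intros st) (auto simp: mem_box)
    with True show ?thesis by simp
  qed (simp add: z)
  ultimately show ?thesis by blast
qed

section \<open>The Sobolev inequality\<close>

lemma prod_mono_ennreal: "(\<And>i. i \<in> S \<Longrightarrow> f i \<le> (g i :: ennreal)) \<Longrightarrow> prod f S \<le> prod g S"
  by (induction S rule: infinite_finite_induct) (auto intro: mult_mono)

text \<open>Induction over the set \<open>J\<close> of coordinates that have been integrated. A factor with index in \<open>J\<close>
  no longer depends on its own coordinate. When \<open>j\<close> joins \<open>J\<close>, the factor with index \<open>j\<close> is thus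
  constant in the new variable, and Hoelder's inequality applies to the remaining \<open>card K - 1\<close>
  factors, whose exponents add up to \<open>1\<close>.\<close>
lemma Loomis_Whitney_PiM:
  fixes K :: "'i set" and f :: "'i \<Rightarrow> ('i \<Rightarrow> real) \<Rightarrow> ennreal"
  assumes K: "finite K" "card K \<ge> 2" and J: "J \<subseteq> K"
    and f: "\<And>i. i \<in> K \<Longrightarrow> f i \<in> borel_measurable (PiM J (\<lambda>_. lborel))"
  shows "(\<integral>\<^sup>+x. (\<Prod>i\<in>J. epow (\<integral>\<^sup>+t. f i (x(i := t)) \<partial>lborel) (1 / (real (card K) - 1)))
              * (\<Prod>i\<in>K - J. epow (f i x) (1 / (real (card K) - 1))) \<partial>PiM J (\<lambda>_. lborel))
         \<le> (\<Prod>i\<in>K. epow (\<integral>\<^sup>+x. f i x \<partial>PiM J (\<lambda>_. lborel)) (1 / (real (card K) - 1)))"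
proof -
  interpret product_sigma_finite "\<lambda>_::'i. lborel :: real measure" by standard
  let ?\<theta> = "1 / (real (card K) - 1)"
  have \<theta>: "?\<theta> > 0" using K by simp
  have "finite J" using J K finite_subset by blast
  then show ?thesis using J f
  proof (induction J arbitrary: f rule: finite_induct)
    case empty
    then show ?case by (simp add: PiM_empty nn_integral_count_space_finite)
  next
    case (insert j J)
    have jK: "j \<in> K" and JK: "J \<subseteq> K" using insert.prems by auto
    note meas = insert.prems(2)
    define g where "g y i x = (if i = j then (\<integral>\<^sup>+t. f j (x(j := t)) \<partial>lborel) else f i (x(j := y)))" for y i and x :: "'i \<Rightarrow> real"
    have upd: "(\<lambda>x. x(j := y)) \<in> PiM J (\<lambda>_. lborel) \<rightarrow>\<^sub>M PiM (insert j J) (\<lambda>_. lborel)" for y :: real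
      by (rule measurable_fun_upd[of _ J]) auto
    have pairm: "(\<lambda>(x, y). f i (x(j := y))) \<in> borel_measurable (PiM J (\<lambda>_. lborel) \<Otimes>\<^sub>M lborel)" if "i \<in> K" for i
      using measurable_compose[OF measurable_add_dim meas[OF that]] by (simp add: split_beta' fun_upd_def)
    have gj: "(\<lambda>x. \<integral>\<^sup>+t. f j (x(j := t)) \<partial>lborel) \<in> borel_measurable (PiM J (\<lambda>_. lborel))"
      using pairm[OF jK] by (rule lborel.borel_measurable_nn_integral)
    have gm: "g y i \<in> borel_measurable (PiM J (\<lambda>_. lborel))" if "i \<in> K" for y i
      using gj measurable_compose[OF upd meas[OF that]] by (cases "i = j") (auto simp: g_def[abs_def] fun_upd_def)
    interpret PJ: sigma_finite_measure "PiM J (\<lambda>_. lborel :: real measure)"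
      by (rule sigma_finite) (fact insert.hyps)
    have ym: "(\<lambda>y. \<integral>\<^sup>+x. f i (x(j := y)) \<partial>PiM J (\<lambda>_. lborel)) \<in> borel_measurable lborel" if "i \<in> K" for i
    proof -
      have "(\<lambda>(y, x). f i (x(j := y))) \<in> borel_measurable (lborel \<Otimes>\<^sub>M PiM J (\<lambda>_. lborel))"
        using measurable_compose[OF measurable_pair_swap' pairm[OF that]] by (simp add: split_beta' fun_upd_def cong: if_cong)
      then show ?thesis by (rule PJ.borel_measurable_nn_integral)
    qed
    have KJ: "K - J = insert j (K - insert j J)" "j \<notin> K - insert j J" using jK insert.hyps by auto
    have "(\<integral>\<^sup>+x. (\<Prod>i\<in>insert j J. epow (\<integral>\<^sup>+t. f i (x(i := t)) \<partial>lborel) ?\<theta>)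
              * (\<Prod>i\<in>K - insert j J. epow (f i x) ?\<theta>) \<partial>PiM (insert j J) (\<lambda>_. lborel))
       = (\<integral>\<^sup>+y. (\<integral>\<^sup>+x. (\<Prod>i\<in>insert j J. epow (\<integral>\<^sup>+t. f i (x(j := y, i := t)) \<partial>lborel) ?\<theta>)
              * (\<Prod>i\<in>K - insert j J. epow (f i (x(j := y))) ?\<theta>) \<partial>PiM J (\<lambda>_. lborel)) \<partial>lborel)"
    proof (rule product_nn_integral_insert_rev[OF insert.hyps])
      have *: "(\<lambda>x. \<integral>\<^sup>+t. f i (x(i := t)) \<partial>lborel) \<in> borel_measurable (PiM (insert j J) (\<lambda>_. lborel))"
        if "i \<in> insert j J" for i
      proof -
        have i: "i \<in> K" using that insert.prems by auto
        have "(\<lambda>(x, t). x(i := t)) \<in> PiM (insert j J) (\<lambda>_. lborel) \<Otimes>\<^sub>M lborel \<rightarrow>\<^sub>M PiM (insert j J) (\<lambda>_. lborel :: real measure)"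
          unfolding split_beta' by (rule measurable_fun_upd[of _ "insert j J"]) (use that in auto)
        from measurable_compose[OF this meas[OF i]]
        show ?thesis by (intro lborel.borel_measurable_nn_integral) (simp add: split_beta' fun_upd_def)
      qed
      show "(\<lambda>x. (\<Prod>i\<in>insert j J. epow (\<integral>\<^sup>+t. f i (x(i := t)) \<partial>lborel) ?\<theta>)
              * (\<Prod>i\<in>K - insert j J. epow (f i x) ?\<theta>)) \<in> borel_measurable (PiM (insert j J) (\<lambda>_. lborel))"
        by (intro borel_measurable_times_ennreal borel_measurable_prod_ennreal epow_measurable * meas) auto
    qed
    also have "\<dots> = (\<integral>\<^sup>+y. (\<integral>\<^sup>+x. (\<Prod>i\<in>J. epow (\<integral>\<^sup>+t. g y i (x(i := t)) \<partial>lborel) ?\<theta>)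
              * (\<Prod>i\<in>K - J. epow (g y i x) ?\<theta>) \<partial>PiM J (\<lambda>_. lborel)) \<partial>lborel)"
    proof (intro nn_integral_cong)
      fix y :: real and x :: "'i \<Rightarrow> real"
      have "(\<Prod>i\<in>J. epow (\<integral>\<^sup>+t. f i (x(j := y, i := t)) \<partial>lborel) ?\<theta>)
          = (\<Prod>i\<in>J. epow (\<integral>\<^sup>+t. g y i (x(i := t)) \<partial>lborel) ?\<theta>)"
      proof (intro prod.cong refl)
        fix i assume "i \<in> J"
        then have "i \<noteq> j" using insert.hyps by auto
        then have "x(j := y, i := t) = x(i := t, j := y)" for t by (rule fun_upd_twist[OF not_sym])
        with \<open>i \<noteq> j\<close> show "epow (\<integral>\<^sup>+t. f i (x(j := y, i := t)) \<partial>lborel) ?\<theta> = epow (\<integral>\<^sup>+t. g y i (x(i := t)) \<partial>lborel) ?\<theta>"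
          by (simp only: g_def if_False)
      qed
      moreover have "(\<Prod>i\<in>K - insert j J. epow (f i (x(j := y))) ?\<theta>) = (\<Prod>i\<in>K - insert j J. epow (g y i x) ?\<theta>)"
        by (intro prod.cong refl) (auto simp: g_def)
      ultimately show "(\<Prod>i\<in>insert j J. epow (\<integral>\<^sup>+t. f i (x(j := y, i := t)) \<partial>lborel) ?\<theta>)
              * (\<Prod>i\<in>K - insert j J. epow (f i (x(j := y))) ?\<theta>) = (\<Prod>i\<in>J. epow (\<integral>\<^sup>+t. g y i (x(i := t)) \<partial>lborel) ?\<theta>)
              * (\<Prod>i\<in>K - J. epow (g y i x) ?\<theta>)"
        unfolding KJ(1) using KJ(2) K insert.hyps by (simp add: g_def mult_ac)
    qed
    also have "\<dots> \<le> (\<integral>\<^sup>+y. (\<Prod>i\<in>K. epow (\<integral>\<^sup>+x. g y i x \<partial>PiM J (\<lambda>_. lborel)) ?\<theta>) \<partial>lborel)"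
      by (intro nn_integral_mono insert.IH JK gm)
    also have "\<dots> = (\<integral>\<^sup>+y. epow (\<integral>\<^sup>+x. f j x \<partial>PiM (insert j J) (\<lambda>_. lborel)) ?\<theta> *
        (\<Prod>i\<in>K - {j}. epow (\<integral>\<^sup>+x. f i (x(j := y)) \<partial>PiM J (\<lambda>_. lborel)) ?\<theta>) \<partial>lborel)"
    proof (intro nn_integral_cong)
      fix y :: real
      have "(\<integral>\<^sup>+x. g y j x \<partial>PiM J (\<lambda>_. lborel)) = (\<integral>\<^sup>+x. f j x \<partial>PiM (insert j J) (\<lambda>_. lborel))"
        using product_nn_integral_insert[OF insert.hyps meas[OF jK]] by (simp add: g_def fun_upd_def)
      moreover have "(\<Prod>i\<in>K - {j}. epow (\<integral>\<^sup>+x. g y i x \<partial>PiM J (\<lambda>_. lborel)) ?\<theta>)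
         = (\<Prod>i\<in>K - {j}. epow (\<integral>\<^sup>+x. f i (x(j := y)) \<partial>PiM J (\<lambda>_. lborel)) ?\<theta>)"
        by (intro prod.cong refl) (auto simp: g_def)
      ultimately show "(\<Prod>i\<in>K. epow (\<integral>\<^sup>+x. g y i x \<partial>PiM J (\<lambda>_. lborel)) ?\<theta>) = epow (\<integral>\<^sup>+x. f j x \<partial>PiM (insert j J) (\<lambda>_. lborel)) ?\<theta> *
        (\<Prod>i\<in>K - {j}. epow (\<integral>\<^sup>+x. f i (x(j := y)) \<partial>PiM J (\<lambda>_. lborel)) ?\<theta>)"
        by (subst prod.remove[OF K(1) jK]) (simp only:)
    qed
    also have "\<dots> = epow (\<integral>\<^sup>+x. f j x \<partial>PiM (insert j J) (\<lambda>_. lborel)) ?\<theta> *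
        (\<integral>\<^sup>+y. (\<Prod>i\<in>K - {j}. epow (\<integral>\<^sup>+x. f i (x(j := y)) \<partial>PiM J (\<lambda>_. lborel)) ?\<theta>) \<partial>lborel)"
      by (intro nn_integral_cmult borel_measurable_prod_ennreal epow_measurable ym) auto
    also have "\<dots> \<le> epow (\<integral>\<^sup>+x. f j x \<partial>PiM (insert j J) (\<lambda>_. lborel)) ?\<theta> *
        (\<Prod>i\<in>K - {j}. epow (\<integral>\<^sup>+y. \<integral>\<^sup>+x. f i (x(j := y)) \<partial>PiM J (\<lambda>_. lborel) \<partial>lborel) ?\<theta>)"
    proof (intro mult_left_mono nn_integral_Hoelder ym)
      have "card (K - {j}) = card K - 1" using jK K by simp
      then show "(\<Sum>i\<in>K - {j}. ?\<theta>) = 1" using K by (simp add: of_nat_diff)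
      show "K - {j} \<noteq> {}" using K jK by (metis \<open>card (K - {j}) = card K - 1\<close> card.empty diff_is_0_eq not_less_eq_eq numeral_2_eq_2 One_nat_def)
    qed (use K \<theta> in auto)
    also have "(\<Prod>i\<in>K - {j}. epow (\<integral>\<^sup>+y. \<integral>\<^sup>+x. f i (x(j := y)) \<partial>PiM J (\<lambda>_. lborel) \<partial>lborel) ?\<theta>)
       = (\<Prod>i\<in>K - {j}. epow (\<integral>\<^sup>+x. f i x \<partial>PiM (insert j J) (\<lambda>_. lborel)) ?\<theta>)"
      by (intro prod.cong refl arg_cong2[where f=epow] product_nn_integral_insert_rev[symmetric] insert.hyps meas) auto
    also have "epow (\<integral>\<^sup>+x. f j x \<partial>PiM (insert j J) (\<lambda>_. lborel)) ?\<theta> * \<dots>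
       = (\<Prod>i\<in>K. epow (\<integral>\<^sup>+x. f i x \<partial>PiM (insert j J) (\<lambda>_. lborel)) ?\<theta>)"
      by (rule prod.remove[OF K(1) jK, symmetric])
    finally show ?case .
  qed
qed

lemma Loomis_Whitney:
  fixes f :: "'a::euclidean_space \<Rightarrow> 'a \<Rightarrow> ennreal"
  assumes n: "DIM('a) \<ge> 2" and [measurable]: "\<And>b. b \<in> Basis \<Longrightarrow> f b \<in> borel_measurable borel"
  shows "(\<integral>\<^sup>+x. (\<Prod>b\<in>Basis. epow (\<integral>\<^sup>+t. f b (x + (t - x \<bullet> b) *\<^sub>R b) \<partial>lborel) (1 / (real DIM('a) - 1))) \<partial>lborel)
    \<le> (\<Prod>b\<in>Basis. epow (\<integral>\<^sup>+x. f b x \<partial>lborel) (1 / (real DIM('a) - 1)))"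
proof -
  let ?\<theta> = "1 / (real DIM('a) - 1)"
  let ?P = "PiM (Basis::'a set) (\<lambda>_. lborel :: real measure)"
  let ?e = "\<lambda>\<omega>::'a\<Rightarrow>real. \<Sum>b\<in>Basis. \<omega> b *\<^sub>R b"
  have e[measurable]: "?e \<in> ?P \<rightarrow>\<^sub>M borel" by measurable
  have int: "(\<integral>\<^sup>+x. h x \<partial>lborel) = (\<integral>\<^sup>+\<omega>. h (?e \<omega>) \<partial>?P)" if "h \<in> borel_measurable borel" for h
    by (subst lborel_eq, subst nn_integral_distr[OF e]) (use that in auto)
  have upd: "?e (fun_upd \<omega> b t) = ?e \<omega> + (t - ?e \<omega> \<bullet> b) *\<^sub>R b" if "b \<in> Basis" for \<omega> b t
  proof -
    have "?e \<omega> \<bullet> b = \<omega> b" using that by (simp add: inner_sum_left_Basis)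
    moreover have "?e (fun_upd \<omega> b t) = t *\<^sub>R b + (\<Sum>c\<in>Basis - {b}. \<omega> c *\<^sub>R c)"
      using that by (subst sum.remove[of _ b]) (auto intro!: sum.cong)
    moreover have "?e \<omega> = \<omega> b *\<^sub>R b + (\<Sum>c\<in>Basis - {b}. \<omega> c *\<^sub>R c)"
      using that by (subst sum.remove[of _ b]) auto
    ultimately show ?thesis by (simp add: algebra_simps)
  qed
  have "(\<integral>\<^sup>+x. (\<Prod>b\<in>Basis. epow (\<integral>\<^sup>+t. f b (x + (t - x \<bullet> b) *\<^sub>R b) \<partial>lborel) ?\<theta>) \<partial>lborel)
     = (\<integral>\<^sup>+\<omega>. (\<Prod>b\<in>Basis. epow (\<integral>\<^sup>+t. f b (?e \<omega> + (t - ?e \<omega> \<bullet> b) *\<^sub>R b) \<partial>lborel) ?\<theta>) \<partial>?P)"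
    by (intro int borel_measurable_prod_ennreal epow_measurable lborel.borel_measurable_nn_integral)
      (auto simp: split_beta')
  also have "\<dots> = (\<integral>\<^sup>+\<omega>. (\<Prod>b\<in>Basis. epow (\<integral>\<^sup>+t. f b (?e (fun_upd \<omega> b t)) \<partial>lborel) ?\<theta>) * (\<Prod>b\<in>Basis-Basis. epow (f b (?e \<omega>)) ?\<theta>) \<partial>?P)"
  proof (intro nn_integral_cong)
    fix \<omega>
    have "(\<Prod>b\<in>Basis. epow (\<integral>\<^sup>+t. f b (?e \<omega> + (t - ?e \<omega> \<bullet> b) *\<^sub>R b) \<partial>lborel) ?\<theta>)
        = (\<Prod>b\<in>Basis. epow (\<integral>\<^sup>+t. f b (?e (fun_upd \<omega> b t)) \<partial>lborel) ?\<theta>)"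
      by (intro prod.cong refl) (simp only: upd)
    then show "(\<Prod>b\<in>Basis. epow (\<integral>\<^sup>+t. f b (?e \<omega> + (t - ?e \<omega> \<bullet> b) *\<^sub>R b) \<partial>lborel) ?\<theta>)
        = (\<Prod>b\<in>Basis. epow (\<integral>\<^sup>+t. f b (?e (fun_upd \<omega> b t)) \<partial>lborel) ?\<theta>) * (\<Prod>b\<in>Basis-Basis. epow (f b (?e \<omega>)) ?\<theta>)"
      by (simp only: Diff_cancel prod.empty mult_1_right)
  qed
  also have "\<dots> \<le> (\<Prod>b\<in>Basis. epow (\<integral>\<^sup>+\<omega>. f b (?e \<omega>) \<partial>?P) ?\<theta>)"
    by (rule Loomis_Whitney_PiM[where f="\<lambda>b \<omega>. f b (?e \<omega>)"]) (use n in auto)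
  also have "\<dots> = (\<Prod>b\<in>Basis. epow (\<integral>\<^sup>+x. f b x \<partial>lborel) ?\<theta>)"
    by (intro prod.cong refl arg_cong2[where f=epow] int[symmetric]) auto
  finally show ?thesis .
qed

text \<open>For \<open>\<sigma> > 1\<close> this power is continuously differentiable across \<open>0\<close>, so that \<open>|v|\<^sup>s\<close> can be
  differentiated below without a regularisation at the zeros of \<open>v\<close>.\<close>
lemma DERIV_abs_powr:
  assumes "r \<ge> 0" "\<sigma> > 1"
  shows "((\<lambda>r. \<bar>r\<bar> powr \<sigma>) has_real_derivative \<sigma> * r powr (\<sigma> - 1)) (at r)"
proof (cases "r = 0")
  case True
  have "((\<lambda>h::real. \<bar>h\<bar> powr (\<sigma> - 1)) \<longlongrightarrow> 0) (at 0)"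
    by (rule tendsto_zero_powrI) (use assms in \<open>auto intro!: tendsto_eq_intros\<close>)
  then have "((\<lambda>h. \<bar>h\<bar> powr \<sigma> / h) \<longlongrightarrow> 0) (at 0)"
  proof (rule tendsto_0_le[where K=1])
    show "\<forall>\<^sub>F h in at 0. norm (\<bar>h\<bar> powr \<sigma> / h) \<le> norm (\<bar>h\<bar> powr (\<sigma> - 1)) * 1"
      by (auto simp: powr_diff eventually_at_filter)
  qed
  then show ?thesis using True by (simp add: DERIV_def)
next
  case False
  then have r: "r > 0" using assms by simp
  have "((\<lambda>r. r powr \<sigma>) has_real_derivative \<sigma> * r powr (\<sigma> - 1)) (at r)"
    using r by (auto intro!: derivative_eq_intros)
  then show ?thesis
    by (rule has_field_derivative_transform_within_open[where S="{0<..}"]) (use r in auto)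
qed

text \<open>The fundamental theorem of calculus for \<open>|v|\<^sup>s\<close> on the line through \<open>x\<close> in direction \<open>b\<close>, started
  at a point outside the support.\<close>
lemma norm_powr_line_bound:
  fixes v :: "'a::euclidean_space \<Rightarrow> 'b::euclidean_space"
  assumes D: "\<And>x. (v has_derivative v' x) (at x)"
    and C: "continuous_on UNIV (\<lambda>x. v' x b)" and b: "b \<in> Basis"
    and supp: "\<And>x. norm x > M \<Longrightarrow> v x = 0" and s: "s > 2"
  shows "ennreal (norm (v x) powr s) \<le>
    (\<integral>\<^sup>+t. ennreal (s * norm (v (x + (t - x \<bullet> b) *\<^sub>R b)) powr (s - 1) * norm (v' (x + (t - x \<bullet> b) *\<^sub>R b) b)) \<partial>lborel)"
proof -
  define y where "y t = x + (t - x \<bullet> b) *\<^sub>R b" for t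
  define G where "G t = (s / 2) * (v (y t) \<bullet> v (y t)) powr (s / 2 - 1) * (2 * (v (y t) \<bullet> v' (y t) b))" for t
  let ?g = "\<lambda>t. \<bar>v (y t) \<bullet> v (y t)\<bar> powr (s / 2)"
  \<comment> \<open>the point of the line with parameter \<open>a\<close> lies outside the ball of radius \<open>M\<close>\<close>
  define a where "a = min (x \<bullet> b) (- \<bar>M\<bar> - 1)"
  have yd: "(y has_vector_derivative b) (at t)" for t
    unfolding y_def by (auto intro!: derivative_eq_intros)
  have vy: "((\<lambda>t. v (y t)) has_vector_derivative v' (y t) b) (at t)" for t
    using vector_derivative_diff_chain_within[OF yd, of v "v' (y t)"] D by (simp add: o_def has_derivative_at_withinI)
  have inner: "((\<lambda>t. v (y t) \<bullet> v (y t)) has_real_derivative 2 * (v (y t) \<bullet> v' (y t) b)) (at t)" for t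
    using has_derivative_inner[OF vy[of t, unfolded has_vector_derivative_def] vy[of t, unfolded has_vector_derivative_def]]
    unfolding has_field_derivative_def
    by (rule has_derivative_eq_rhs) (auto simp: inner_commute algebra_simps)
  have gd: "(?g has_real_derivative G t) (at t)" for t
    unfolding G_def
    by (rule DERIV_chain2[OF DERIV_abs_powr inner]) (use s in auto)
  have vc: "continuous_on UNIV v"
    by (intro continuous_at_imp_continuous_on ballI has_derivative_continuous[OF D])
  have yc: "continuous_on UNIV y" unfolding y_def by (intro continuous_intros)
  have Gc: "continuous_on UNIV G" unfolding G_def
    by (intro continuous_intros continuous_on_compose2[OF vc yc] continuous_on_compose2[OF C yc] continuous_on_powr')
      (use s in auto)
  have "y a \<bullet> b = a" using b by (simp add: y_def inner_add_left)
  then have "norm (y a) > M" using Basis_le_norm[OF b, of "y a"] unfolding a_def by linarith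
  then have ga: "?g a = 0" using supp by simp
  have "(\<integral>t. indicator {a..x \<bullet> b} t *\<^sub>R G t \<partial>lborel) = ?g (x \<bullet> b) - ?g a"
    by (rule integral_FTC_atLeastAtMost)
      (use gd in \<open>auto simp: a_def has_real_derivative_iff_has_vector_derivative has_vector_derivative_at_within intro: continuous_on_subset[OF Gc]\<close>)
  then have "?g (x \<bullet> b) = norm (\<integral>t. indicator {a..x \<bullet> b} t *\<^sub>R G t \<partial>lborel)"
    using ga by simp
  moreover have "y (x \<bullet> b) = x" by (simp add: y_def)
  moreover have "norm (v x) powr s = \<bar>v x \<bullet> v x\<bar> powr (s / 2)"
    by (simp add: norm_eq_sqrt_inner powr_half_sqrt[symmetric] powr_powr mult.commute)
  ultimately have "ennreal (norm (v x) powr s) = ennreal (norm (\<integral>t. indicator {a..x \<bullet> b} t *\<^sub>R G t \<partial>lborel))"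
    by simp
  also have "\<dots> \<le> (\<integral>\<^sup>+t. ennreal (norm (indicator {a..x \<bullet> b} t *\<^sub>R G t)) \<partial>lborel)"
    by (intro integral_norm_bound_ennreal borel_integrable_compact continuous_on_subset[OF Gc]) auto
  also have "\<dots> \<le> (\<integral>\<^sup>+t. ennreal (s * norm (v (y t)) powr (s - 1) * norm (v' (y t) b)) \<partial>lborel)"
  proof (intro nn_integral_mono ennreal_leI)
    fix t
    have *: "(v (y t) \<bullet> v (y t)) powr (s / 2 - 1) = norm (v (y t)) powr (s - 2)"
      by (simp add: norm_eq_sqrt_inner powr_half_sqrt[symmetric] powr_powr) (simp add: algebra_simps diff_divide_distrib)
    have "norm (indicator {a..x \<bullet> b} t *\<^sub>R G t) \<le> \<bar>G t\<bar>" by (auto simp: indicator_def)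
    also have "\<dots> = s * (norm (v (y t)) powr (s - 2) * \<bar>v (y t) \<bullet> v' (y t) b\<bar>)"
      using s by (simp add: G_def abs_mult *)
    also have "\<dots> \<le> s * (norm (v (y t)) powr (s - 2) * (norm (v (y t)) * norm (v' (y t) b)))"
      using s by (intro mult_left_mono Cauchy_Schwarz_ineq2) auto
    also have "norm (v (y t)) powr (s - 2) * (norm (v (y t)) * norm (v' (y t) b)) = norm (v (y t)) powr (s - 1) * norm (v' (y t) b)"
      using powr_add[of "norm (v (y t))" "s - 2" 1] by simp
    finally show "norm (indicator {a..x \<bullet> b} t *\<^sub>R G t) \<le> s * norm (v (y t)) powr (s - 1) * norm (v' (y t) b)"
      by (simp add: mult.assoc)
  qed
  finally show ?thesis unfolding y_def .
qed

text \<open>The argument of Gagliardo and Nirenberg for \<open>|v|\<^sup>s\<close> with \<open>s = 2 (n - 1) / (n - 2)\<close>. The line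
  bounds and the inequality of Loomis and Whitney estimate \<open>I = \<integral> |v|\<^sup>p\<close>, \<open>p = 2 n / (n - 2)\<close>, by a
  product of the integrals of \<open>|v|\<^bsup>s-1\<^esup> |D\<^sub>b v|\<close>. As \<open>2 (s - 1) = p\<close>, the Cauchy-Schwarz inequality
  turns these into powers of \<open>I\<close> of total order less than \<open>1\<close>, which can be cancelled because \<open>I\<close> is
  finite.\<close>
lemma Sobolev_C1:
  fixes v :: "'a::euclidean_space \<Rightarrow> 'b::euclidean_space"
  assumes n: "DIM('a) \<ge> 3"
    and D: "\<And>x. (v has_derivative v' x) (at x)"
    and C: "\<And>b. b \<in> Basis \<Longrightarrow> continuous_on UNIV (\<lambda>x. v' x b)"
    and supp: "\<And>x. norm x > M \<Longrightarrow> v x = 0"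
  shows "epow (\<integral>\<^sup>+x. ennreal (norm (v x) powr (2 * real DIM('a) / (real DIM('a) - 2))) \<partial>lborel) ((real DIM('a) - 2) / real DIM('a))
    \<le> 16 * (\<integral>\<^sup>+x. ennreal (\<Sum>b\<in>Basis. (norm (v' x b))\<^sup>2) \<partial>lborel)"
proof -
  define N where "N = real DIM('a)"
  have N: "N \<ge> 3" using n by (simp add: N_def)
  define p where "p = 2 * N / (N - 2)"
  define s where "s = 2 * (N - 1) / (N - 2)"
  have s: "s > 2" "s \<le> 4" "2 * (s - 1) = p" "s * N / (N - 1) = p" "p / 2 = s - 1" using N by (auto simp: s_def p_def divide_simps)
  define I where "I = (\<integral>\<^sup>+x. ennreal (norm (v x) powr p) \<partial>lborel)"
  define E where "E = (\<integral>\<^sup>+x. ennreal (\<Sum>b\<in>Basis. (norm (v' x b))\<^sup>2) \<partial>lborel)"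
  have vc: "continuous_on UNIV v"
    by (intro continuous_at_imp_continuous_on ballI has_derivative_continuous[OF D])
  have vm[measurable]: "v \<in> borel_measurable borel" using vc by (rule borel_measurable_continuous_onI)
  have v'm[measurable]: "(\<lambda>x. v' x b) \<in> borel_measurable borel" if "b \<in> Basis" for b
    using C[OF that] by (rule borel_measurable_continuous_onI)
  have Itop: "I < top"
  proof -
    have "set_integrable lborel (cball 0 M) (\<lambda>x. norm (v x) powr p)"
      unfolding set_integrable_def
      by (rule borel_integrable_compact) (use N in \<open>auto intro!: continuous_intros continuous_on_powr' continuous_on_subset[OF vc] simp: p_def\<close>)
    moreover have "indicator (cball 0 M) x *\<^sub>R norm (v x) powr p = norm (v x) powr p" for x
      using supp[of x] by (auto simp: indicator_def not_le)
    ultimately have "integrable lborel (\<lambda>x. norm (v x) powr p)" by (simp only: set_integrable_def)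
    then show ?thesis unfolding I_def integrable_iff_bounded by simp
  qed
  have half: "norm (v x) powr (p / 2) = norm (v x) powr (s - 1)" for x using s(5) by (simp only:)
  define F where "F b x = ennreal (s * norm (v x) powr (s - 1) * norm (v' x b))" for b x
  have Fm[measurable]: "F b \<in> borel_measurable borel" if "b \<in> Basis" for b
    using that unfolding F_def[abs_def] by measurable
  have "I \<le> (\<integral>\<^sup>+x. (\<Prod>b\<in>Basis. epow (\<integral>\<^sup>+t. F b (x + (t - x \<bullet> b) *\<^sub>R b) \<partial>lborel) (1 / (real DIM('a) - 1))) \<partial>lborel)"
    unfolding I_def
  proof (intro nn_integral_mono)
    fix x
    have "ennreal (norm (v x) powr p) = (\<Prod>b\<in>(Basis::'a set). epow (ennreal (norm (v x) powr s)) (1 / (real DIM('a) - 1)))"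
      using s N by (simp add: ennreal_power powr_powr powr_realpow'[symmetric] N_def[symmetric] powr_power)
    also have "\<dots> \<le> (\<Prod>b\<in>Basis. epow (\<integral>\<^sup>+t. F b (x + (t - x \<bullet> b) *\<^sub>R b) \<partial>lborel) (1 / (real DIM('a) - 1)))"
      unfolding F_def
      by (intro prod_mono_ennreal epow_mono norm_powr_line_bound[OF D C _ supp s(1)]) (use n in auto)
    finally show "ennreal (norm (v x) powr p) \<le> \<dots>" .
  qed
  also have "\<dots> \<le> (\<Prod>b\<in>Basis. epow (\<integral>\<^sup>+x. F b x \<partial>lborel) (1 / (real DIM('a) - 1)))"
    by (rule Loomis_Whitney) (use n in auto)
  also have "\<dots> \<le> (\<Prod>b\<in>(Basis::'a set). epow (ennreal s * (epow I (1/2) * epow E (1/2))) (1 / (real DIM('a) - 1)))"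
  proof (intro prod_mono_ennreal epow_mono)
    fix b :: 'a assume b: "b \<in> Basis"
    have "(\<integral>\<^sup>+x. F b x \<partial>lborel) = ennreal s * (\<integral>\<^sup>+x. epow (ennreal (norm (v x) powr p)) (1/2) * epow (ennreal ((norm (v' x b))\<^sup>2)) (1/2) \<partial>lborel)"
      using b s(1) by (subst nn_integral_cmult[symmetric])
        (auto intro!: nn_integral_cong simp: F_def ennreal_mult powr_powr powr_half_sqrt mult.assoc half)
    also have "\<dots> \<le> ennreal s * (epow (\<integral>\<^sup>+x. ennreal (norm (v x) powr p) \<partial>lborel) (1/2) * epow (\<integral>\<^sup>+x. ennreal ((norm (v' x b))\<^sup>2) \<partial>lborel) (1/2))"
      by (intro mult_left_mono nn_integral_Hoelder2) (use b in auto)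
    also have "\<dots> \<le> ennreal s * (epow I (1/2) * epow E (1/2))"
      unfolding I_def E_def
      by (intro mult_left_mono epow_mono nn_integral_mono ennreal_leI member_le_sum[where f="\<lambda>b. (norm (v' _ b))\<^sup>2"]) (use b in auto)
    finally show "(\<integral>\<^sup>+x. F b x \<partial>lborel) \<le> ennreal s * (epow I (1/2) * epow E (1/2))" .
  qed (use n in auto)
  finally have main: "I \<le> (epow (ennreal s * (epow I (1/2) * epow E (1/2))) (1 / (N - 1))) ^ DIM('a)"
    by (simp add: N_def)
  have "epow I ((N - 2) / N) \<le> 16 * E"
  proof (cases "E = top \<or> I = 0")
    case True then show ?thesis by (auto simp: ennreal_mult_top)
  next
    case False
    obtain i where i: "I = ennreal i" "i > 0" using Itop False
      by (cases I) (auto simp: ennreal_eq_0_iff not_le)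
    obtain e where e: "E = ennreal e" "e \<ge> 0" using False by (cases E) auto
    define k where "k = N / (N - 1)"
    have kp: "k > 0" using N by (simp add: k_def)
    have pp: "(z powr (1 / (N - 1))) ^ DIM('a) = z powr k" for z :: real
      by (cases "z = 0") (auto simp: powr_power k_def N_def)
    have "i \<le> (s * (i powr (1/2) * e powr (1/2))) powr k"
      using main s(1) i e N by (simp add: ennreal_mult[symmetric] ennreal_power pp)
    also have "\<dots> = s powr k * i powr (k / 2) * e powr (k / 2)"
      using s(1) i e by (simp add: powr_mult powr_powr)
    finally have le: "i \<le> s powr k * e powr (k / 2) * i powr (k / 2)" by (simp add: mult_ac)
    have "i powr (1 - k / 2) = i powr 1 / i powr (k / 2)" by (rule powr_diff)
    also have "\<dots> \<le> s powr k * e powr (k / 2)"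
      using i(2) le by (simp add: divide_le_eq)
    finally have "i powr (1 - k / 2) \<le> s powr k * e powr (k / 2)" .
    then have "(i powr (1 - k / 2)) powr (2 / k) \<le> (s powr k * e powr (k / 2)) powr (2 / k)"
      using N by (intro powr_mono2) (auto simp: k_def)
    also have "\<dots> = s powr 2 * e" using kp s(1) e by (simp add: powr_mult powr_powr)
    also have "s powr 2 \<le> 4 powr 2" using s by (intro powr_mono2) auto
    also have "(i powr (1 - k / 2)) powr (2 / k) = i powr ((N - 2) / N)"
    proof -
      have "2 / k = 2 * ((N - 1) / N)" by (simp add: k_def)
      moreover have "(1 - k / 2) * (2 / k) = 2 / k - 1" using kp by (simp add: field_simps)
      ultimately have "(1 - k / 2) * (2 / k) = 2 * ((N - 1) / N) - 1" by (simp only:)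
      also have "\<dots> = (N - 2) / N" using N by (simp add: field_simps)
      finally show ?thesis by (simp add: powr_powr)
    qed
    finally have "i powr ((N - 2) / N) \<le> 16 * e" using e by (simp add: mult_right_mono)
    then show ?thesis using i e by (simp add: ennreal_mult'[symmetric] ennreal_numeral[symmetric] ennreal_leI del: ennreal_numeral)
  qed
  then show ?thesis by (simp add: I_def E_def p_def N_def)
qed

section \<open>Integration by parts and uniqueness of weak gradients\<close>

lemma integral_lborel_shift:
  fixes f :: "'a::euclidean_space \<Rightarrow> real"
  assumes [measurable]: "f \<in> borel_measurable borel"
  shows "(\<integral>x. f (x + c) \<partial>lborel) = (\<integral>x. f x \<partial>lborel)"
proof -
  have "(\<integral>x. f x \<partial>lborel) = (\<integral>x. f x \<partial>distr lborel borel ((+) c))"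
    by (simp add: lborel_distr_plus)
  also have "\<dots> = (\<integral>x. f (c + x) \<partial>lborel)" by (rule integral_distr) auto
  finally show ?thesis by (simp add: add.commute)
qed

lemma integrable_compact_support:
  fixes f :: "'a::euclidean_space \<Rightarrow> 'b::euclidean_space"
  assumes "continuous_on UNIV f" "\<And>x. norm x > M \<Longrightarrow> f x = 0"
  shows "integrable lborel f" "integrable lebesgue f"
proof -
  have "integrable lborel (\<lambda>x. indicator (cball 0 M) x *\<^sub>R f x)"
    by (rule borel_integrable_compact) (auto intro: continuous_on_subset[OF assms(1)])
  moreover have "(\<lambda>x. indicator (cball 0 M) x *\<^sub>R f x) = f"
    using assms(2) by (auto simp: fun_eq_iff indicator_def not_le)
  ultimately show *: "integrable lborel f" by simp
  then show "integrable lebesgue f"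
    by (subst integrable_completion) auto
qed

lemma derivative_zero_outside_support:
  fixes f :: "'a::euclidean_space \<Rightarrow> 'b::real_normed_vector"
  assumes "(f has_derivative f') (at x)" "\<And>x. norm x > M \<Longrightarrow> f x = 0" "norm x > M"
  shows "f' = (\<lambda>_. 0)"
proof -
  have "((\<lambda>_. 0) has_derivative f') (at x)"
  proof (rule has_derivative_transform_within_open[OF assms(1)])
    show "open {x::'a. norm x > M}" by (intro open_Collect_less continuous_intros)
  qed (use assms in auto)
  then show ?thesis using has_derivative_unique has_derivative_const by blast
qed

text \<open>By translation invariance all difference quotients of \<open>f\<close> have integral zero, and by the mean value
  theorem they converge boundedly on a fixed ball.\<close>
lemma integral_derivative_zero_real:
  fixes f :: "'a::euclidean_space \<Rightarrow> real"
  assumes D: "\<And>x. (f has_derivative f' x) (at x)"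
    and C: "continuous_on UNIV (\<lambda>x. f' x e)"
    and supp: "\<And>x. norm x > M \<Longrightarrow> f x = 0"
  shows "(\<integral>x. f' x e \<partial>lborel) = 0"
proof -
  define t where "t m = inverse (real (Suc m))" for m
  have t: "t m > 0" "t m \<le> 1" for m by (auto simp: t_def field_simps)
  have t0: "t \<longlonglongrightarrow> 0" unfolding t_def by (rule LIMSEQ_inverse_real_of_nat)
  define q where "q m x = (f (x + t m *\<^sub>R e) - f x) / t m" for m x
  have fc: "continuous_on UNIV f"
    by (intro continuous_at_imp_continuous_on ballI has_derivative_continuous[OF D])
  have fm[measurable]: "f \<in> borel_measurable borel" using fc by (rule borel_measurable_continuous_onI)
  have f'm[measurable]: "(\<lambda>x. f' x e) \<in> borel_measurable borel" using C by (rule borel_measurable_continuous_onI)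
  have f'0: "f' x e = 0" if "norm x > M" for x
    using derivative_zero_outside_support[OF D supp that] by simp
  have "bounded ((\<lambda>x. f' x e) ` cball 0 M)"
    by (intro compact_imp_bounded compact_continuous_image continuous_on_subset[OF C]) auto
  then obtain B where B: "B > 0" "\<And>x. x \<in> cball 0 M \<Longrightarrow> \<bar>f' x e\<bar> \<le> B" by (auto simp: bounded_pos)
  have B': "\<bar>f' x e\<bar> \<le> B" for x using B f'0[of x] by (cases "norm x \<le> M") auto
  have gd: "((\<lambda>s. f (x + s *\<^sub>R e)) has_real_derivative f' (x + s *\<^sub>R e) e) (at s)" for x s
  proof -
    have "((\<lambda>s. x + s *\<^sub>R e) has_derivative (\<lambda>h. h *\<^sub>R e)) (at s)"
      by (auto intro!: derivative_eq_intros)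
    from has_derivative_compose[OF this D]
    show ?thesis unfolding has_field_derivative_def
      by (rule has_derivative_eq_rhs)
        (simp add: linear_simps(5)[OF has_derivative_bounded_linear[OF D]] fun_eq_iff mult.commute)
  qed
  have qint: "(\<integral>x. q m x \<partial>lborel) = 0" for m
  proof -
    have "integrable lborel f" using integrable_compact_support[OF fc supp] by simp
    moreover have "integrable lborel (\<lambda>x. f (x + t m *\<^sub>R e))"
    proof (rule integrable_compact_support(1))
      show "f (x + t m *\<^sub>R e) = 0" if "norm x > M + norm (t m *\<^sub>R e)" for x
        using that norm_triangle_ineq2[of x "- (t m *\<^sub>R e)"] by (intro supp) auto
    qed (intro continuous_intros continuous_on_compose2[OF fc], auto)
    ultimately show ?thesis
      by (simp add: q_def integral_lborel_shift)
  qed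
  have "(\<lambda>m. \<integral>x. q m x \<partial>lborel) \<longlonglongrightarrow> (\<integral>x. f' x e \<partial>lborel)"
  proof (rule integral_dominated_convergence[where w="\<lambda>x. indicator (cball 0 (M + norm e)) x * B"])
    show "integrable lborel (\<lambda>x. indicator (cball 0 (M + norm e)) x * B)"
      by (intro integrable_mult_left integrable_real_indicator emeasure_bounded_finite) auto
    show "AE x in lborel. (\<lambda>m. q m x) \<longlonglongrightarrow> f' x e"
    proof (intro AE_I2)
      fix x
      have "((\<lambda>h. (f (x + h *\<^sub>R e) - f x) / h) \<longlongrightarrow> f' x e) (at 0)"
        using gd[of x 0] by (simp add: DERIV_def)
      moreover have "filterlim t (at 0) sequentially"
        using t0 t(1) by (auto simp: filterlim_at less_imp_neq[THEN not_sym])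
      ultimately show "(\<lambda>m. q m x) \<longlonglongrightarrow> f' x e"
        unfolding q_def by (rule filterlim_compose)
    qed
    show "AE x in lborel. norm (q m x) \<le> indicator (cball 0 (M + norm e)) x * B" for m
    proof (intro AE_I2)
      fix x
      show "norm (q m x) \<le> indicator (cball 0 (M + norm e)) x * B"
      proof (cases "norm x \<le> M + norm e")
        case True
        obtain s where "f (x + t m *\<^sub>R e) - f (x + 0 *\<^sub>R e) = (t m - 0) * f' (x + s *\<^sub>R e) e"
          using MVT2[of 0 "t m" "\<lambda>s. f (x + s *\<^sub>R e)" "\<lambda>s. f' (x + s *\<^sub>R e) e"] t(1)[of m] gd by blast
        then have "q m x = f' (x + s *\<^sub>R e) e" using t(1)[of m] by (simp add: q_def)
        with B' True show ?thesis by simp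
      next
        case False
        have "norm (t m *\<^sub>R e) \<le> norm e" using t(1,2)[of m] by (simp add: mult_left_le_one_le less_imp_le)
        then have "norm (x + t m *\<^sub>R e) > M"
          using False norm_triangle_ineq2[of x "- (t m *\<^sub>R e)"] by simp
        moreover have "norm x > M" using False norm_ge_zero[of e] by linarith
        ultimately show ?thesis using supp False by (simp add: q_def)
      qed
    qed
  qed (auto simp: q_def)
  then show ?thesis by (simp add: qint LIMSEQ_const_iff)
qed

lemma integral_derivative_zero:
  fixes f :: "'a::euclidean_space \<Rightarrow> 'b::euclidean_space"
  assumes D: "\<And>x. (f has_derivative f' x) (at x)"
    and C: "continuous_on UNIV (\<lambda>x. f' x e)"
    and supp: "\<And>x. norm x > M \<Longrightarrow> f x = 0"
  shows "(\<integral>x. f' x e \<partial>lborel) = 0"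
proof (rule euclidean_eqI)
  fix b :: 'b assume "b \<in> Basis"
  have "integrable lborel (\<lambda>x. f' x e)"
  proof (rule integrable_compact_support(1)[OF C])
    show "f' x e = 0" if "norm x > M" for x
      using derivative_zero_outside_support[OF D supp that] by simp
  qed
  then have "(\<integral>x. f' x e \<partial>lborel) \<bullet> b = (\<integral>x. f' x e \<bullet> b \<partial>lborel)" by simp
  also have "\<dots> = 0"
    by (rule integral_derivative_zero_real[where f="\<lambda>x. f x \<bullet> b" and f'="\<lambda>x h. f' x h \<bullet> b" and M=M])
      (auto intro!: has_derivative_inner_left D continuous_intros C supp simp: supp)
  finally show "(\<integral>x. f' x e \<partial>lborel) \<bullet> b = 0 \<bullet> b" by simp
qed

lemma integral_by_parts_smooth:
  fixes \<phi> :: "'a::euclidean_space \<Rightarrow> 'b::euclidean_space" and \<psi> :: "'a \<Rightarrow> real"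
  assumes \<phi>: "smooth \<phi>" and \<psi>: "smooth \<psi>" and supp: "\<And>x. norm x > M \<Longrightarrow> \<psi> x = 0"
  shows "(\<integral>x. frechet_derivative \<psi> (at x) e *\<^sub>R \<phi> x \<partial>lebesgue)
     = - (\<integral>x. \<psi> x *\<^sub>R frechet_derivative \<phi> (at x) e \<partial>lebesgue)"
proof -
  note D = smooth_has_derivative[OF \<phi>] smooth_has_derivative[OF \<psi>]
  have c1: "continuous_on UNIV (\<lambda>x. frechet_derivative \<psi> (at x) e *\<^sub>R \<phi> x)"
    and c2: "continuous_on UNIV (\<lambda>x. \<psi> x *\<^sub>R frechet_derivative \<phi> (at x) e)"
    by (intro continuous_intros smooth_continuous_on smooth_frechet_derivative \<phi> \<psi>)+
  have s1: "frechet_derivative \<psi> (at x) e *\<^sub>R \<phi> x = 0" if "norm x > M" for x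
    using derivative_zero_outside_support[OF D(2) supp that] by simp
  have i1: "integrable lborel (\<lambda>x. frechet_derivative \<psi> (at x) e *\<^sub>R \<phi> x)"
    using c1 s1 by (rule integrable_compact_support)
  have i2: "integrable lborel (\<lambda>x. \<psi> x *\<^sub>R frechet_derivative \<phi> (at x) e)"
    using supp by (intro integrable_compact_support(1)[OF c2, of M]) auto
  have "(\<integral>x. \<psi> x *\<^sub>R frechet_derivative \<phi> (at x) e + frechet_derivative \<psi> (at x) e *\<^sub>R \<phi> x \<partial>lborel) = 0"
    by (rule integral_derivative_zero[OF has_derivative_scaleR[OF D(2) D(1)], where M=M])
      (use c1 c2 supp in \<open>auto intro: continuous_on_add\<close>)
  then have "(\<integral>x. \<psi> x *\<^sub>R frechet_derivative \<phi> (at x) e \<partial>lborel) + (\<integral>x. frechet_derivative \<psi> (at x) e *\<^sub>R \<phi> x \<partial>lborel) = 0"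
    using i1 i2 by simp
  moreover have "(\<lambda>x. frechet_derivative \<psi> (at x) e *\<^sub>R \<phi> x) \<in> borel_measurable lborel" 
    "(\<lambda>x. \<psi> x *\<^sub>R frechet_derivative \<phi> (at x) e) \<in> borel_measurable lborel"
    using i1 i2 by auto
  ultimately show ?thesis by (simp add: integral_completion eq_neg_iff_add_eq_0 add.commute)
qed

lemma Cc_smoothD:
  assumes "\<psi> \<in> Cc_smooth \<Omega>"
  shows "smooth \<psi>" "compact (closure {x. \<psi> x \<noteq> 0})" "closure {x. \<psi> x \<noteq> 0} \<subseteq> \<Omega>"
    "\<exists>M. \<forall>x. norm x > M \<longrightarrow> \<psi> x = 0"
proof -
  show "smooth \<psi>" and c: "compact (closure {x. \<psi> x \<noteq> 0})" and "closure {x. \<psi> x \<noteq> 0} \<subseteq> \<Omega>"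
    using assms by (auto simp: Cc_smooth_def smooth_def)
  obtain M where "\<forall>x\<in>closure {x. \<psi> x \<noteq> 0}. norm x \<le> M"
    using compact_imp_bounded[OF c] by (auto simp: bounded_iff)
  then show "\<exists>M. \<forall>x. norm x > M \<longrightarrow> \<psi> x = 0"
    using closure_subset[of "{x. \<psi> x \<noteq> 0}"] by (intro exI[of _ M]) force
qed

lemma Cc_smoothI:
  fixes \<psi> :: "'a::euclidean_space \<Rightarrow> 'b::real_normed_vector"
  assumes "smooth \<psi>" "compact K" "K \<subseteq> \<Omega>" "\<And>x. x \<notin> K \<Longrightarrow> \<psi> x = 0"
  shows "\<psi> \<in> Cc_smooth \<Omega>"
proof -
  have "closure {x. \<psi> x \<noteq> 0} \<subseteq> K"
    using assms by (intro closure_minimal compact_imp_closed) auto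
  moreover have "compact (closure {x. \<psi> x \<noteq> 0})"
    using calculation assms(2) by (metis closed_closure compact_Int_closed inf.absorb_iff2)
  ultimately show ?thesis using assms by (auto simp: Cc_smooth_def smooth_def)
qed

text \<open>Both integrals in the definition of a weak gradient have this form, and may thus be taken over the
  whole space.\<close>
lemma locally_integrable_mult:
  fixes g :: "'a::euclidean_space \<Rightarrow> 'b::euclidean_space" and \<psi> :: "'a \<Rightarrow> real"
  assumes g: "locally_integrable_on g \<Omega>" and c: "continuous_on UNIV \<psi>"
    and K: "compact K" "K \<subseteq> \<Omega>" "\<And>x. x \<notin> K \<Longrightarrow> \<psi> x = 0"
  shows "integrable lebesgue (\<lambda>x. \<psi> x *\<^sub>R g x)"
    and "(LINT x:\<Omega>|lebesgue. \<psi> x *\<^sub>R g x) = (\<integral>x. \<psi> x *\<^sub>R g x \<partial>lebesgue)"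
proof -
  have i: "integrable lebesgue (\<lambda>x. indicator K x *\<^sub>R g x)"
    using g K unfolding locally_integrable_on_def set_integrable_def by auto
  have "bounded (\<psi> ` K)"
    by (intro compact_imp_bounded compact_continuous_image continuous_on_subset[OF c] K) auto
  then obtain B where B: "\<And>x. x \<in> K \<Longrightarrow> \<bar>\<psi> x\<bar> \<le> B" by (auto simp: bounded_iff)
  have eq: "\<psi> x *\<^sub>R g x = \<psi> x *\<^sub>R (indicator K x *\<^sub>R g x)" for x using K(3) by (auto simp: indicator_def)
  have "\<psi> \<in> borel_measurable borel" using c by (rule borel_measurable_continuous_onI)
  then have pm: "\<psi> \<in> borel_measurable lebesgue" by (simp add: measurable_completion)
  show "integrable lebesgue (\<lambda>x. \<psi> x *\<^sub>R g x)" unfolding eq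
  proof (rule Bochner_Integration.integrable_bound[OF integrable_scaleR_right[OF i, of B]])
    show "(\<lambda>x. \<psi> x *\<^sub>R indicat_real K x *\<^sub>R g x) \<in> borel_measurable lebesgue"
      using pm borel_measurable_integrable[OF i] by (rule borel_measurable_scaleR)
    show "AE x in lebesgue. norm (\<psi> x *\<^sub>R indicat_real K x *\<^sub>R g x) \<le> norm (B *\<^sub>R indicat_real K x *\<^sub>R g x)"
      using B by (intro AE_I2) (force simp: indicator_def intro!: mult_right_mono)
  qed
  show "(LINT x:\<Omega>|lebesgue. \<psi> x *\<^sub>R g x) = (\<integral>x. \<psi> x *\<^sub>R g x \<partial>lebesgue)"
    unfolding set_lebesgue_integral_def using K by (intro Bochner_Integration.integral_cong) (auto simp: indicator_def)
qed

text \<open>The sets over which \<open>h\<close> integrates to zero form a Dynkin system, and boxes generate the Borel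
  sets.\<close>
lemma AE_zero_if_box_integrals_zero:
  fixes h :: "'a::euclidean_space \<Rightarrow> real"
  assumes h: "integrable lebesgue h" and supp: "\<And>x. x \<notin> box L U \<Longrightarrow> h x = 0"
    and box: "\<And>l u. (LINT x:box l u|lebesgue. h x) = 0"
  shows "AE x in lebesgue. h x = 0"
proof -
  obtain h' where h'm: "h' \<in> borel_measurable lborel" and h'e: "AE x in lborel. h x = h' x"
    using completion_ex_borel_measurable_real[OF borel_measurable_integrable[OF h]] by auto
  have h'e': "AE x in lebesgue. h x = h' x" using h'e by (rule AE_completion)
  have hm: "h \<in> borel_measurable lebesgue" using h by auto
  have h'm': "h' \<in> borel_measurable lebesgue" using h'm by (rule measurable_completion)
  have "integrable lebesgue h'"
    using h h'e' by (subst integrable_cong_AE[of h' _ h]) (auto simp: h'm' hm)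
  then have i': "integrable lborel h'" using h'm by (subst (asm) integrable_completion) auto
  have sI: "(LINT x:A|lborel. h' x) = (LINT x:A|lebesgue. h x)" if "A \<in> sets borel" for A
  proof -
    have "(LINT x:A|lborel. h' x) = (LINT x:A|lebesgue. h' x)"
      unfolding set_lebesgue_integral_def using that h'm by (subst integral_completion) auto
    also have "\<dots> = (LINT x:A|lebesgue. h x)"
      unfolding set_lebesgue_integral_def using h'e' that
      by (intro integral_cong_AE) (auto simp: h'm' hm intro!: borel_measurable_times borel_measurable_indicator)
    finally show ?thesis .
  qed
  have total: "(\<integral>x. h' x \<partial>lborel) = 0"
  proof -
    have "(LINT x:UNIV|lborel. h' x) = (LINT x:UNIV|lebesgue. h x)" by (rule sI) simp
    also have "\<dots> = (LINT x:box L U|lebesgue. h x)"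
      unfolding set_lebesgue_integral_def using supp by (intro Bochner_Integration.integral_cong) (auto simp: indicator_def)
    finally show ?thesis using box by (simp add: set_lebesgue_integral_def)
  qed
  have int: "integrable lborel (\<lambda>x. indicator A x *\<^sub>R h' x)" if "A \<in> sets borel" for A
    using that i' by (intro integrable_mult_indicator) auto
  have "AE x in lborel. h' x = (\<lambda>_. 0) x"
  proof (rule density_unique_real)
    fix A :: "'a set" assume A: "A \<in> sets lborel"
    let ?G = "range (\<lambda>(a, b). box a b :: 'a set)"
    have G: "Int_stable ?G" "?G \<subseteq> Pow UNIV" by (force simp: Int_stable_def box_Int_box) auto
    have "A \<in> sigma_sets UNIV ?G" using A by (simp add: borel_eq_box)
    with G have "(LINT x:A|lborel. h' x) = 0"
    proof (induction A rule: sigma_sets_induct_disjoint)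
      case (basic A)
      then obtain a b where A: "A = box a b" by auto
      show ?case unfolding A by (subst sI) (simp_all add: box)
    next
      case empty show ?case by (simp add: set_lebesgue_integral_def)
    next
      case (compl A)
      then have Ab: "A \<in> sets borel" by (simp add: borel_eq_box)
      have "(LINT x:UNIV - A|lborel. h' x) = (\<integral>x. h' x - indicator A x *\<^sub>R h' x \<partial>lborel)"
        unfolding set_lebesgue_integral_def by (intro Bochner_Integration.integral_cong) (auto simp: indicator_def)
      also have "\<dots> = 0" using compl.IH total i' int[OF Ab] by (simp add: set_lebesgue_integral_def)
      finally show ?case .
    next
      case (union F)
      then have Fb: "F i \<in> sets borel" for i by (auto simp: borel_eq_box)
      have "(LINT x:(\<Union>i. F i)|lborel. h' x) = (\<Sum>i. LINT x:F i|lborel. h' x)"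
        by (rule lebesgue_integral_countable_add)
          (use Fb union int in \<open>auto simp: disjoint_family_on_def set_integrable_def\<close>)
      also have "\<dots> = 0" using union.IH by simp
      finally show ?case .
    qed
    then show "(LINT x:A|lborel. h' x) = (LINT x:A|lborel. 0)" by simp
  qed (use i' in auto)
  then have "AE x in lebesgue. h' x = 0" by (intro AE_completion) simp
  with h'e' show ?thesis by eventually_elim simp
qed

text \<open>Smooth functions that vanish outside a box and converge to \<open>1\<close> inside it reduce the claim to
  integrals over boxes.\<close>
lemma fundamental_lemma_of_variations:
  fixes g :: "'a::euclidean_space \<Rightarrow> 'b::euclidean_space"
  assumes \<Omega>: "open \<Omega>" and g: "locally_integrable_on g \<Omega>"
    and 0: "\<And>\<psi>::'a \<Rightarrow> real. \<psi> \<in> Cc_smooth \<Omega> \<Longrightarrow> (LINT x:\<Omega>|lebesgue. \<psi> x *\<^sub>R g x) = 0"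
  shows "AE x in lebesgue. x \<in> \<Omega> \<longrightarrow> g x = 0"
proof -
  have loc: "AE x in lebesgue. x \<in> box L U \<longrightarrow> g x = 0" if LU: "cbox L U \<subseteq> \<Omega>" for L U
  proof -
    have gi: "integrable lebesgue (\<lambda>x. indicator (cbox L U) x *\<^sub>R g x)"
      using g LU unfolding locally_integrable_on_def set_integrable_def by auto
    have comp: "AE x in lebesgue. indicator (box L U) x * (g x \<bullet> b) = 0" for b
    proof (rule AE_zero_if_box_integrals_zero[where L=L and U=U])
      have *: "integrable lebesgue (\<lambda>x. indicator (box L U) x *\<^sub>R ((indicator (cbox L U) x *\<^sub>R g x) \<bullet> b))"
        by (intro integrable_mult_indicator integrable_inner_left gi) auto
      have "(\<lambda>x. indicator (box L U) x *\<^sub>R ((indicator (cbox L U) x *\<^sub>R g x) \<bullet> b)) = (\<lambda>x. indicator (box L U) x * (g x \<bullet> b))"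
        using box_subset_cbox[of L U] by (auto simp: indicator_def fun_eq_iff)
      with * show "integrable lebesgue (\<lambda>x. indicator (box L U) x * (g x \<bullet> b))" by simp
    next
      fix l u :: 'a
      obtain l' u' where lu: "box l u \<inter> box L U = box l' u'" using box_Int_box[of l u L U] by blast
      obtain \<zeta> :: "nat \<Rightarrow> 'a \<Rightarrow> real" where z: "\<And>m. smooth (\<zeta> m)" "\<And>m x. 0 \<le> \<zeta> m x" "\<And>m x. \<zeta> m x \<le> 1"
        "\<And>m x. x \<notin> box l' u' \<Longrightarrow> \<zeta> m x = 0" "\<And>x. (\<lambda>m. \<zeta> m x) \<longlonglongrightarrow> indicator (box l' u') x"
        using box_smooth_approx[of l' u'] by blast
      have out: "\<zeta> m x = 0" if "x \<notin> cbox L U" for m x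
        using that z(4)[of x m] lu box_subset_cbox[of L U] by blast
      have zi: "integrable lebesgue (\<lambda>x. \<zeta> m x *\<^sub>R g x)" "(LINT x:\<Omega>|lebesgue. \<zeta> m x *\<^sub>R g x) = (\<integral>x. \<zeta> m x *\<^sub>R g x \<partial>lebesgue)" for m
        using locally_integrable_mult[OF g smooth_continuous_on[OF z(1)] compact_cbox LU out] by auto
      have "\<zeta> m \<in> Cc_smooth \<Omega>" for m by (rule Cc_smoothI[OF z(1) compact_cbox LU out])
      then have "(\<integral>x. \<zeta> m x *\<^sub>R g x \<partial>lebesgue) = 0" for m using 0 zi by auto
      then have z0: "(\<integral>x. (\<zeta> m x *\<^sub>R g x) \<bullet> b \<partial>lebesgue) = 0" for m
        using integral_inner_left[of b, OF zi(1)[of m]] by simp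
      have "(\<lambda>m. \<integral>x. (\<zeta> m x *\<^sub>R g x) \<bullet> b \<partial>lebesgue) \<longlonglongrightarrow> (\<integral>x. indicator (box l' u') x *\<^sub>R (indicator (cbox L U) x *\<^sub>R g x) \<bullet> b \<partial>lebesgue)"
      proof (rule integral_dominated_convergence[where w="\<lambda>x. norm (indicator (cbox L U) x *\<^sub>R g x) * norm b"])
        show "integrable lebesgue (\<lambda>x. norm (indicator (cbox L U) x *\<^sub>R g x) * norm b)"
          using gi by (intro integrable_mult_left integrable_norm)
        show "(\<lambda>x. (\<zeta> m x *\<^sub>R g x) \<bullet> b) \<in> borel_measurable lebesgue" for m
          using zi(1)[of m] by (intro borel_measurable_inner) auto
        show "(\<lambda>x. indicator (box l' u') x *\<^sub>R (indicator (cbox L U) x *\<^sub>R g x) \<bullet> b) \<in> borel_measurable lebesgue"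
          by (intro borel_measurable_inner borel_measurable_scaleR[OF _ borel_measurable_integrable[OF gi]]
              borel_measurable_indicator borel_measurable_const) auto
        show "AE x in lebesgue. (\<lambda>m. (\<zeta> m x *\<^sub>R g x) \<bullet> b) \<longlonglongrightarrow> indicator (box l' u') x *\<^sub>R (indicator (cbox L U) x *\<^sub>R g x) \<bullet> b"
        proof (intro AE_I2)
          fix x
          have eq: "indicator (box l' u') x *\<^sub>R (indicator (cbox L U) x *\<^sub>R g x) = indicator (box l' u') x *\<^sub>R g x"
            using lu box_subset_cbox[of L U] by (auto simp: indicator_def)
          show "(\<lambda>m. (\<zeta> m x *\<^sub>R g x) \<bullet> b) \<longlonglongrightarrow> indicator (box l' u') x *\<^sub>R (indicator (cbox L U) x *\<^sub>R g x) \<bullet> b"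
            unfolding eq by (intro tendsto_intros z(5))
        qed
        show "AE x in lebesgue. norm ((\<zeta> m x *\<^sub>R g x) \<bullet> b) \<le> norm (indicator (cbox L U) x *\<^sub>R g x) * norm b" for m
        proof (intro AE_I2)
          fix x
          have "norm ((\<zeta> m x *\<^sub>R g x) \<bullet> b) \<le> norm (\<zeta> m x *\<^sub>R g x) * norm b"
            unfolding real_norm_def by (rule Cauchy_Schwarz_ineq2)
          also have "norm (\<zeta> m x *\<^sub>R g x) \<le> norm (indicator (cbox L U) x *\<^sub>R g x)"
            using z(2,3)[of m x] out[of x m] by (auto simp: indicator_def intro: mult_left_le_one_le)
          finally show "norm ((\<zeta> m x *\<^sub>R g x) \<bullet> b) \<le> norm (indicator (cbox L U) x *\<^sub>R g x) * norm b"
            by (simp add: mult_right_mono)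
        qed
      qed
      then have "(\<integral>x. indicator (box l' u') x *\<^sub>R (indicator (cbox L U) x *\<^sub>R g x) \<bullet> b \<partial>lebesgue) = 0"
        unfolding z0 by (simp add: LIMSEQ_const_iff)
      moreover have "(\<lambda>x. indicator (box l' u') x *\<^sub>R (indicator (cbox L U) x *\<^sub>R g x) \<bullet> b)
         = (\<lambda>x. indicator (box l u) x *\<^sub>R (indicator (box L U) x * (g x \<bullet> b)))"
        unfolding lu[symmetric] using box_subset_cbox[of L U] by (auto simp: indicator_def fun_eq_iff)
      ultimately show "(LINT x:box l u|lebesgue. indicator (box L U) x * (g x \<bullet> b)) = 0"
        by (simp add: set_lebesgue_integral_def)
    qed (auto simp: indicator_def)
    have "AE x in lebesgue. \<forall>b\<in>Basis. indicator (box L U) x * (g x \<bullet> b) = 0"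
      by (rule AE_finite_allI) (simp, rule comp)
    then show ?thesis
      by eventually_elim (auto simp: euclidean_all_zero_iff)
  qed
  obtain \<D> where D: "countable \<D>" "\<And>X. X \<in> \<D> \<Longrightarrow> X \<subseteq> \<Omega>" "\<And>X. X \<in> \<D> \<Longrightarrow> \<exists>a b. X = cbox a b" "\<Union>\<D> = \<Omega>"
    using open_countable_Union_open_cbox[OF \<Omega>] by (smt (verit, del_insts) Pow_iff subsetD)
  have "AE x in lebesgue. \<forall>X\<in>\<D>. x \<in> X \<longrightarrow> g x = 0"
  proof (rule AE_ball_countable'[OF _ D(1)])
    fix X assume X: "X \<in> \<D>"
    obtain a b where ab: "X = cbox a b" using D(3)[OF X] by blast
    have "cbox a b - box a b \<in> null_sets lebesgue"
      using negligible_frontier_interval by (simp add: negligible_iff_null_sets)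
    then have "AE x in lebesgue. x \<notin> cbox a b - box a b" by (rule AE_not_in)
    moreover have "AE x in lebesgue. x \<in> box a b \<longrightarrow> g x = 0"
      using D(2)[OF X] ab by (intro loc) auto
    ultimately show "AE x in lebesgue. x \<in> X \<longrightarrow> g x = 0"
      by eventually_elim (auto simp: ab)
  qed
  then show ?thesis by eventually_elim (use D(4) in auto)
qed

lemma locally_integrable_column:
  fixes Du :: "real^'n::finite \<Rightarrow> real^'n^'d::finite"
  assumes "locally_integrable_on Du \<Omega>"
  shows "locally_integrable_on (\<lambda>x. column \<alpha> (Du x)) \<Omega>"
proof -
  have bl: "bounded_linear (column \<alpha> :: real^'n^'d \<Rightarrow> real^'d)"
    unfolding linear_conv_bounded_linear[symmetric]
    by (rule linearI) (auto simp: column_def vec_eq_iff)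
  have "integrable lebesgue (\<lambda>x. column \<alpha> (indicator K x *\<^sub>R Du x))" if "compact K" "K \<subseteq> \<Omega>" for K
    using assms that unfolding locally_integrable_on_def set_integrable_def
    by (intro integrable_bounded_linear[OF bl]) auto
  moreover have "column \<alpha> (indicator K x *\<^sub>R Du x) = indicator K x *\<^sub>R column \<alpha> (Du x)" for K x
    by (auto simp: column_def vec_eq_iff)
  ultimately show ?thesis by (simp add: locally_integrable_on_def set_integrable_def)
qed

text \<open>A weak solution comes with some weak gradient. Uniqueness identifies it with the gradient obtained
  from the test functions that approximate the solution, which is the one that can be computed with.\<close>
lemma weak_gradient_unique:
  fixes Du Du' :: "real^'n::finite \<Rightarrow> real^'n^'d::finite"
  assumes \<Omega>: "open \<Omega>" and u: "has_weak_gradient u Du \<Omega>" and u': "has_weak_gradient u' Du' \<Omega>"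
    and eq: "AE x in lebesgue. x \<in> \<Omega> \<longrightarrow> u x = u' x"
  shows "AE x in lebesgue. x \<in> \<Omega> \<longrightarrow> Du x = Du' x"
proof -
  have col: "AE x in lebesgue. x \<in> \<Omega> \<longrightarrow> column \<alpha> (Du x) - column \<alpha> (Du' x) = 0" for \<alpha>
  proof (rule fundamental_lemma_of_variations[OF \<Omega>])
    have l: "locally_integrable_on (\<lambda>x. column \<alpha> (Du x)) \<Omega>" "locally_integrable_on (\<lambda>x. column \<alpha> (Du' x)) \<Omega>"
      using u u' by (auto intro!: locally_integrable_column simp: has_weak_gradient_def)
    then show "locally_integrable_on (\<lambda>x. column \<alpha> (Du x) - column \<alpha> (Du' x)) \<Omega>"
      by (auto simp: locally_integrable_on_def)
    fix \<psi> :: "real^'n \<Rightarrow> real" assume \<psi>: "\<psi> \<in> Cc_smooth \<Omega>"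
    note P = Cc_smoothD[OF \<psi>]
    have cl: "\<psi> x = 0" if "x \<notin> closure {x. \<psi> x \<noteq> 0}" for x using that closure_subset[of "{x. \<psi> x \<noteq> 0}"] by blast
    note i1 = locally_integrable_mult[OF l(1) smooth_continuous_on[OF P(1)] P(2,3) cl]
    note i2 = locally_integrable_mult[OF l(2) smooth_continuous_on[OF P(1)] P(2,3) cl]
    have lu: "locally_integrable_on u \<Omega>" "locally_integrable_on u' \<Omega>" using u u' by (auto simp: has_weak_gradient_def)
    have cl': "frechet_derivative \<psi> (at x) (axis \<alpha> 1) = 0" if "x \<notin> closure {x. \<psi> x \<noteq> 0}" for x
    proof -
      have "(\<psi> has_derivative (\<lambda>_. 0)) (at x)"
      proof (rule has_derivative_transform_within_open[OF has_derivative_const, where s="- closure {x. \<psi> x \<noteq> 0}"])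
        show "open (- closure {x. \<psi> x \<noteq> 0})" by (rule open_Compl) (rule closed_closure)
        show "x \<in> - closure {x. \<psi> x \<noteq> 0}" using that by simp
        show "0 = \<psi> y" if "y \<in> - closure {x. \<psi> x \<noteq> 0}" for y using cl[OF ComplD[OF that]] by (rule sym)
      qed
      then show ?thesis by (metis frechet_derivative_at)
    qed
    have j1: "integrable lebesgue (\<lambda>x. frechet_derivative \<psi> (at x) (axis \<alpha> 1) *\<^sub>R u x)"
      "(LINT x:\<Omega>|lebesgue. frechet_derivative \<psi> (at x) (axis \<alpha> 1) *\<^sub>R u x)
        = (\<integral>x. frechet_derivative \<psi> (at x) (axis \<alpha> 1) *\<^sub>R u x \<partial>lebesgue)"
      by (rule locally_integrable_mult[OF lu(1) smooth_continuous_on[OF smooth_frechet_derivative[OF P(1)]] P(2,3) cl'], assumption)+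
    have j2: "integrable lebesgue (\<lambda>x. frechet_derivative \<psi> (at x) (axis \<alpha> 1) *\<^sub>R u' x)"
      "(LINT x:\<Omega>|lebesgue. frechet_derivative \<psi> (at x) (axis \<alpha> 1) *\<^sub>R u' x)
        = (\<integral>x. frechet_derivative \<psi> (at x) (axis \<alpha> 1) *\<^sub>R u' x \<partial>lebesgue)"
      by (rule locally_integrable_mult[OF lu(2) smooth_continuous_on[OF smooth_frechet_derivative[OF P(1)]] P(2,3) cl'], assumption)+
    have "(LINT x:\<Omega>|lebesgue. \<psi> x *\<^sub>R (column \<alpha> (Du x) - column \<alpha> (Du' x)))
       = (LINT x:\<Omega>|lebesgue. \<psi> x *\<^sub>R column \<alpha> (Du x)) - (LINT x:\<Omega>|lebesgue. \<psi> x *\<^sub>R column \<alpha> (Du' x))"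
    proof -
      have "locally_integrable_on (\<lambda>x. column \<alpha> (Du x) - column \<alpha> (Du' x)) \<Omega>"
        using l by (auto simp: locally_integrable_on_def)
      from locally_integrable_mult[OF this smooth_continuous_on[OF P(1)] P(2,3) cl] show ?thesis
        using i1 i2 by (simp add: scaleR_diff_right)
    qed
    also have "\<dots> = (LINT x:\<Omega>|lebesgue. frechet_derivative \<psi> (at x) (axis \<alpha> 1) *\<^sub>R u' x)
        - (LINT x:\<Omega>|lebesgue. frechet_derivative \<psi> (at x) (axis \<alpha> 1) *\<^sub>R u x)"
      using u u' \<psi> by (simp add: has_weak_gradient_def)
    also have "(LINT x:\<Omega>|lebesgue. frechet_derivative \<psi> (at x) (axis \<alpha> 1) *\<^sub>R u' x)
        = (LINT x:\<Omega>|lebesgue. frechet_derivative \<psi> (at x) (axis \<alpha> 1) *\<^sub>R u x)"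
      unfolding j1(2) j2(2)
    proof (rule integral_cong_AE)
      show "AE x in lebesgue. frechet_derivative \<psi> (at x) (axis \<alpha> 1) *\<^sub>R u' x = frechet_derivative \<psi> (at x) (axis \<alpha> 1) *\<^sub>R u x"
        using eq by eventually_elim (use cl' P(3) in auto)
    qed (use j1 j2 in auto)
    finally show "(LINT x:\<Omega>|lebesgue. \<psi> x *\<^sub>R (column \<alpha> (Du x) - column \<alpha> (Du' x))) = 0" by simp
  qed
  have "AE x in lebesgue. \<forall>\<alpha>\<in>UNIV. x \<in> \<Omega> \<longrightarrow> column \<alpha> (Du x) - column \<alpha> (Du' x) = 0"
    by (rule AE_finite_allI) (simp, rule col)
  then show ?thesis
    by eventually_elim (auto simp: column_def vec_eq_iff)
qed

section \<open>Limits of test functions\<close>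

text \<open>The inverse of taking columns: gradients are assembled from partial derivatives.\<close>
definition of_columns :: "('n::finite \<Rightarrow> real^'d::finite) \<Rightarrow> real^'n^'d" where
  "of_columns c = (\<chi> i \<alpha>. c \<alpha> $ i)"

lemma column_of_columns [simp]: "column \<alpha> (of_columns c) = c \<alpha>"
  by (simp add: of_columns_def column_def vec_eq_iff)

lemma norm_matrix_columns: "(norm M)\<^sup>2 = (\<Sum>\<alpha>\<in>UNIV. (norm (column \<alpha> M))\<^sup>2)" for M :: "real^'n::finite^'d::finite"
proof -
  have "(norm M)\<^sup>2 = (\<Sum>i\<in>UNIV. \<Sum>\<alpha>\<in>UNIV. M $ i $ \<alpha> * M $ i $ \<alpha>)"
    by (simp add: power2_norm_eq_inner inner_vec_def)
  also have "\<dots> = (\<Sum>\<alpha>\<in>UNIV. \<Sum>i\<in>UNIV. M $ i $ \<alpha> * M $ i $ \<alpha>)" by (rule sum.swap)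
  finally show ?thesis by (simp add: power2_norm_eq_inner inner_vec_def column_def)
qed

lemma column_jacobian: "column \<alpha> (jacobian f (at x)) = frechet_derivative f (at x) (axis \<alpha> 1)"
  by (simp add: column_def jacobian_def matrix_def vec_eq_iff)

lemma column_diff [simp]: "column \<alpha> (A - B) = column \<alpha> A - column \<alpha> B"
  and column_add [simp]: "column \<alpha> (A + B) = column \<alpha> A + column \<alpha> B"
  for A B :: "real^'n::finite^'d::finite"
  by (simp_all add: column_def vec_eq_iff)

lemma column_measurable [measurable]:
  "f \<in> borel_measurable M \<Longrightarrow> (\<lambda>x. column \<alpha> (f x)) \<in> borel_measurable M"
  for f :: "_ \<Rightarrow> real^'n::finite^'d::finite"
proof -
  have "linear (column \<alpha> :: real^'n^'d \<Rightarrow> real^'d)"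
    by (rule linearI) (auto simp: column_def vec_eq_iff)
  then have "(column \<alpha> :: real^'n^'d \<Rightarrow> real^'d) \<in> borel_measurable borel"
    by (intro borel_measurable_continuous_onI linear_continuous_on linear_conv_bounded_linear[THEN iffD1])
  then show "f \<in> borel_measurable M \<Longrightarrow> (\<lambda>x. column \<alpha> (f x)) \<in> borel_measurable M"
    by (rule measurable_compose[rotated])
qed

lemma of_columns_measurable:
  fixes c :: "'n::finite \<Rightarrow> _ \<Rightarrow> real^'d::finite"
  assumes [measurable]: "\<And>\<alpha>. c \<alpha> \<in> borel_measurable M"
  shows "(\<lambda>x. of_columns (\<lambda>\<alpha>. c \<alpha> x)) \<in> borel_measurable M"
proof -
  have "(\<lambda>x. c \<alpha> x $ i) \<in> borel_measurable M" for \<alpha> i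
    by (rule measurable_compose[OF assms borel_measurable_continuous_onI[OF continuous_on_component[OF continuous_on_id]]])
  then show ?thesis
    by (subst borel_measurable_euclidean_space) (auto simp: Basis_vec_def inner_axis of_columns_def)
qed

lemma continuous_imp_lebesgue_measurable:
  fixes f :: "'a::euclidean_space \<Rightarrow> 'b::topological_space"
  shows "continuous_on UNIV f \<Longrightarrow> f \<in> borel_measurable lebesgue"
proof -
  assume "continuous_on UNIV f"
  then have "f \<in> borel_measurable borel" by (rule borel_measurable_continuous_onI)
  then have "f \<in> borel_measurable lborel" by simp
  then show "f \<in> borel_measurable lebesgue" by (rule measurable_completion)
qed

lemma integrable_continuous_compact:
  fixes f :: "'a::euclidean_space \<Rightarrow> 'b::euclidean_space"
  assumes "compact K" "continuous_on UNIV f"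
  shows "integrable lebesgue (\<lambda>x. indicator K x *\<^sub>R f x)"
proof -
  have "integrable lborel (\<lambda>x. indicator K x *\<^sub>R f x)"
    by (rule borel_integrable_compact[OF assms(1)]) (rule continuous_on_subset[OF assms(2)], simp)
  then show ?thesis
    by (subst integrable_completion) (auto intro: borel_measurable_integrable)
qed

lemma epow_strict_mono: "x < y \<Longrightarrow> r > 0 \<Longrightarrow> epow x r < epow y r"
  by (cases x; cases y) (auto intro!: ennreal_lessI powr_less_mono2 simp: ennreal_less_iff top.not_eq_extremum)

lemma tendsto_epow_0:
  assumes "(f \<longlongrightarrow> 0) F" "r > 0"
  shows "((\<lambda>k. epow (f k) r) \<longlongrightarrow> 0) F"
proof (rule order_tendstoI)
  fix e :: ennreal assume "0 < e"
  then have "0 < epow e (1 / r)" by (simp add: zero_less_iff_neq_zero)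
  then have "\<forall>\<^sub>F k in F. f k < epow e (1 / r)" by (rule order_tendstoD(2)[OF assms(1)])
  then show "\<forall>\<^sub>F k in F. epow (f k) r < e"
  proof eventually_elim
    case (elim k)
    from epow_strict_mono[OF elim \<open>r > 0\<close>] show ?case using \<open>r > 0\<close> by (simp add: epow_epow)
  qed
qed simp

lemma tendsto_0_ennreal_le:
  assumes "(g \<longlongrightarrow> (0::ennreal)) F" "\<And>k. f k \<le> g k"
  shows "(f \<longlongrightarrow> 0) F"
  using assms by (intro tendsto_sandwich[OF _ _ tendsto_const assms(1)]) auto

lemma nn_integral_norm_powr_le:
  fixes g :: "'a \<Rightarrow> 'b::euclidean_space"
  assumes g[measurable]: "g \<in> borel_measurable M" and K[measurable]: "K \<in> sets M" and r: "0 < r" "r < s"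
  shows "(\<integral>\<^sup>+x. ennreal (norm (g x) powr r) * indicator K x \<partial>M)
    \<le> epow (\<integral>\<^sup>+x. ennreal (norm (g x) powr s) \<partial>M) (r / s) * epow (emeasure M K) (1 - r / s)"
proof -
  have "(\<integral>\<^sup>+x. ennreal (norm (g x) powr r) * indicator K x \<partial>M)
     = (\<integral>\<^sup>+x. epow (ennreal (norm (g x) powr s)) (r / s) * epow (indicator K x) (1 - r / s) \<partial>M)"
    using r by (intro nn_integral_cong) (auto simp: powr_powr indicator_def)
  also have "\<dots> \<le> epow (\<integral>\<^sup>+x. ennreal (norm (g x) powr s) \<partial>M) (r / s) * epow (\<integral>\<^sup>+x. indicator K x \<partial>M) (1 - r / s)"
    by (rule nn_integral_Hoelder2) (use r in auto)
  finally show ?thesis by simp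
qed

lemma tendsto_local_norm_powr:
  fixes g :: "nat \<Rightarrow> 'a \<Rightarrow> 'b::euclidean_space"
  assumes g: "\<And>k. g k \<in> borel_measurable M" and K: "K \<in> sets M" "emeasure M K < \<infinity>" and r: "0 < r" "r < s"
    and lim: "(\<lambda>k. \<integral>\<^sup>+x. ennreal (norm (g k x) powr s) \<partial>M) \<longlonglongrightarrow> 0"
  shows "(\<lambda>k. \<integral>\<^sup>+x. ennreal (norm (g k x) powr r) * indicator K x \<partial>M) \<longlonglongrightarrow> 0"
proof (rule tendsto_0_ennreal_le)
  show "(\<integral>\<^sup>+x. ennreal (norm (g k x) powr r) * indicator K x \<partial>M)
     \<le> epow (\<integral>\<^sup>+x. ennreal (norm (g k x) powr s) \<partial>M) (r / s) * epow (emeasure M K) (1 - r / s)" for k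
    using g K r by (intro nn_integral_norm_powr_le)
  have "(\<lambda>k. epow (emeasure M K) (1 - r / s) * epow (\<integral>\<^sup>+x. ennreal (norm (g k x) powr s) \<partial>M) (r / s)) \<longlonglongrightarrow> epow (emeasure M K) (1 - r / s) * 0"
    using K r by (intro tendsto_mult_ennreal tendsto_const tendsto_epow_0 lim) (auto simp: epow_less_top less_top[symmetric])
  then show "(\<lambda>k. epow (\<integral>\<^sup>+x. ennreal (norm (g k x) powr s) \<partial>M) (r / s) * epow (emeasure M K) (1 - r / s)) \<longlonglongrightarrow> 0"
    by (simp add: mult.commute)
qed

text \<open>Tests have bounded support, so convergence in any \<open>L\<^sup>r\<close> with \<open>r > 1\<close> suffices to pass to the limit
  in tested integrals. This is used for functions with \<open>r = 2 n / (n - 2)\<close> and for gradients with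
  \<open>r = 2\<close>.\<close>
lemma Lp_limit_tested:
  fixes g :: "'a::euclidean_space \<Rightarrow> 'b::euclidean_space"
  assumes g: "g \<in> borel_measurable lebesgue" and h: "\<And>k. continuous_on UNIV (h k)" and r: "r > 1"
    and lim: "(\<lambda>k. \<integral>\<^sup>+x. ennreal (norm (g x - h k x) powr r) \<partial>lebesgue) \<longlonglongrightarrow> 0"
  shows "locally_integrable_on g \<Omega>"
    and "continuous_on UNIV \<psi> \<Longrightarrow> (\<And>x. norm x > M \<Longrightarrow> \<psi> x = 0) \<Longrightarrow>
      (\<lambda>k. \<integral>x. \<psi> x *\<^sub>R h k x \<partial>lebesgue) \<longlonglongrightarrow> (\<integral>x. \<psi> x *\<^sub>R g x \<partial>lebesgue)"
proof -
  have [measurable]: "h k \<in> borel_measurable lebesgue" for k using h by (rule continuous_imp_lebesgue_measurable)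
  note g[measurable]
  have L1: "(\<lambda>k. \<integral>\<^sup>+x. ennreal (norm (g x - h k x)) * indicator K x \<partial>lebesgue) \<longlonglongrightarrow> 0" if "compact K" for K :: "'a set"
  proof -
    have "(\<lambda>k. \<integral>\<^sup>+x. ennreal (norm (g x - h k x) powr 1) * indicator K x \<partial>lebesgue) \<longlonglongrightarrow> 0"
      using that r by (intro tendsto_local_norm_powr[OF _ _ _ _ _ lim])
        (auto simp: compact_imp_closed emeasure_compact_finite fmeasurable_compact fmeasurableD2 less_top[symmetric])
    then show ?thesis by simp
  qed
  show loc: "locally_integrable_on g \<Omega>" for \<Omega>
    unfolding locally_integrable_on_def
  proof (intro allI impI)
    fix K :: "'a set" assume K: "compact K"
    then have [measurable]: "K \<in> sets lebesgue" by (simp add: compact_imp_closed)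
    have "\<forall>\<^sub>F k in sequentially. (\<integral>\<^sup>+x. ennreal (norm (g x - h k x)) * indicator K x \<partial>lebesgue) < 1"
      by (rule order_tendstoD(2)[OF L1[OF K]]) simp
    then obtain k where k: "(\<integral>\<^sup>+x. ennreal (norm (g x - h k x)) * indicator K x \<partial>lebesgue) < 1"
      by (meson eventually_happens' sequentially_bot)
    have 1: "integrable lebesgue (\<lambda>x. indicator K x *\<^sub>R (g x - h k x))"
    proof (rule integrableI_bounded)
      have "(\<integral>\<^sup>+x. ennreal (norm (indicator K x *\<^sub>R (g x - h k x))) \<partial>lebesgue) = (\<integral>\<^sup>+x. ennreal (norm (g x - h k x)) * indicator K x \<partial>lebesgue)"
        by (intro nn_integral_cong) (auto simp: indicator_def)
      with k show "(\<integral>\<^sup>+x. ennreal (norm (indicator K x *\<^sub>R (g x - h k x))) \<partial>lebesgue) < \<infinity>"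
        by (auto intro: less_trans)
    qed measurable
    have 2: "integrable lebesgue (\<lambda>x. indicator K x *\<^sub>R h k x)"
      by (rule integrable_continuous_compact[OF K h])
    from Bochner_Integration.integrable_add[OF 1 2] show "set_integrable lebesgue K g"
      by (simp add: set_integrable_def scaleR_diff_right)
  qed
  assume \<psi>: "continuous_on UNIV \<psi>" and supp: "\<And>x. norm x > M \<Longrightarrow> \<psi> x = 0"
  have out: "\<psi> x = 0" if "x \<notin> cball 0 M" for x using supp[of x] that by simp
  have [measurable]: "cball 0 M \<in> sets (lebesgue :: 'a measure)" by simp
  have "bounded (\<psi> ` cball 0 M)"
    by (intro compact_imp_bounded compact_continuous_image continuous_on_subset[OF \<psi>]) auto
  then obtain B where B: "B > 0" "\<And>x. x \<in> cball 0 M \<Longrightarrow> \<bar>\<psi> x\<bar> \<le> B" by (auto simp: bounded_pos)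
  have lh: "locally_integrable_on (h k) UNIV" for k
    by (simp add: locally_integrable_on_def set_integrable_def integrable_continuous_compact h)
  have ig: "integrable lebesgue (\<lambda>x. \<psi> x *\<^sub>R g x)"
    by (rule locally_integrable_mult(1)[OF loc \<psi> compact_cball subset_UNIV out])
  have ih: "integrable lebesgue (\<lambda>x. \<psi> x *\<^sub>R h k x)" for k
    by (rule locally_integrable_mult(1)[OF lh \<psi> compact_cball subset_UNIV out])
  show "(\<lambda>k. \<integral>x. \<psi> x *\<^sub>R h k x \<partial>lebesgue) \<longlonglongrightarrow> (\<integral>x. \<psi> x *\<^sub>R g x \<partial>lebesgue)"
  proof (rule tendsto_L1_int)
    have "(\<lambda>k. ennreal B * (\<integral>\<^sup>+x. ennreal (norm (g x - h k x)) * indicator (cball 0 M) x \<partial>lebesgue)) \<longlonglongrightarrow> ennreal B * 0"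
      by (intro tendsto_mult_ennreal tendsto_const L1) auto
    then have lim: "(\<lambda>k. ennreal B * (\<integral>\<^sup>+x. ennreal (norm (g x - h k x)) * indicator (cball 0 M) x \<partial>lebesgue)) \<longlonglongrightarrow> 0" by simp
    show "(\<lambda>k. \<integral>\<^sup>+x. norm (\<psi> x *\<^sub>R h k x - \<psi> x *\<^sub>R g x) \<partial>lebesgue) \<longlonglongrightarrow> 0"
    proof (rule tendsto_0_ennreal_le[OF lim])
      fix k
      have "(\<integral>\<^sup>+x. norm (\<psi> x *\<^sub>R h k x - \<psi> x *\<^sub>R g x) \<partial>lebesgue)
         \<le> (\<integral>\<^sup>+x. ennreal B * (ennreal (norm (g x - h k x)) * indicator (cball 0 M) x) \<partial>lebesgue)"
      proof (intro nn_integral_mono)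
        fix x
        have "norm (\<psi> x *\<^sub>R h k x - \<psi> x *\<^sub>R g x) = \<bar>\<psi> x\<bar> * norm (g x - h k x)"
          by (simp add: scaleR_diff_right[symmetric] norm_minus_commute)
        also have "ennreal \<dots> \<le> ennreal B * (ennreal (norm (g x - h k x)) * indicator (cball 0 M) x)"
          using B(2)[of x] B(1) out[of x] by (auto simp: ennreal_mult[symmetric] indicator_def intro!: ennreal_leI mult_right_mono)
        finally show "ennreal (norm (\<psi> x *\<^sub>R h k x - \<psi> x *\<^sub>R g x)) \<le> ennreal B * (ennreal (norm (g x - h k x)) * indicator (cball 0 M) x)" .
      qed
      also have "\<dots> = ennreal B * (\<integral>\<^sup>+x. ennreal (norm (g x - h k x)) * indicator (cball 0 M) x \<partial>lebesgue)"
        by (rule nn_integral_cmult) measurable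
      finally show "(\<integral>\<^sup>+x. norm (\<psi> x *\<^sub>R h k x - \<psi> x *\<^sub>R g x) \<partial>lebesgue) \<le> \<dots>" .
    qed
  qed (fact ih, fact ig)
qed

text \<open>The Sobolev exponent.\<close>
definition crit_exp :: "'n::finite itself \<Rightarrow> real" where
  "crit_exp _ = 2 * real CARD('n) / (real CARD('n) - 2)"

text \<open>The part of the completion of the test functions that does not refer to the weight. Convergence
  almost everywhere is included, because the derivative of a nonlinear map at the approximations
  has to converge pointwise in the chain rule.\<close>
definition smooth_limit ::
  "(real^'n::finite \<Rightarrow> real^'d::finite) \<Rightarrow> (real^'n \<Rightarrow> real^'n^'d) \<Rightarrow> (nat \<Rightarrow> real^'n \<Rightarrow> real^'d) \<Rightarrow> bool" where
  "smooth_limit U DU \<phi> \<longleftrightarrow>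
     U \<in> borel_measurable lebesgue \<and> DU \<in> borel_measurable lebesgue \<and> (\<forall>k. \<phi> k \<in> Cc_smooth UNIV) \<and>
     (\<lambda>k. \<integral>\<^sup>+x. ennreal (norm (U x - \<phi> k x) powr crit_exp TYPE('n)) \<partial>lebesgue) \<longlonglongrightarrow> 0 \<and>
     (\<lambda>k. \<integral>\<^sup>+x. ennreal ((norm (DU x - jacobian (\<phi> k) (at x)))\<^sup>2) \<partial>lebesgue) \<longlonglongrightarrow> 0 \<and>
     (AE x in lebesgue. (\<lambda>k. \<phi> k x) \<longlonglongrightarrow> U x)"

lemma smooth_limitD:
  fixes U :: "real^'n::finite \<Rightarrow> real^'d::finite"
  assumes "smooth_limit U DU \<phi>"
  shows "U \<in> borel_measurable lebesgue" "DU \<in> borel_measurable lebesgue" "\<And>k. \<phi> k \<in> Cc_smooth UNIV"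
    "(\<lambda>k. \<integral>\<^sup>+x. ennreal (norm (U x - \<phi> k x) powr crit_exp TYPE('n)) \<partial>lebesgue) \<longlonglongrightarrow> 0"
    "(\<lambda>k. \<integral>\<^sup>+x. ennreal ((norm (DU x - jacobian (\<phi> k) (at x)))\<^sup>2) \<partial>lebesgue) \<longlonglongrightarrow> 0"
    "AE x in lebesgue. (\<lambda>k. \<phi> k x) \<longlonglongrightarrow> U x"
    "\<And>k. smooth (\<phi> k)"
  using assms Cc_smoothD(1) unfolding smooth_limit_def by blast+

lemma crit_exp_gt_2: "CARD('n::finite) \<ge> 3 \<Longrightarrow> crit_exp TYPE('n) > 2"
  by (simp add: crit_exp_def field_simps)

lemma continuous_jacobian: "smooth \<phi> \<Longrightarrow> continuous_on UNIV (\<lambda>x. jacobian \<phi> (at x))"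
  for \<phi> :: "real^'n::finite \<Rightarrow> real^'d::finite"
proof -
  assume "smooth \<phi>"
  then have "continuous_on UNIV (\<lambda>x. frechet_derivative \<phi> (at x) (axis \<alpha> 1))" for \<alpha>
    by (intro smooth_continuous_on smooth_frechet_derivative)
  then show ?thesis unfolding jacobian_def matrix_def
    by (intro continuous_on_vec_lambda continuous_on_component) auto
qed

lemma Cc_smooth_jacobian_0:
  fixes \<phi> :: "real^'n::finite \<Rightarrow> real^'d::finite"
  assumes "\<And>x. norm x > M \<Longrightarrow> \<phi> x = 0" "smooth \<phi>" "norm x > M"
  shows "jacobian \<phi> (at x) = 0"
  using derivative_zero_outside_support[OF smooth_has_derivative[OF assms(2)] assms(1,3)]
  by (simp add: jacobian_def matrix_def vec_eq_iff)

text \<open>Integration by parts holds for the approximating test functions and survives in the limit.\<close>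
lemma smooth_limit_weak_gradient:
  fixes U :: "real^'n::finite \<Rightarrow> real^'d::finite"
  assumes n: "CARD('n) \<ge> 3" and U: "smooth_limit U DU \<phi>"
  shows "has_weak_gradient U DU \<Omega>"
  unfolding has_weak_gradient_def
proof (intro conjI allI impI)
  note S = smooth_limitD[OF U]
  have lim2: "(\<lambda>k. \<integral>\<^sup>+x. ennreal (norm (DU x - jacobian (\<phi> k) (at x)) powr 2) \<partial>lebesgue) \<longlonglongrightarrow> 0"
    using S(5) by (simp add: powr_numeral)
  have p: "crit_exp TYPE('n) > 1" using crit_exp_gt_2[OF n] by simp
  note LU = Lp_limit_tested[OF S(1) smooth_continuous_on[OF S(7)] p S(4)]
  have LD: "locally_integrable_on DU \<Omega>" for \<Omega>
    by (rule Lp_limit_tested(1)[OF S(2) continuous_jacobian[OF S(7)] _ lim2]) simp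
  show lU: "locally_integrable_on U \<Omega>" by (rule LU(1))
  show "locally_integrable_on DU \<Omega>" by (rule LD)
  fix \<psi> :: "real^'n \<Rightarrow> real" and \<alpha> assume \<psi>: "\<psi> \<in> Cc_smooth \<Omega>"
  note P = Cc_smoothD[OF \<psi>]
  obtain M where M: "\<And>x. norm x > M \<Longrightarrow> \<psi> x = 0" using P(4) by blast
  let ?K = "closure {x. \<psi> x \<noteq> 0}"
  let ?d = "\<lambda>x. frechet_derivative \<psi> (at x) (axis \<alpha> 1)"
  have c: "continuous_on UNIV \<psi>" "continuous_on UNIV ?d"
    by (intro smooth_continuous_on smooth_frechet_derivative P)+
  have cl: "\<psi> x = 0" if "x \<notin> ?K" for x
    using that closure_subset[of "{x. \<psi> x \<noteq> 0}"] by blast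
  have cl': "?d x = 0" if "x \<notin> ?K" for x
  proof -
    have "(\<psi> has_derivative (\<lambda>_. 0)) (at x)"
    proof (rule has_derivative_transform_within_open[OF has_derivative_const, where s="- ?K"])
      show "open (- ?K)" by (rule open_Compl) (rule closed_closure)
      show "x \<in> - ?K" using that by simp
      show "0 = \<psi> y" if "y \<in> - ?K" for y using cl[OF ComplD[OF that]] by (rule sym)
    qed
    then show ?thesis by (metis frechet_derivative_at)
  qed
  have d0: "?d x = 0" if "norm x > M" for x
    using derivative_zero_outside_support[OF smooth_has_derivative[OF P(1)] M that] by simp
  have "(\<lambda>k. \<integral>x. \<psi> x *\<^sub>R jacobian (\<phi> k) (at x) \<partial>lebesgue) \<longlonglongrightarrow> (\<integral>x. \<psi> x *\<^sub>R DU x \<partial>lebesgue)"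
    by (rule Lp_limit_tested(2)[OF S(2) continuous_jacobian[OF S(7)] _ lim2 c(1) M]) simp_all
  have bl: "bounded_linear (column \<alpha> :: real^'n^'d \<Rightarrow> real^'d)"
    unfolding linear_conv_bounded_linear[symmetric] by (rule linearI) (auto simp: column_def vec_eq_iff)
  have col: "(\<integral>x. \<psi> x *\<^sub>R column \<alpha> (G x) \<partial>lebesgue) = column \<alpha> (\<integral>x. \<psi> x *\<^sub>R G x \<partial>lebesgue)"
    if "locally_integrable_on G UNIV" for G :: "real^'n \<Rightarrow> real^'n^'d"
  proof -
    have "integrable lebesgue (\<lambda>x. \<psi> x *\<^sub>R G x)"
      by (rule locally_integrable_mult(1)[OF that c(1) P(2)]) (auto intro: cl)
    from integral_bounded_linear[OF bl this] show ?thesis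
      by (simp add: linear_simps(5)[OF bl])
  qed
  have cj: "locally_integrable_on (\<lambda>x. jacobian (\<phi> k) (at x)) UNIV" for k
    by (simp add: locally_integrable_on_def set_integrable_def integrable_continuous_compact continuous_jacobian[OF S(7)])
  have lim1: "(\<lambda>k. \<integral>x. \<psi> x *\<^sub>R column \<alpha> (jacobian (\<phi> k) (at x)) \<partial>lebesgue) \<longlonglongrightarrow> (\<integral>x. \<psi> x *\<^sub>R column \<alpha> (DU x) \<partial>lebesgue)"
    unfolding col[OF cj] col[OF LD]
    by (rule bounded_linear.tendsto[OF bl]) fact
  have "(\<lambda>k. \<integral>x. ?d x *\<^sub>R \<phi> k x \<partial>lebesgue) \<longlonglongrightarrow> (\<integral>x. ?d x *\<^sub>R U x \<partial>lebesgue)"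
    by (rule LU(2)[OF c(2) d0])
  moreover have "(\<integral>x. ?d x *\<^sub>R \<phi> k x \<partial>lebesgue) = - (\<integral>x. \<psi> x *\<^sub>R column \<alpha> (jacobian (\<phi> k) (at x)) \<partial>lebesgue)" for k
    unfolding column_jacobian by (rule integral_by_parts_smooth[OF S(7) P(1) M])
  ultimately have "(\<integral>x. ?d x *\<^sub>R U x \<partial>lebesgue) = - (\<integral>x. \<psi> x *\<^sub>R column \<alpha> (DU x) \<partial>lebesgue)"
    using tendsto_minus[OF lim1] LIMSEQ_unique by auto
  moreover have "(LINT x:\<Omega>|lebesgue. ?d x *\<^sub>R U x) = (\<integral>x. ?d x *\<^sub>R U x \<partial>lebesgue)"
    by (rule locally_integrable_mult(2)[OF lU c(2) P(2,3) cl'])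
  moreover have "(LINT x:\<Omega>|lebesgue. \<psi> x *\<^sub>R column \<alpha> (DU x)) = (\<integral>x. \<psi> x *\<^sub>R column \<alpha> (DU x) \<partial>lebesgue)"
    by (rule locally_integrable_mult(2)[OF locally_integrable_column[OF LD] c(1) P(2,3) cl])
  ultimately show "(LINT x:\<Omega>|lebesgue. ?d x *\<^sub>R U x) = - (LINT x:\<Omega>|lebesgue. \<psi> x *\<^sub>R column \<alpha> (DU x))"
    by simp
qed

text \<open>With \<open>\<delta>\<close> close to \<open>0\<close> the error of approximation is separated from the gradient at a cost
  arbitrarily close to the factor \<open>1\<close>.\<close>
lemma norm_add_sq_le:
  fixes a b :: "'b::real_normed_vector"
  assumes "\<delta> > 0"
  shows "(norm (a + b))\<^sup>2 \<le> (1 + \<delta>) * (norm a)\<^sup>2 + (1 + 1 / \<delta>) * (norm b)\<^sup>2"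
proof -
  have "(norm (a + b))\<^sup>2 \<le> (norm a + norm b)\<^sup>2" by (intro power_mono norm_triangle_ineq) auto
  also have "\<dots> = (norm a)\<^sup>2 + (norm b)\<^sup>2 + 2 * (norm a * norm b)" by (simp add: power2_sum)
  also have "2 * (norm a * norm b) \<le> \<delta> * (norm a)\<^sup>2 + (norm b)\<^sup>2 / \<delta>"
  proof -
    have "0 \<le> (\<delta> * norm a - norm b)\<^sup>2 / \<delta>" using assms by simp
    also have "\<dots> = \<delta> * (norm a)\<^sup>2 + (norm b)\<^sup>2 / \<delta> - 2 * (norm a * norm b)"
      using assms by (simp add: power2_diff field_simps power2_eq_square)
    finally show ?thesis by simp
  qed
  finally show ?thesis by (simp add: algebra_simps)
qed

text \<open>Fatou's lemma on the left-hand side, convergence of the gradients on the right-hand side.\<close>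
lemma smooth_limit_Sobolev:
  fixes U :: "real^'n::finite \<Rightarrow> real^'d::finite"
  assumes n: "CARD('n) \<ge> 3" and U: "smooth_limit U DU \<phi>"
  shows "epow (\<integral>\<^sup>+x. ennreal (norm (U x) powr crit_exp TYPE('n)) \<partial>lebesgue) ((real CARD('n) - 2) / real CARD('n))
    \<le> 16 * (\<integral>\<^sup>+x. ennreal ((norm (DU x))\<^sup>2) \<partial>lebesgue)"
    and "(\<integral>\<^sup>+x. ennreal ((norm (DU x))\<^sup>2) \<partial>lebesgue) < \<infinity>"
    and "(\<integral>\<^sup>+x. ennreal (norm (U x) powr crit_exp TYPE('n)) \<partial>lebesgue) < \<infinity>"
proof -
  note S = smooth_limitD[OF U]
  let ?p = "crit_exp TYPE('n)"
  let ?t = "(real CARD('n) - 2) / real CARD('n)"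
  have t: "?t > 0" "1 / ?t > 0" using n by auto
  define A where "A = (\<integral>\<^sup>+x. ennreal ((norm (DU x))\<^sup>2) \<partial>lebesgue)"
  define Ak where "Ak k = (\<integral>\<^sup>+x. ennreal ((norm (jacobian (\<phi> k) (at x)))\<^sup>2) \<partial>lebesgue)" for k
  define Bk where "Bk k = (\<integral>\<^sup>+x. ennreal ((norm (DU x - jacobian (\<phi> k) (at x)))\<^sup>2) \<partial>lebesgue)" for k
  define I where "I = (\<integral>\<^sup>+x. ennreal (norm (U x) powr ?p) \<partial>lebesgue)"
  have [measurable]: "U \<in> borel_measurable lebesgue" "DU \<in> borel_measurable lebesgue" by (fact S)+
  have jm[measurable]: "(\<lambda>x. jacobian (\<phi> k) (at x)) \<in> borel_measurable lebesgue" for k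
    by (intro continuous_imp_lebesgue_measurable continuous_jacobian S)
  have pm[measurable]: "\<phi> k \<in> borel_measurable lebesgue" for k
    by (intro continuous_imp_lebesgue_measurable smooth_continuous_on S)
  have B0: "Bk \<longlonglongrightarrow> 0" using S(5) unfolding Bk_def .
  have sob: "epow (\<integral>\<^sup>+x. ennreal (norm (\<phi> k x) powr ?p) \<partial>lebesgue) ?t \<le> 16 * Ak k" for k
  proof -
    obtain M where M: "\<And>x. norm x > M \<Longrightarrow> \<phi> k x = 0" using Cc_smoothD(4)[OF S(3)] by blast
    have "(\<Sum>b\<in>Basis. (norm (frechet_derivative (\<phi> k) (at x) b))\<^sup>2) = (norm (jacobian (\<phi> k) (at x)))\<^sup>2" for x
    proof -
      have "(Basis :: (real^'n) set) = (\<lambda>i. axis i 1) ` UNIV" by (auto simp: Basis_vec_def)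
      moreover have "inj (\<lambda>i::'n. axis i (1::real))" by (auto simp: inj_def axis_eq_axis)
      ultimately have "(\<Sum>b\<in>Basis. (norm (frechet_derivative (\<phi> k) (at x) b))\<^sup>2)
          = (\<Sum>\<alpha>\<in>UNIV. (norm (frechet_derivative (\<phi> k) (at x) (axis \<alpha> 1)))\<^sup>2)"
        by (subst \<open>Basis = _\<close>, subst sum.reindex) (simp_all only: o_def)
      then show ?thesis by (simp only: norm_matrix_columns column_jacobian)
    qed
    then show ?thesis
      using Sobolev_C1[of "\<phi> k" "\<lambda>x. frechet_derivative (\<phi> k) (at x)" M] n M
        smooth_has_derivative[OF S(7)] smooth_continuous_on[OF smooth_frechet_derivative[OF S(7)]]
      by (simp add: nn_integral_completion Ak_def crit_exp_def)
  qed
  have Afin: "A < \<infinity>"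
  proof -
    have "\<forall>\<^sub>F k in sequentially. Bk k < 1" by (rule order_tendstoD(2)[OF B0]) simp
    then obtain k where k: "Bk k < 1" by (meson eventually_happens' sequentially_bot)
    obtain M where M: "\<And>x. norm x > M \<Longrightarrow> \<phi> k x = 0" using Cc_smoothD(4)[OF S(3)] by blast
    have "integrable lebesgue (\<lambda>x. (norm (jacobian (\<phi> k) (at x)))\<^sup>2)"
      by (rule integrable_compact_support[where M=M])
        (auto intro!: continuous_intros continuous_jacobian S simp: Cc_smooth_jacobian_0[OF M S(7)])
    then have Akf: "Ak k < \<infinity>" unfolding Ak_def integrable_iff_bounded by simp
    have "A \<le> (\<integral>\<^sup>+x. 2 * ennreal ((norm (DU x - jacobian (\<phi> k) (at x)))\<^sup>2) + 2 * ennreal ((norm (jacobian (\<phi> k) (at x)))\<^sup>2) \<partial>lebesgue)"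
      unfolding A_def
    proof (intro nn_integral_mono)
      fix x
      have "(norm (DU x))\<^sup>2 \<le> 2 * (norm (DU x - jacobian (\<phi> k) (at x)))\<^sup>2 + 2 * (norm (jacobian (\<phi> k) (at x)))\<^sup>2"
        using norm_add_sq_le[of 1 "DU x - jacobian (\<phi> k) (at x)" "jacobian (\<phi> k) (at x)"] by simp
      then have "ennreal ((norm (DU x))\<^sup>2) \<le> ennreal (2 * (norm (DU x - jacobian (\<phi> k) (at x)))\<^sup>2 + 2 * (norm (jacobian (\<phi> k) (at x)))\<^sup>2)"
        by (rule ennreal_leI)
      also have "\<dots> = 2 * ennreal ((norm (DU x - jacobian (\<phi> k) (at x)))\<^sup>2) + 2 * ennreal ((norm (jacobian (\<phi> k) (at x)))\<^sup>2)"
        by (simp add: ennreal_plus ennreal_mult)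
      finally show "ennreal ((norm (DU x))\<^sup>2) \<le> \<dots>" .
    qed
    also have "\<dots> = 2 * Bk k + 2 * Ak k"
      unfolding Ak_def Bk_def by (simp add: nn_integral_add nn_integral_cmult)
    also have "\<dots> < \<infinity>" using k Akf
      by (auto simp: ennreal_mult_eq_top_iff less_top[symmetric] dest: less_trans)
    finally show ?thesis .
  qed
  have main: "epow I ?t \<le> 16 * ennreal c" if c: "A < ennreal c" for c
  proof -
    obtain a where a: "A = ennreal a" "a \<ge> 0" using Afin by (cases A) auto
    have ac: "a < c" using c a by (simp add: ennreal_less_iff)
    \<comment> \<open>room for the error of approximation\<close>
    obtain \<delta> where d: "\<delta> > 0" "(1 + \<delta>) * a < c"
    proof -
      have "(1 + (c - a) / (2 * (a + 1))) * a = a + (c - a) * (a / (2 * (a + 1)))" using a by (simp add: algebra_simps)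
      also have "a / (2 * (a + 1)) < 1" using a by (simp add: divide_less_eq)
      then have "a + (c - a) * (a / (2 * (a + 1))) < a + (c - a) * 1" using ac by (intro add_strict_left_mono mult_strict_left_mono) auto
      finally show ?thesis using a ac by (intro that[of "(c - a) / (2 * (a + 1))"]) auto
    qed
    have Akle: "Ak k \<le> ennreal ((1 + \<delta>) * a) + ennreal (1 + 1 / \<delta>) * Bk k" for k
    proof -
      have "Ak k \<le> (\<integral>\<^sup>+x. ennreal (1 + \<delta>) * ennreal ((norm (DU x))\<^sup>2) + ennreal (1 + 1 / \<delta>) * ennreal ((norm (DU x - jacobian (\<phi> k) (at x)))\<^sup>2) \<partial>lebesgue)"
        unfolding Ak_def
      proof (intro nn_integral_mono)
        fix x
        have "(norm (jacobian (\<phi> k) (at x)))\<^sup>2 \<le> (1 + \<delta>) * (norm (DU x))\<^sup>2 + (1 + 1 / \<delta>) * (norm (DU x - jacobian (\<phi> k) (at x)))\<^sup>2"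
          using norm_add_sq_le[OF d(1), of "DU x" "- (DU x - jacobian (\<phi> k) (at x))"] unfolding norm_minus_cancel by simp
        then have "ennreal ((norm (jacobian (\<phi> k) (at x)))\<^sup>2) \<le> ennreal ((1 + \<delta>) * (norm (DU x))\<^sup>2 + (1 + 1 / \<delta>) * (norm (DU x - jacobian (\<phi> k) (at x)))\<^sup>2)"
          by (rule ennreal_leI)
        also have "\<dots> = ennreal (1 + \<delta>) * ennreal ((norm (DU x))\<^sup>2) + ennreal (1 + 1 / \<delta>) * ennreal ((norm (DU x - jacobian (\<phi> k) (at x)))\<^sup>2)"
          using d(1) by (subst ennreal_plus) (simp_all add: ennreal_mult del: ennreal_plus)
        finally show "ennreal ((norm (jacobian (\<phi> k) (at x)))\<^sup>2) \<le> \<dots>" .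
      qed
      also have "\<dots> = ennreal (1 + \<delta>) * A + ennreal (1 + 1 / \<delta>) * Bk k"
        unfolding A_def Bk_def by (simp add: nn_integral_add nn_integral_cmult)
      finally show ?thesis using d a by (simp add: ennreal_mult[symmetric] del: ennreal_plus)
    qed
    have "(\<lambda>k. ennreal ((1 + \<delta>) * a) + ennreal (1 + 1 / \<delta>) * Bk k) \<longlonglongrightarrow> ennreal ((1 + \<delta>) * a) + ennreal (1 + 1 / \<delta>) * 0"
      by (intro tendsto_add tendsto_mult_ennreal tendsto_const B0) auto
    then have "\<forall>\<^sub>F k in sequentially. ennreal ((1 + \<delta>) * a) + ennreal (1 + 1 / \<delta>) * Bk k < ennreal c"
      by (rule order_tendstoD(2)) (use d a ac in \<open>auto intro!: ennreal_lessI\<close>)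
    then have ev: "\<forall>\<^sub>F k in sequentially. (\<integral>\<^sup>+x. ennreal (norm (\<phi> k x) powr ?p) \<partial>lebesgue) \<le> epow (16 * ennreal c) (1 / ?t)"
    proof eventually_elim
      case (elim k)
      have "(\<integral>\<^sup>+x. ennreal (norm (\<phi> k x) powr ?p) \<partial>lebesgue) = epow (epow (\<integral>\<^sup>+x. ennreal (norm (\<phi> k x) powr ?p) \<partial>lebesgue) ?t) (1 / ?t)"
        using n by (simp add: epow_epow)
      also have "\<dots> \<le> epow (16 * ennreal c) (1 / ?t)"
        using elim Akle[of k] t(2) by (intro epow_mono order_trans[OF sob] mult_left_mono) auto
      finally show ?case .
    qed
    have "I \<le> (\<integral>\<^sup>+x. liminf (\<lambda>k. ennreal (norm (\<phi> k x) powr ?p)) \<partial>lebesgue)"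
      unfolding I_def
    proof (rule nn_integral_mono_AE)
      show "AE x in lebesgue. ennreal (norm (U x) powr ?p) \<le> liminf (\<lambda>k. ennreal (norm (\<phi> k x) powr ?p))"
        using S(6)
      proof eventually_elim
        case (elim x)
        have "(\<lambda>k. ennreal (norm (\<phi> k x) powr ?p)) \<longlonglongrightarrow> ennreal (norm (U x) powr ?p)"
          using crit_exp_gt_2[OF n] by (intro tendsto_ennrealI tendsto_powr' tendsto_norm elim tendsto_const) auto
        from lim_imp_Liminf[OF sequentially_bot this] show ?case by simp
      qed
    qed
    also have "\<dots> \<le> liminf (\<lambda>k. \<integral>\<^sup>+x. ennreal (norm (\<phi> k x) powr ?p) \<partial>lebesgue)"
      by (rule nn_integral_liminf) measurable
    also have "\<dots> \<le> liminf (\<lambda>k. epow (16 * ennreal c) (1 / ?t))"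
      by (rule Liminf_mono[OF ev])
    also have "\<dots> = epow (16 * ennreal c) (1 / ?t)" by (simp add: Liminf_const)
    finally have "epow I ?t \<le> epow (epow (16 * ennreal c) (1 / ?t)) ?t" using t by (intro epow_mono) auto
    then show ?thesis using n by (simp add: epow_epow)
  qed
  have final: "epow I ?t \<le> 16 * A"
  proof -
    obtain a where a: "A = ennreal a" "a \<ge> 0" using Afin by (cases A) auto
    have eps: "epow I ?t \<le> ennreal (16 * a) + ennreal e" if "e > 0" for e
    proof -
      have "epow I ?t \<le> 16 * ennreal (a + e / 16)" using a that by (intro main) (auto intro!: ennreal_lessI)
      also have "\<dots> = ennreal 16 * ennreal (a + e / 16)" by simp
      also have "\<dots> = ennreal (16 * (a + e / 16))" using a that by (intro ennreal_mult[symmetric]) auto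
      also have "16 * (a + e / 16) = 16 * a + e" by simp
      also have "ennreal \<dots> = ennreal (16 * a) + ennreal e" using a that by (intro ennreal_plus) auto
      finally show ?thesis .
    qed
    have "epow I ?t \<le> ennreal (16 * a)" by (rule ennreal_le_epsilon) (rule eps)
    then show ?thesis using a by (simp add: ennreal_mult)
  qed
  then show "epow (\<integral>\<^sup>+x. ennreal (norm (U x) powr crit_exp TYPE('n)) \<partial>lebesgue) ?t \<le> 16 * (\<integral>\<^sup>+x. ennreal ((norm (DU x))\<^sup>2) \<partial>lebesgue)"
    unfolding I_def A_def .
  show "(\<integral>\<^sup>+x. ennreal ((norm (DU x))\<^sup>2) \<partial>lebesgue) < \<infinity>" using Afin unfolding A_def .
  have "epow I ?t < \<infinity>"
  proof (rule le_less_trans[OF final])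
    show "16 * A < \<infinity>" using Afin by (simp add: ennreal_mult_less_top)
  qed
  then show "(\<integral>\<^sup>+x. ennreal (norm (U x) powr crit_exp TYPE('n)) \<partial>lebesgue) < \<infinity>"
    unfolding I_def[symmetric] by (cases I) auto
qed

lemma Lp_norm_epow: "Lp_norm p \<Omega> f = epow (\<integral>\<^sup>+x. ennreal (norm (f x) powr p) \<partial>lebesgue_on \<Omega>) (1 / p)"
  by (simp add: Lp_norm_def epow_def Let_def)

text \<open>Convergence in \<open>L\<^sup>p\<close> yields convergence almost everywhere along a subsequence.\<close>
lemma smooth_limit_subseq:
  fixes U :: "real^'n::finite \<Rightarrow> real^'d::finite"
  assumes n: "CARD('n) \<ge> 3" and m: "U \<in> borel_measurable lebesgue" "DU \<in> borel_measurable lebesgue"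
    and \<phi>: "\<And>k. \<phi> k \<in> Cc_smooth UNIV"
    and l1: "(\<lambda>k. \<integral>\<^sup>+x. ennreal (norm (U x - \<phi> k x) powr crit_exp TYPE('n)) \<partial>lebesgue) \<longlonglongrightarrow> 0"
    and l2: "(\<lambda>k. \<integral>\<^sup>+x. ennreal ((norm (DU x - jacobian (\<phi> k) (at x)))\<^sup>2) \<partial>lebesgue) \<longlonglongrightarrow> 0"
  shows "\<exists>\<phi>'. smooth_limit U DU \<phi>'"
proof -
  let ?p = "crit_exp TYPE('n)"
  have p: "?p > 0" using crit_exp_gt_2[OF n] by simp
  note m(1)[measurable]
  have [measurable]: "\<phi> k \<in> borel_measurable lebesgue" for k
    by (intro continuous_imp_lebesgue_measurable smooth_continuous_on Cc_smoothD(1)[OF \<phi>])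
  have "\<forall>\<^sub>F k in sequentially. (\<integral>\<^sup>+x. ennreal (norm (U x - \<phi> k x) powr ?p) \<partial>lebesgue) < 1"
    by (rule order_tendstoD(2)[OF l1]) simp
  then obtain N where N: "\<And>k. k \<ge> N \<Longrightarrow> (\<integral>\<^sup>+x. ennreal (norm (U x - \<phi> k x) powr ?p) \<partial>lebesgue) < 1"
    by (auto simp: eventually_sequentially)
  define g where "g k x = norm (U x - \<phi> (k + N) x) powr ?p" for k x
  have gm[measurable]: "g k \<in> borel_measurable lebesgue" for k unfolding g_def[abs_def] by measurable
  have gi: "integrable lebesgue (g k)" for k
  proof (rule integrableI_bounded[OF gm])
    show "(\<integral>\<^sup>+x. ennreal (norm (g k x)) \<partial>lebesgue) < \<infinity>"
      using N[of "k + N"] by (auto simp: g_def intro: less_trans)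
  qed
  have "(\<lambda>k. enn2real (\<integral>\<^sup>+x. ennreal (norm (U x - \<phi> (k + N) x) powr ?p) \<partial>lebesgue)) \<longlonglongrightarrow> enn2real 0"
    using LIMSEQ_ignore_initial_segment[OF l1, of N] by (intro tendsto_enn2real) auto
  moreover have "(\<integral>x. norm (g k x) \<partial>lebesgue) = enn2real (\<integral>\<^sup>+x. ennreal (norm (U x - \<phi> (k + N) x) powr ?p) \<partial>lebesgue)" for k
    by (subst integral_eq_nn_integral) (auto simp: g_def)
  ultimately have "(\<lambda>k. \<integral>x. norm (g k x) \<partial>lebesgue) \<longlonglongrightarrow> 0" by simp
  from tendsto_L1_AE_subseq[OF gi this] obtain r :: "nat \<Rightarrow> nat" where r: "strict_mono r"
    and ae: "AE x in lebesgue. (\<lambda>k. g (r k) x) \<longlonglongrightarrow> 0" by blast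
  define s where "s k = r k + N" for k
  have s: "strict_mono s" using r by (auto simp: s_def strict_mono_def)
  have "smooth_limit U DU (\<lambda>k. \<phi> (s k))"
    unfolding smooth_limit_def
  proof (intro conjI allI m \<phi>)
    show "(\<lambda>k. \<integral>\<^sup>+x. ennreal (norm (U x - \<phi> (s k) x) powr ?p) \<partial>lebesgue) \<longlonglongrightarrow> 0"
      using LIMSEQ_subseq_LIMSEQ[OF l1 s] by (simp add: o_def)
    show "(\<lambda>k. \<integral>\<^sup>+x. ennreal ((norm (DU x - jacobian (\<phi> (s k)) (at x)))\<^sup>2) \<partial>lebesgue) \<longlonglongrightarrow> 0"
      using LIMSEQ_subseq_LIMSEQ[OF l2 s] by (simp add: o_def)
    show "AE x in lebesgue. (\<lambda>k. \<phi> (s k) x) \<longlonglongrightarrow> U x"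
      using ae
    proof eventually_elim
      case (elim x)
      have "(\<lambda>k. g (r k) x powr (1 / ?p)) \<longlonglongrightarrow> 0"
        using p by (intro tendsto_zero_powrI[OF elim tendsto_const]) (auto simp: g_def)
      moreover have "g (r k) x powr (1 / ?p) = norm (U x - \<phi> (s k) x)" for k
        using p by (simp add: g_def s_def powr_powr)
      ultimately have "(\<lambda>k. norm (\<phi> (s k) x - U x)) \<longlonglongrightarrow> 0" by (simp add: norm_minus_commute)
      then show ?case by (rule LIM_zero_cancel[OF tendsto_norm_zero_cancel])
    qed
  qed
  then show ?thesis by blast
qed

text \<open>The weight is positive semidefinite, so its contribution to the norm may be omitted.\<close>
lemma W12V0_UNIV_smooth_limit:
  fixes U :: "real^'n::finite \<Rightarrow> real^'d::finite"
  assumes n: "CARD('n) \<ge> 3" and V: "matrix_weight V" and U: "U \<in> W12V0 V UNIV"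
  shows "\<exists>DU \<phi>. smooth_limit U DU \<phi>"
proof -
  let ?p = "crit_exp TYPE('n)"
  have p: "?p > 0" using crit_exp_gt_2[OF n] by simp
  from U obtain DU \<phi> where U1: "U \<in> Lp_space ?p UNIV" and DU: "DU \<in> Lp_space 2 UNIV"
    and \<phi>: "\<And>k. \<phi> k \<in> Cc_smooth UNIV"
    and l1: "(\<lambda>k. Lp_norm ?p UNIV (\<lambda>x. U x - \<phi> k x)) \<longlonglongrightarrow> 0"
    and l2: "(\<lambda>k. W12_normsq V UNIV (\<lambda>x. U x - \<phi> k x) (\<lambda>x. DU x - jacobian (\<phi> k) (at x))) \<longlonglongrightarrow> 0"
    unfolding W12V0_def crit_exp_def Let_def by auto
  have m: "U \<in> borel_measurable lebesgue" "DU \<in> borel_measurable lebesgue"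
    using U1 DU by (auto simp: Lp_space_def lebesgue_on_UNIV_eq)
  have "(\<lambda>k. epow (Lp_norm ?p UNIV (\<lambda>x. U x - \<phi> k x)) ?p) \<longlonglongrightarrow> 0"
    by (rule tendsto_epow_0[OF l1 p])
  then have l1': "(\<lambda>k. \<integral>\<^sup>+x. ennreal (norm (U x - \<phi> k x) powr ?p) \<partial>lebesgue) \<longlonglongrightarrow> 0"
    using p by (simp add: Lp_norm_epow epow_epow lebesgue_on_UNIV_eq)
  have psd: "AE x in lebesgue. pos_semidef (V x)" using V by (simp add: matrix_weight_def)
  have l2': "(\<lambda>k. \<integral>\<^sup>+x. ennreal ((norm (DU x - jacobian (\<phi> k) (at x)))\<^sup>2) \<partial>lebesgue) \<longlonglongrightarrow> 0"
  proof (rule tendsto_0_ennreal_le[OF l2])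
    fix k
    show "(\<integral>\<^sup>+x. ennreal ((norm (DU x - jacobian (\<phi> k) (at x)))\<^sup>2) \<partial>lebesgue)
       \<le> W12_normsq V UNIV (\<lambda>x. U x - \<phi> k x) (\<lambda>x. DU x - jacobian (\<phi> k) (at x))"
      unfolding W12_normsq_def lebesgue_on_UNIV_eq
      by (rule nn_integral_mono_AE, use psd in eventually_elim) (auto intro!: ennreal_leI simp: pos_semidef_def)
  qed
  from smooth_limit_subseq[OF n m \<phi> l1' l2'] show ?thesis by blast
qed

lemma norm_add3_sq_le:
  fixes a b c :: "'b::real_normed_vector"
  shows "(norm (a + b + c))\<^sup>2 \<le> 3 * (norm a)\<^sup>2 + 3 * (norm b)\<^sup>2 + 3 * (norm c)\<^sup>2"
proof -
  have "(norm (a + b + c))\<^sup>2 \<le> (norm a + norm b + norm c)\<^sup>2"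
    by (intro power_mono norm_triangle_le add_mono norm_triangle_ineq) auto
  also have "\<dots> \<le> 3 * (norm a)\<^sup>2 + 3 * (norm b)\<^sup>2 + 3 * (norm c)\<^sup>2"
    using sum_squares_bound[of "norm a" "norm b"] sum_squares_bound[of "norm a" "norm c"] sum_squares_bound[of "norm b" "norm c"]
    by (simp add: power2_eq_square algebra_simps)
  finally show ?thesis .
qed

text \<open>The admissible nonlinear functions of a weakly differentiable map. A bounded derivative makes \<open>F\<close>
  Lipschitz, which settles the convergence of the functions. The difference of the gradients splits
  into \<open>F'(\<phi>\<^sub>k)(DU - D\<phi>\<^sub>k)\<close>, small in \<open>L\<^sup>2\<close> since \<open>F'\<close> is bounded; \<open>(F'(U) - F'(\<phi>\<^sub>k)) DU\<close>, small by
  dominated convergence; and the term in which the cut-off function is differentiated, which lives on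
  a ball, where convergence in \<open>L\<^sup>p\<close> is stronger than in \<open>L\<^sup>2\<close>. Since \<open>F(\<phi>\<^sub>k)\<close> is smooth, no
  mollification is involved.\<close>
lemma smooth_limit_chain:
  fixes U :: "real^'n::finite \<Rightarrow> real^'d::finite" and F :: "real^'d \<Rightarrow> real^'d"
  assumes n: "CARD('n) \<ge> 3" and U: "smooth_limit U DU \<phi>"
    and F: "\<And>y. (F has_derivative F' y) (at y)" and L: "\<And>y v. norm (F' y v) \<le> L * norm v"
    and F'c: "\<And>v. continuous_on UNIV (\<lambda>y. F' y v)"
    and Fs: "\<And>\<psi> :: real^'n \<Rightarrow> real^'d. smooth \<psi> \<Longrightarrow> smooth (\<lambda>x. F (\<psi> x))"
    and \<eta>: "smooth \<eta>" "\<And>x. \<bar>\<eta> x\<bar> \<le> 1" and \<eta>0: "\<And>x. norm x > M \<Longrightarrow> \<eta> x = 0"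
  shows "smooth_limit (\<lambda>x. \<eta> x *\<^sub>R F (U x))
    (\<lambda>x. of_columns (\<lambda>\<alpha>. \<eta> x *\<^sub>R F' (U x) (column \<alpha> (DU x)) + frechet_derivative \<eta> (at x) (axis \<alpha> 1) *\<^sub>R F (U x)))
    (\<lambda>k x. \<eta> x *\<^sub>R F (\<phi> k x))"
proof -
  note S = smooth_limitD[OF U]
  let ?p = "crit_exp TYPE('n)"
  have p: "?p > 2" by (rule crit_exp_gt_2[OF n])
  have L0: "L \<ge> 0" using order_trans[OF norm_ge_zero L[of 0 "axis undefined 1"]] by simp
  have Fl: "linear (F' y)" for y using has_derivative_bounded_linear[OF F] by (rule bounded_linear.linear)
  have Lip: "norm (F x - F y) \<le> L * norm (x - y)" for x y
  proof (rule differentiable_bound[OF convex_UNIV])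
    show "(F has_derivative F' z) (at z within UNIV)" for z using F by simp
    show "onorm (F' z) \<le> L" for z using L by (rule onorm_le)
  qed auto
  have Fc: "continuous_on UNIV F"
    by (intro continuous_at_imp_continuous_on ballI has_derivative_continuous[OF F])
  define dd where "dd \<alpha> x = frechet_derivative \<eta> (at x) (axis \<alpha> 1)" for \<alpha> x
  have ddc: "continuous_on UNIV (dd \<alpha>)" for \<alpha> unfolding dd_def[abs_def]
    by (intro smooth_continuous_on smooth_frechet_derivative \<eta>)
  have dd0: "dd \<alpha> x = 0" if "norm x > M" for \<alpha> x
    using derivative_zero_outside_support[OF smooth_has_derivative[OF \<eta>(1)] \<eta>0 that] by (simp add: dd_def)
  have "\<exists>c\<ge>0. \<forall>x. \<bar>dd \<alpha> x\<bar> \<le> c" for \<alpha>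
  proof -
    have "bounded (dd \<alpha> ` cball 0 M)"
      by (intro compact_imp_bounded compact_continuous_image continuous_on_subset[OF ddc]) auto
    then obtain B where B: "B > 0" "\<And>x. x \<in> cball 0 M \<Longrightarrow> \<bar>dd \<alpha> x\<bar> \<le> B" by (auto simp: bounded_pos)
    have "\<bar>dd \<alpha> x\<bar> \<le> B" for x using B(2)[of x] B(1) dd0[of x \<alpha>] by (cases "norm x \<le> M") auto
    with B(1) show ?thesis by (intro exI[of _ B]) auto
  qed
  then obtain c where c: "\<And>\<alpha>. c \<alpha> \<ge> 0" "\<And>\<alpha> x. \<bar>dd \<alpha> x\<bar> \<le> c \<alpha>" by metis
  have Um[measurable]: "U \<in> borel_measurable lebesgue" by (fact S(1))
  have DUm[measurable]: "DU \<in> borel_measurable lebesgue" by (fact S(2))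
  have ph[measurable]: "\<phi> k \<in> borel_measurable lebesgue" for k
    by (intro continuous_imp_lebesgue_measurable smooth_continuous_on S)
  have jm[measurable]: "(\<lambda>x. jacobian (\<phi> k) (at x)) \<in> borel_measurable lebesgue" for k
    by (intro continuous_imp_lebesgue_measurable continuous_jacobian S)
  have em[measurable]: "\<eta> \<in> borel_measurable lebesgue"
    by (intro continuous_imp_lebesgue_measurable smooth_continuous_on \<eta>)
  have dm[measurable]: "dd \<alpha> \<in> borel_measurable lebesgue" for \<alpha>
    by (intro continuous_imp_lebesgue_measurable ddc)
  have Fm: "(\<lambda>x. F (W x)) \<in> borel_measurable lebesgue" if "W \<in> borel_measurable lebesgue" for W :: "real^'n \<Rightarrow> real^'d"
    using that borel_measurable_continuous_onI[OF Fc] by (rule measurable_compose)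
  have F'rep: "F' y v = (\<Sum>i\<in>UNIV. (v $ i) *\<^sub>R F' y (axis i 1))" for y v
  proof -
    have "v = (\<Sum>i\<in>UNIV. (v $ i) *\<^sub>R axis i 1)"
      using basis_expansion[of v] by (simp only: scalar_mult_eq_scaleR)
    then have "F' y v = F' y (\<Sum>i\<in>UNIV. (v $ i) *\<^sub>R axis i 1)" by (rule arg_cong)
    also have "\<dots> = (\<Sum>i\<in>UNIV. (v $ i) *\<^sub>R F' y (axis i 1))"
      by (simp only: linear_sum[OF Fl] linear_scale[OF Fl])
    finally show ?thesis .
  qed
  have F'm: "(\<lambda>x. F' (W x) (v x)) \<in> borel_measurable lebesgue"
    if W: "W \<in> borel_measurable lebesgue" and v: "v \<in> borel_measurable lebesgue" for W v :: "real^'n \<Rightarrow> real^'d"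
  proof -
    have "(\<lambda>x. F' (W x) (axis i 1)) \<in> borel_measurable lebesgue" for i
      using W borel_measurable_continuous_onI[OF F'c] by (rule measurable_compose)
    moreover have "(\<lambda>x. v x $ i) \<in> borel_measurable lebesgue" for i
      by (rule measurable_compose[OF v borel_measurable_continuous_onI[OF continuous_on_component[OF continuous_on_id]]])
    moreover have "(\<lambda>x. F' (W x) (v x)) = (\<lambda>x. \<Sum>i\<in>UNIV. (v x $ i) *\<^sub>R F' (W x) (axis i 1))"
      by (rule ext) (rule F'rep)
    ultimately show ?thesis by (simp only:) (intro borel_measurable_sum borel_measurable_scaleR; simp only:)
  qed
  define W where "W x = \<eta> x *\<^sub>R F (U x)" for x
  define DW where "DW x = of_columns (\<lambda>\<alpha>. \<eta> x *\<^sub>R F' (U x) (column \<alpha> (DU x)) + dd \<alpha> x *\<^sub>R F (U x))" for x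
  define w where "w k x = \<eta> x *\<^sub>R F (\<phi> k x)" for k x
  have ws: "smooth (w k)" for k unfolding w_def[abs_def] by (intro smooth_scaleR \<eta> Fs S)
  have colw: "column \<alpha> (jacobian (w k) (at x)) = \<eta> x *\<^sub>R F' (\<phi> k x) (column \<alpha> (jacobian (\<phi> k) (at x))) + dd \<alpha> x *\<^sub>R F (\<phi> k x)" for \<alpha> k x
  proof -
    have "(w k has_derivative (\<lambda>h. \<eta> x *\<^sub>R F' (\<phi> k x) (frechet_derivative (\<phi> k) (at x) h) + frechet_derivative \<eta> (at x) h *\<^sub>R F (\<phi> k x))) (at x)"
      unfolding w_def[abs_def]
      by (intro has_derivative_scaleR smooth_has_derivative \<eta> has_derivative_compose[OF smooth_has_derivative[OF S(7)] F])
    from fun_cong[OF frechet_derivative_at[OF this], of "axis \<alpha> 1"] show ?thesis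
      unfolding column_jacobian dd_def by (rule sym)
  qed
  have diffW: "norm (W x - w k x) \<le> L * norm (U x - \<phi> k x)" for k x
  proof -
    have "norm (W x - w k x) = \<bar>\<eta> x\<bar> * norm (F (U x) - F (\<phi> k x))"
      by (simp add: W_def w_def scaleR_diff_right[symmetric])
    also have "\<dots> \<le> 1 * (L * norm (U x - \<phi> k x))" by (intro mult_mono \<eta> Lip) auto
    finally show ?thesis by simp
  qed
  have "smooth_limit W DW w" unfolding smooth_limit_def
  proof (intro conjI allI)
    show "W \<in> borel_measurable lebesgue" unfolding W_def[abs_def] using Fm[OF Um] by measurable
    show "DW \<in> borel_measurable lebesgue" unfolding DW_def[abs_def]
      by (intro of_columns_measurable borel_measurable_add borel_measurable_scaleR em dm F'm Um Fm column_measurable DUm)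
    show "w k \<in> Cc_smooth UNIV" for k
      by (rule Cc_smoothI[OF ws, of "cball 0 M"]) (auto simp: w_def \<eta>0)
    show "(\<lambda>k. \<integral>\<^sup>+x. ennreal (norm (W x - w k x) powr ?p) \<partial>lebesgue) \<longlonglongrightarrow> 0"
    proof (rule tendsto_0_ennreal_le)
      fix k
      have "(\<integral>\<^sup>+x. ennreal (norm (W x - w k x) powr ?p) \<partial>lebesgue) \<le> (\<integral>\<^sup>+x. ennreal (L powr ?p) * ennreal (norm (U x - \<phi> k x) powr ?p) \<partial>lebesgue)"
      proof (intro nn_integral_mono)
        fix x
        have "norm (W x - w k x) powr ?p \<le> (L * norm (U x - \<phi> k x)) powr ?p"
          using p diffW by (intro powr_mono2) auto
        then show "ennreal (norm (W x - w k x) powr ?p) \<le> ennreal (L powr ?p) * ennreal (norm (U x - \<phi> k x) powr ?p)"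
          using L0 by (simp add: powr_mult ennreal_mult[symmetric] ennreal_leI)
      qed
      also have "\<dots> = ennreal (L powr ?p) * (\<integral>\<^sup>+x. ennreal (norm (U x - \<phi> k x) powr ?p) \<partial>lebesgue)"
        by (rule nn_integral_cmult) measurable
      finally show "(\<integral>\<^sup>+x. ennreal (norm (W x - w k x) powr ?p) \<partial>lebesgue) \<le> ennreal (L powr ?p) * (\<integral>\<^sup>+x. ennreal (norm (U x - \<phi> k x) powr ?p) \<partial>lebesgue)" .
    next
      show "(\<lambda>k. ennreal (L powr ?p) * (\<integral>\<^sup>+x. ennreal (norm (U x - \<phi> k x) powr ?p) \<partial>lebesgue)) \<longlonglongrightarrow> 0"
        using tendsto_mult_ennreal[OF tendsto_const S(4), of "ennreal (L powr ?p)"] by simp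
    qed
    show "AE x in lebesgue. (\<lambda>k. w k x) \<longlonglongrightarrow> W x"
      using S(6)
    proof eventually_elim
      case (elim x)
      then show ?case unfolding w_def W_def
        by (intro tendsto_scaleR tendsto_const continuous_on_tendsto_compose[OF Fc]) auto
    qed
    have [measurable]: "cball 0 M \<in> sets (lebesgue :: (real^'n) measure)" by simp
    define Q where "Q \<alpha> k x = norm (F' (U x) (column \<alpha> (DU x)) - F' (\<phi> k x) (column \<alpha> (DU x)))" for \<alpha> k x
    have Qm[measurable]: "Q \<alpha> k \<in> borel_measurable lebesgue" for \<alpha> k
    proof -
      have [measurable]: "(\<lambda>x. F' (U x) (column \<alpha> (DU x))) \<in> borel_measurable lebesgue"
        "(\<lambda>x. F' (\<phi> k x) (column \<alpha> (DU x))) \<in> borel_measurable lebesgue"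
        by (intro F'm Um ph column_measurable DUm)+
      show ?thesis unfolding Q_def[abs_def] by measurable
    qed
    define J1 where "J1 k = (\<integral>\<^sup>+x. ennreal ((norm (DU x - jacobian (\<phi> k) (at x)))\<^sup>2) \<partial>lebesgue)" for k
    define J2 where "J2 \<alpha> k = (\<integral>\<^sup>+x. ennreal ((Q \<alpha> k x)\<^sup>2) \<partial>lebesgue)" for \<alpha> k
    define J3 where "J3 k = (\<integral>\<^sup>+x. ennreal (norm (U x - \<phi> k x) powr 2) * indicator (cball 0 M) x \<partial>lebesgue)" for k
    have J1: "J1 \<longlonglongrightarrow> 0" unfolding J1_def by (rule S(5))
    have J3: "J3 \<longlonglongrightarrow> 0" unfolding J3_def
      by (rule tendsto_local_norm_powr[OF _ _ _ _ p S(4)])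
        (auto simp: fmeasurable_compact fmeasurableD2 less_top[symmetric])
    have J2: "J2 \<alpha> \<longlonglongrightarrow> 0" for \<alpha>
    proof -
      have "(\<lambda>k. \<integral>\<^sup>+x. ennreal ((Q \<alpha> k x)\<^sup>2) \<partial>lebesgue) \<longlonglongrightarrow> (\<integral>\<^sup>+x. 0 \<partial>(lebesgue::(real^'n) measure))"
      proof (rule nn_integral_dominated_convergence[where w="\<lambda>x. ennreal (4 * L\<^sup>2 * (norm (DU x))\<^sup>2)"])
        show "AE x in lebesgue. ennreal ((Q \<alpha> k x)\<^sup>2) \<le> ennreal (4 * L\<^sup>2 * (norm (DU x))\<^sup>2)" for k
        proof (intro AE_I2 ennreal_leI)
          fix x
          have "norm (column \<alpha> (DU x)) \<le> norm (DU x)"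
          proof (rule power2_le_imp_le)
            show "(norm (column \<alpha> (DU x)))\<^sup>2 \<le> (norm (DU x))\<^sup>2" unfolding norm_matrix_columns
              by (rule member_le_sum) auto
          qed simp
          then have "L * norm (column \<alpha> (DU x)) \<le> L * norm (DU x)" using L0 by (rule mult_left_mono)
          then have "Q \<alpha> k x \<le> 2 * (L * norm (DU x))"
            using norm_triangle_ineq4[of "F' (U x) (column \<alpha> (DU x))" "F' (\<phi> k x) (column \<alpha> (DU x))"]
              L[of "U x" "column \<alpha> (DU x)"] L[of "\<phi> k x" "column \<alpha> (DU x)"]
            unfolding Q_def by linarith
          then have "(Q \<alpha> k x)\<^sup>2 \<le> (2 * (L * norm (DU x)))\<^sup>2" by (intro power_mono) (auto simp: Q_def)
          then show "(Q \<alpha> k x)\<^sup>2 \<le> 4 * L\<^sup>2 * (norm (DU x))\<^sup>2" by (simp add: power_mult_distrib)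
        qed
        have "(\<integral>\<^sup>+x. ennreal (4 * L\<^sup>2 * (norm (DU x))\<^sup>2) \<partial>lebesgue) = ennreal (4 * L\<^sup>2) * (\<integral>\<^sup>+x. ennreal ((norm (DU x))\<^sup>2) \<partial>lebesgue)"
          by (subst nn_integral_cmult[symmetric]) (auto simp: ennreal_mult intro!: nn_integral_cong)
        also have "\<dots> < \<infinity>" using smooth_limit_Sobolev(2)[OF n U] by (simp add: ennreal_mult_less_top)
        finally show "(\<integral>\<^sup>+x. ennreal (4 * L\<^sup>2 * (norm (DU x))\<^sup>2) \<partial>lebesgue) < \<infinity>" .
        show "AE x in lebesgue. (\<lambda>k. ennreal ((Q \<alpha> k x)\<^sup>2)) \<longlonglongrightarrow> 0"
          using S(6)
        proof eventually_elim
          case (elim x)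
          have "(\<lambda>k. F' (\<phi> k x) (column \<alpha> (DU x))) \<longlonglongrightarrow> F' (U x) (column \<alpha> (DU x))"
            by (rule continuous_on_tendsto_compose[OF F'c elim]) auto
          then have "(\<lambda>k. ennreal ((Q \<alpha> k x)\<^sup>2)) \<longlonglongrightarrow> ennreal ((norm (F' (U x) (column \<alpha> (DU x)) - F' (U x) (column \<alpha> (DU x))))\<^sup>2)"
            unfolding Q_def by (intro tendsto_intros)
          then show ?case by simp
        qed
      qed measurable
      then show ?thesis unfolding J2_def[abs_def] by simp
    qed
    define C3 where "C3 = 3 * L\<^sup>2 * (\<Sum>\<alpha>\<in>UNIV. (c \<alpha>)\<^sup>2)"
    have C3: "C3 \<ge> 0" unfolding C3_def by (intro mult_nonneg_nonneg sum_nonneg) auto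
    show "(\<lambda>k. \<integral>\<^sup>+x. ennreal ((norm (DW x - jacobian (w k) (at x)))\<^sup>2) \<partial>lebesgue) \<longlonglongrightarrow> 0"
    proof (rule tendsto_0_ennreal_le)
      have "(\<lambda>k. ennreal (3 * L\<^sup>2) * J1 k + 3 * (\<Sum>\<alpha>\<in>UNIV. J2 \<alpha> k) + ennreal C3 * J3 k) \<longlonglongrightarrow> ennreal (3 * L\<^sup>2) * 0 + 3 * (\<Sum>\<alpha>\<in>(UNIV::'n set). 0) + ennreal C3 * 0"
        by (intro tendsto_add tendsto_mult_ennreal tendsto_const J1 J2 J3 tendsto_sum) auto
      then show "(\<lambda>k. ennreal (3 * L\<^sup>2) * J1 k + 3 * (\<Sum>\<alpha>\<in>UNIV. J2 \<alpha> k) + ennreal C3 * J3 k) \<longlonglongrightarrow> 0" by simp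
      fix k
      have "(\<integral>\<^sup>+x. ennreal ((norm (DW x - jacobian (w k) (at x)))\<^sup>2) \<partial>lebesgue)
        \<le> (\<integral>\<^sup>+x. ennreal (3 * L\<^sup>2) * ennreal ((norm (DU x - jacobian (\<phi> k) (at x)))\<^sup>2) + 3 * (\<Sum>\<alpha>\<in>UNIV. ennreal ((Q \<alpha> k x)\<^sup>2))
            + ennreal C3 * (ennreal (norm (U x - \<phi> k x) powr 2) * indicator (cball 0 M) x) \<partial>lebesgue)"
      proof (intro nn_integral_mono)
        fix x :: "real^'n"
        let ?I = "indicator (cball 0 M) x :: real"
        have col: "(norm (column \<alpha> (DW x - jacobian (w k) (at x))))\<^sup>2
           \<le> 3 * L\<^sup>2 * (norm (column \<alpha> (DU x - jacobian (\<phi> k) (at x))))\<^sup>2 + 3 * (Q \<alpha> k x)\<^sup>2 + 3 * L\<^sup>2 * (c \<alpha>)\<^sup>2 * ((norm (U x - \<phi> k x))\<^sup>2 * ?I)" for \<alpha>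
        proof -
          let ?a = "\<eta> x *\<^sub>R F' (\<phi> k x) (column \<alpha> (DU x - jacobian (\<phi> k) (at x)))"
          let ?b = "\<eta> x *\<^sub>R (F' (U x) (column \<alpha> (DU x)) - F' (\<phi> k x) (column \<alpha> (DU x)))"
          let ?c = "dd \<alpha> x *\<^sub>R (F (U x) - F (\<phi> k x))"
          have "column \<alpha> (DW x - jacobian (w k) (at x)) = ?a + ?b + ?c"
            using Fl[of "\<phi> k x"] by (simp add: colw DW_def linear_diff algebra_simps)
          then have "(norm (column \<alpha> (DW x - jacobian (w k) (at x))))\<^sup>2 \<le> 3 * (norm ?a)\<^sup>2 + 3 * (norm ?b)\<^sup>2 + 3 * (norm ?c)\<^sup>2"
            using norm_add3_sq_le[of ?a ?b ?c] by simp
          moreover have "(norm ?a)\<^sup>2 \<le> (L * norm (column \<alpha> (DU x - jacobian (\<phi> k) (at x))))\<^sup>2"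
          proof (rule power_mono)
            have "norm ?a \<le> 1 * (L * norm (column \<alpha> (DU x - jacobian (\<phi> k) (at x))))"
              unfolding norm_scaleR by (intro mult_mono \<eta> L) auto
            then show "norm ?a \<le> L * norm (column \<alpha> (DU x - jacobian (\<phi> k) (at x)))" by simp
          qed simp
          moreover have "(norm ?b)\<^sup>2 \<le> (Q \<alpha> k x)\<^sup>2"
            unfolding norm_scaleR Q_def using \<eta>(2)[of x] by (intro power_mono mult_left_le_one_le) auto
          moreover have "(norm ?c)\<^sup>2 \<le> (c \<alpha> * (L * norm (U x - \<phi> k x)))\<^sup>2 * ?I"
          proof (cases "norm x \<le> M")
            case True
            have "norm ?c \<le> c \<alpha> * (L * norm (U x - \<phi> k x))"
              unfolding norm_scaleR using c by (intro mult_mono Lip) auto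
            then have "(norm ?c)\<^sup>2 \<le> (c \<alpha> * (L * norm (U x - \<phi> k x)))\<^sup>2" by (intro power_mono) auto
            with True show ?thesis by simp
          next
            case False then show ?thesis using dd0[of x \<alpha>] by simp
          qed
          ultimately show ?thesis by (simp add: power_mult_distrib mult_ac)
        qed
        have "(norm (DW x - jacobian (w k) (at x)))\<^sup>2 \<le> (\<Sum>\<alpha>\<in>UNIV. 3 * L\<^sup>2 * (norm (column \<alpha> (DU x - jacobian (\<phi> k) (at x))))\<^sup>2 + 3 * (Q \<alpha> k x)\<^sup>2 + 3 * L\<^sup>2 * (c \<alpha>)\<^sup>2 * ((norm (U x - \<phi> k x))\<^sup>2 * ?I))"
          unfolding norm_matrix_columns[of "DW x - jacobian (w k) (at x)"] by (intro sum_mono col)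
        also have "\<dots> = 3 * L\<^sup>2 * (norm (DU x - jacobian (\<phi> k) (at x)))\<^sup>2 + 3 * (\<Sum>\<alpha>\<in>UNIV. (Q \<alpha> k x)\<^sup>2) + C3 * ((norm (U x - \<phi> k x))\<^sup>2 * ?I)"
          unfolding norm_matrix_columns[of "DU x - jacobian (\<phi> k) (at x)"] C3_def
          by (simp add: sum.distrib sum_distrib_left sum_distrib_right mult.assoc)
        finally have "ennreal ((norm (DW x - jacobian (w k) (at x)))\<^sup>2) \<le> ennreal \<dots>" by (rule ennreal_leI)
        also have "\<dots> = ennreal (3 * L\<^sup>2) * ennreal ((norm (DU x - jacobian (\<phi> k) (at x)))\<^sup>2) + 3 * (\<Sum>\<alpha>\<in>UNIV. ennreal ((Q \<alpha> k x)\<^sup>2))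
            + ennreal C3 * (ennreal (norm (U x - \<phi> k x) powr 2) * indicator (cball 0 M) x)"
        proof -
          have split: "ennreal (3 * L\<^sup>2 * a + 3 * s + C3 * (b * i)) = ennreal (3 * L\<^sup>2) * ennreal a + ennreal 3 * ennreal s + ennreal C3 * (ennreal b * ennreal i)"
            if "a \<ge> 0" "s \<ge> 0" "b \<ge> 0" "i \<ge> 0" for a s b i :: real
            by (simp only: ennreal_plus ennreal_mult mult_nonneg_nonneg add_nonneg_nonneg zero_le_power2 zero_le_numeral that C3)
          have sQ: "ennreal (\<Sum>\<alpha>\<in>UNIV. (Q \<alpha> k x)\<^sup>2) = (\<Sum>\<alpha>\<in>UNIV. ennreal ((Q \<alpha> k x)\<^sup>2))"
            by (rule sum_ennreal[symmetric]) simp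
          show ?thesis
            by (subst split) (simp_all add: sum_nonneg powr_numeral ennreal_indicator)
        qed
        finally show "ennreal ((norm (DW x - jacobian (w k) (at x)))\<^sup>2) \<le> \<dots>" .
      qed
      also have "\<dots> = ennreal (3 * L\<^sup>2) * J1 k + 3 * (\<Sum>\<alpha>\<in>UNIV. J2 \<alpha> k) + ennreal C3 * J3 k"
        unfolding J1_def J2_def J3_def
        by (simp add: nn_integral_add nn_integral_cmult nn_integral_sum del: sum_ennreal powr_numeral)
      finally show "(\<integral>\<^sup>+x. ennreal ((norm (DW x - jacobian (w k) (at x)))\<^sup>2) \<partial>lebesgue) \<le> \<dots>" .
    qed
  qed
  then show ?thesis unfolding W_def[abs_def] DW_def[abs_def] w_def[abs_def] dd_def .
qed

lemma norm_matrix_vector_le: "norm (A *v v) \<le> norm A * norm v" for A :: "real^'n::finite^'m::finite"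
proof -
  have "norm (A *v v) = L2_set (\<lambda>i. norm ((A *v v) $ i)) UNIV" by (simp add: norm_vec_def)
  also have "\<dots> \<le> L2_set (\<lambda>i. norm v * norm (A $ i)) UNIV"
    by (rule L2_set_mono) (auto simp: matrix_vector_mul_component mult.commute[of "norm v"] intro: Cauchy_Schwarz_ineq2)
  also have "\<dots> = norm v * L2_set (\<lambda>i. norm (A $ i)) UNIV" by (simp add: L2_set_right_distrib)
  finally show ?thesis by (simp add: norm_vec_def mult.commute)
qed

lemma quadratic_form_measurable:
  fixes V :: "_ \<Rightarrow> real^'d::finite^'d"
  assumes V: "V \<in> borel_measurable M" and u: "u \<in> borel_measurable M" and w: "w \<in> borel_measurable M"
  shows "(\<lambda>x. (V x *v u x) \<bullet> w x) \<in> borel_measurable M"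
proof -
  have "(\<lambda>x. V x $ i) \<in> borel_measurable M" for i
    by (rule measurable_compose[OF V borel_measurable_continuous_onI[OF continuous_on_component[OF continuous_on_id]]])
  then have "(\<lambda>x. V x $ i \<bullet> u x) \<in> borel_measurable M" for i using u by (intro borel_measurable_inner)
  moreover have "(\<lambda>x. w x $ i) \<in> borel_measurable M" for i
    by (rule measurable_compose[OF w borel_measurable_continuous_onI[OF continuous_on_component[OF continuous_on_id]]])
  moreover have "(V x *v u x) \<bullet> w x = (\<Sum>i\<in>UNIV. (V x $ i \<bullet> u x) * w x $ i)" for x
    by (simp add: inner_vec_def[of "V x *v u x"] matrix_vector_mul_component)
  ultimately show ?thesis by (auto intro!: borel_measurable_sum borel_measurable_times)
qed

text \<open>Hoelder's inequality with the exponents \<open>n/2\<close> and \<open>n/(n-2)\<close>: on compact sets a weight in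
  \<open>L\<^bsup>n/2\<^esup>\<close> gives an energy that is dominated by the norm in the Sobolev exponent.\<close>
lemma weighted_energy_le:
  fixes V :: "real^'n::finite \<Rightarrow> real^'d::finite^'d"
  assumes n: "CARD('n) \<ge> 3" and [measurable]: "V \<in> borel_measurable lebesgue" "w \<in> borel_measurable lebesgue"
    and K: "compact K" and w0: "\<And>x. x \<notin> K \<Longrightarrow> w x = 0"
  shows "(\<integral>\<^sup>+x. ennreal (norm (V x) * (norm (w x))\<^sup>2) \<partial>lebesgue)
    \<le> epow (\<integral>\<^sup>+x. ennreal (norm (V x) powr (real CARD('n) / 2)) * indicator K x \<partial>lebesgue) (2 / real CARD('n))
      * epow (\<integral>\<^sup>+x. ennreal (norm (w x) powr crit_exp TYPE('n)) \<partial>lebesgue) (1 - 2 / real CARD('n))"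
proof -
  have [measurable]: "K \<in> sets lebesgue" using K by (simp add: compact_imp_closed)
  have e: "crit_exp TYPE('n) * (1 - 2 / real CARD('n)) = 2" using n by (simp add: crit_exp_def field_simps)
  have "(\<integral>\<^sup>+x. ennreal (norm (V x) * (norm (w x))\<^sup>2) \<partial>lebesgue)
    = (\<integral>\<^sup>+x. epow (ennreal (norm (V x) powr (real CARD('n) / 2)) * indicator K x) (2 / real CARD('n)) * epow (ennreal (norm (w x) powr crit_exp TYPE('n))) (1 - 2 / real CARD('n)) \<partial>lebesgue)"
  proof (intro nn_integral_cong)
    fix x
    show "ennreal (norm (V x) * (norm (w x))\<^sup>2) = epow (ennreal (norm (V x) powr (real CARD('n) / 2)) * indicator K x) (2 / real CARD('n)) * epow (ennreal (norm (w x) powr crit_exp TYPE('n))) (1 - 2 / real CARD('n))"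
    proof (cases "x \<in> K")
      case True then show ?thesis using n by (simp add: powr_powr e powr_numeral ennreal_mult)
    next
      case False then show ?thesis by (simp add: w0)
    qed
  qed
  also have "\<dots> \<le> epow (\<integral>\<^sup>+x. ennreal (norm (V x) powr (real CARD('n) / 2)) * indicator K x \<partial>lebesgue) (2 / real CARD('n))
      * epow (\<integral>\<^sup>+x. ennreal (norm (w x) powr crit_exp TYPE('n)) \<partial>lebesgue) (1 - 2 / real CARD('n))"
    by (rule nn_integral_Hoelder2) (use n in auto)
  finally show ?thesis .
qed

text \<open>This makes nonlinear functions of the solution admissible in the weak formulation: the weighted
  part of the norm is controlled by the convergence in the Sobolev exponent.\<close>
lemma smooth_limit_in_W12V0:
  fixes V :: "real^'n::finite \<Rightarrow> real^'d::finite^'d" and W :: "real^'n \<Rightarrow> real^'d"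
  assumes n: "CARD('n) \<ge> 3" and V: "matrix_weight V" "V \<in> Lp_loc (real CARD('n) / 2)"
    and W: "smooth_limit W DW w" and B: "open B" and K: "compact K" "K \<subseteq> B"
    and w0: "\<And>k x. x \<notin> K \<Longrightarrow> w k x = 0" and W0: "\<And>x. x \<notin> K \<Longrightarrow> W x = 0"
  shows "W \<in> W12V0 V B" and "DW \<in> Lp_space 2 B"
proof -
  note S = smooth_limitD[OF W]
  let ?p = "crit_exp TYPE('n)"
  have p: "?p > 2" by (rule crit_exp_gt_2[OF n])
  have Wm[measurable]: "W \<in> borel_measurable lebesgue" by (fact S(1))
  have DWm[measurable]: "DW \<in> borel_measurable lebesgue" by (fact S(2))
  have Vm[measurable]: "V \<in> borel_measurable lebesgue" using V by (simp add: matrix_weight_def)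
  have wm[measurable]: "w k \<in> borel_measurable lebesgue" for k
    by (intro continuous_imp_lebesgue_measurable smooth_continuous_on S)
  have jm[measurable]: "(\<lambda>x. jacobian (w k) (at x)) \<in> borel_measurable lebesgue" for k
    by (intro continuous_imp_lebesgue_measurable continuous_jacobian S)
  have Bs[measurable]: "B \<in> sets lebesgue" using B by simp
  have Ks[measurable]: "K \<in> sets lebesgue" using K by (simp add: compact_imp_closed)
  have on: "integrable (lebesgue_on B) g" if "integrable lebesgue g" for g :: "real^'n \<Rightarrow> real"
    using integrable_mult_indicator[OF Bs that] by (subst integrable_restrict_space) auto
  define VK where "VK = (\<integral>\<^sup>+x. ennreal (norm (V x) powr (real CARD('n) / 2)) * indicator K x \<partial>lebesgue)"
  have VK: "VK < \<infinity>"
  proof -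
    have "integrable (lebesgue_on K) (\<lambda>x. norm (V x) powr (real CARD('n) / 2))"
      using V(2) K by (simp add: Lp_loc_def Lp_space_def)
    then have "integrable lebesgue (\<lambda>x. indicator K x *\<^sub>R norm (V x) powr (real CARD('n) / 2))"
      by (subst (asm) integrable_restrict_space) auto
    then have "(\<integral>\<^sup>+x. ennreal (norm (indicator K x *\<^sub>R norm (V x) powr (real CARD('n) / 2))) \<partial>lebesgue) < \<infinity>"
      unfolding integrable_iff_bounded by simp
    also have "(\<integral>\<^sup>+x. ennreal (norm (indicator K x *\<^sub>R norm (V x) powr (real CARD('n) / 2))) \<partial>lebesgue) = VK"
      unfolding VK_def by (intro nn_integral_cong) (auto simp: indicator_def)
    finally show ?thesis .
  qed
  have quad: "norm ((V x *v y) \<bullet> y) \<le> norm (V x) * (norm y)\<^sup>2" for x y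
  proof -
    have "norm ((V x *v y) \<bullet> y) \<le> norm (V x *v y) * norm y" using Cauchy_Schwarz_ineq2 by auto
    also have "\<dots> \<le> norm (V x) * norm y * norm y" by (intro mult_right_mono norm_matrix_vector_le) auto
    finally show ?thesis by (simp add: power2_eq_square mult.assoc)
  qed
  show DW2: "DW \<in> Lp_space 2 B" unfolding Lp_space_def
  proof (intro CollectI conjI on)
    show "DW \<in> borel_measurable (lebesgue_on B)" by (rule measurable_restrict_space1[OF DWm])
    show "integrable lebesgue (\<lambda>x. norm (DW x) powr 2)"
      using smooth_limit_Sobolev(2)[OF n W] by (intro integrableI_bounded) (auto simp: powr_numeral)
  qed
  show "W \<in> W12V0 V B" unfolding W12V0_def Let_def crit_exp_def[of "TYPE('n)", symmetric]
  proof (intro CollectI conjI exI[of _ DW] exI[of _ w] allI DW2)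
    show "W \<in> Lp_space ?p B" unfolding Lp_space_def
    proof (intro CollectI conjI on)
      show "W \<in> borel_measurable (lebesgue_on B)" by (rule measurable_restrict_space1[OF Wm])
      show "integrable lebesgue (\<lambda>x. norm (W x) powr ?p)"
        using smooth_limit_Sobolev(3)[OF n W] by (intro integrableI_bounded) auto
    qed
    show "integrable (lebesgue_on B) (\<lambda>x. (V x *v W x) \<bullet> W x)"
    proof (intro on integrableI_bounded)
      show "(\<lambda>x. (V x *v W x) \<bullet> W x) \<in> borel_measurable lebesgue" by (intro quadratic_form_measurable Vm Wm)
      have "(\<integral>\<^sup>+x. ennreal (norm ((V x *v W x) \<bullet> W x)) \<partial>lebesgue) \<le> (\<integral>\<^sup>+x. ennreal (norm (V x) * (norm (W x))\<^sup>2) \<partial>lebesgue)"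
        by (intro nn_integral_mono ennreal_leI quad)
      also have "\<dots> \<le> epow VK (2 / real CARD('n)) * epow (\<integral>\<^sup>+x. ennreal (norm (W x) powr ?p) \<partial>lebesgue) (1 - 2 / real CARD('n))"
        unfolding VK_def by (rule weighted_energy_le[OF n Vm Wm K(1) W0])
      also have "\<dots> < \<infinity>" using VK smooth_limit_Sobolev(3)[OF n W]
        by (simp add: ennreal_mult_less_top epow_less_top)
      finally show "(\<integral>\<^sup>+x. ennreal (norm ((V x *v W x) \<bullet> W x)) \<partial>lebesgue) < \<infinity>" .
    qed
    show "has_weak_gradient W DW B" by (rule smooth_limit_weak_gradient[OF n W])
    show "w k \<in> Cc_smooth B" for k by (rule Cc_smoothI[OF S(7) K w0])
    have restr: "(\<integral>\<^sup>+x. g x \<partial>lebesgue_on B) \<le> (\<integral>\<^sup>+x. g x \<partial>lebesgue)" for g :: "real^'n \<Rightarrow> ennreal"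
      by (subst nn_integral_restrict_space) (auto intro!: nn_integral_mono simp: indicator_def)
    show "(\<lambda>k. Lp_norm ?p B (\<lambda>x. W x - w k x)) \<longlonglongrightarrow> 0"
    proof (rule tendsto_0_ennreal_le)
      show "Lp_norm ?p B (\<lambda>x. W x - w k x) \<le> epow (\<integral>\<^sup>+x. ennreal (norm (W x - w k x) powr ?p) \<partial>lebesgue) (1 / ?p)" for k
        unfolding Lp_norm_epow using p by (intro epow_mono restr) auto
      show "(\<lambda>k. epow (\<integral>\<^sup>+x. ennreal (norm (W x - w k x) powr ?p) \<partial>lebesgue) (1 / ?p)) \<longlonglongrightarrow> 0"
        using p by (intro tendsto_epow_0 S(4)) auto
    qed
    show "(\<lambda>k. W12_normsq V B (\<lambda>x. W x - w k x) (\<lambda>x. DW x - jacobian (w k) (at x))) \<longlonglongrightarrow> 0"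
    proof (rule tendsto_0_ennreal_le)
      let ?R = "\<lambda>k. epow VK (2 / real CARD('n)) * epow (\<integral>\<^sup>+x. ennreal (norm (W x - w k x) powr ?p) \<partial>lebesgue) (1 - 2 / real CARD('n))
          + (\<integral>\<^sup>+x. ennreal ((norm (DW x - jacobian (w k) (at x)))\<^sup>2) \<partial>lebesgue)"
      have "?R \<longlonglongrightarrow> epow VK (2 / real CARD('n)) * 0 + 0"
        using n VK by (intro tendsto_add tendsto_mult_ennreal tendsto_const tendsto_epow_0 S(4,5)) (auto simp: epow_less_top less_top[symmetric])
      then show "?R \<longlonglongrightarrow> 0" by simp
      fix k
      have "W12_normsq V B (\<lambda>x. W x - w k x) (\<lambda>x. DW x - jacobian (w k) (at x))
         \<le> (\<integral>\<^sup>+x. ennreal (norm (V x) * (norm (W x - w k x))\<^sup>2) + ennreal ((norm (DW x - jacobian (w k) (at x)))\<^sup>2) \<partial>lebesgue)"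
        unfolding W12_normsq_def
      proof (rule order_trans[OF restr], rule nn_integral_mono)
        fix x
        have "(V x *v (W x - w k x)) \<bullet> (W x - w k x) \<le> norm (V x) * (norm (W x - w k x))\<^sup>2"
          using quad[of x "W x - w k x"] by auto
        then have "ennreal ((V x *v (W x - w k x)) \<bullet> (W x - w k x) + (norm (DW x - jacobian (w k) (at x)))\<^sup>2)
            \<le> ennreal (norm (V x) * (norm (W x - w k x))\<^sup>2 + (norm (DW x - jacobian (w k) (at x)))\<^sup>2)"
          by (intro ennreal_leI) simp
        also have "\<dots> = ennreal (norm (V x) * (norm (W x - w k x))\<^sup>2) + ennreal ((norm (DW x - jacobian (w k) (at x)))\<^sup>2)"
          by (rule ennreal_plus) auto
        finally show "ennreal ((V x *v (W x - w k x)) \<bullet> (W x - w k x) + (norm (DW x - jacobian (w k) (at x)))\<^sup>2) \<le> \<dots>" .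
      qed
      also have "\<dots> = (\<integral>\<^sup>+x. ennreal (norm (V x) * (norm (W x - w k x))\<^sup>2) \<partial>lebesgue) + (\<integral>\<^sup>+x. ennreal ((norm (DW x - jacobian (w k) (at x)))\<^sup>2) \<partial>lebesgue)"
        by (rule nn_integral_add) measurable
      also have "\<dots> \<le> ?R k"
        unfolding VK_def using W0 w0
        by (intro add_right_mono weighted_energy_le[OF n Vm _ K(1)]) auto
      finally show "W12_normsq V B (\<lambda>x. W x - w k x) (\<lambda>x. DW x - jacobian (w k) (at x)) \<le> ?R k" .
    qed
  qed
qed

section \<open>Truncated powers and the pointwise energy inequality\<close>

text \<open>A smooth truncation of \<open>t\<^sup>s\<close>: it is bounded by \<open>e\<^bsup>-s\<^esup>\<close> and increases to \<open>t\<^sup>s\<close> as \<open>e\<close> tends to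
  \<open>0\<close>. Its logarithmic derivative \<open>s / (t (1 + e t))\<close> lies between \<open>0\<close> and \<open>s / t\<close>, which is all
  that the energy estimate uses of a power.\<close>
definition trunc :: "real \<Rightarrow> real \<Rightarrow> real \<Rightarrow> real" where
  "trunc s e t = t powr s * (1 + e * t) powr (- s)"

lemma trunc_eq: "t > 0 \<Longrightarrow> e > 0 \<Longrightarrow> trunc s e t = (t / (1 + e * t)) powr s"
  by (simp add: trunc_def powr_divide powr_minus_divide)

lemma trunc_pos: "t > 0 \<Longrightarrow> e > 0 \<Longrightarrow> trunc s e t > 0"
  using add_pos_pos[of 1 "e * t"] by (simp add: trunc_def)

lemma trunc_double: "trunc (2 * s) e t = (trunc s e t)\<^sup>2"
proof -
  have "x powr (2 * r) = (x powr r)\<^sup>2" for x r :: real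
    using powr_add[of x r r] by (simp add: power2_eq_square)
  from this[of t s] this[of "1 + e * t" "- s"] show ?thesis by (simp add: trunc_def power_mult_distrib)
qed

lemma trunc_bound:
  assumes "t > 0" "e > 0" "s \<ge> 0"
  shows "trunc s e t \<le> (1 / e) powr s" "trunc s e t \<le> t powr s"
proof -
  have "t / (1 + e * t) \<le> 1 / e" "t / (1 + e * t) \<le> t"
    using assms by (auto simp: field_simps add_pos_pos)
  then show "trunc s e t \<le> (1 / e) powr s" "trunc s e t \<le> t powr s"
    using assms by (auto simp: trunc_eq add_pos_pos less_imp_le intro!: powr_mono2)
qed

lemma trunc_has_derivative:
  assumes "t > 0" "e > 0"
  shows "(trunc s e has_real_derivative s * trunc s e t / (t * (1 + e * t))) (at t)"
proof -
  have q: "1 + e * t > 0" using assms by (simp add: add_pos_pos)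
  have "(trunc s e has_real_derivative (s * t powr (s - 1)) * (1 + e * t) powr (- s) + (- s * (1 + e * t) powr (- s - 1) * e) * t powr s) (at t)"
    unfolding trunc_def[abs_def] using assms q
    by (auto intro!: derivative_eq_intros simp: algebra_simps)
  moreover have "(s * t powr (s - 1)) * (1 + e * t) powr (- s) + (- s * (1 + e * t) powr (- s - 1) * e) * t powr s
      = s * trunc s e t / (t * (1 + e * t))"
    using assms q by (simp add: trunc_def powr_diff divide_simps) (simp add: algebra_simps)
  ultimately show ?thesis by simp
qed

lemma trunc_tendsto:
  assumes "t > 0"
  shows "(\<lambda>j. trunc s (inverse (real (Suc j))) t) \<longlonglongrightarrow> t powr s"
proof -
  have "(\<lambda>j. t powr s * (1 + inverse (real (Suc j)) * t) powr (- s)) \<longlonglongrightarrow> t powr s * (1 + 0 * t) powr (- s)"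
    by (intro tendsto_intros LIMSEQ_inverse_real_of_nat) auto
  then show ?thesis by (simp add: trunc_def)
qed

text \<open>The constant keeps all powers smooth at the zeros of \<open>y\<close>; later it also absorbs the right-hand
  side of the equation.\<close>
definition reg_sq :: "real \<Rightarrow> 'a::real_inner \<Rightarrow> real" where "reg_sq \<kappa> y = y \<bullet> y + \<kappa>\<^sup>2"

lemma reg_sq_pos: "\<kappa> > 0 \<Longrightarrow> reg_sq \<kappa> y > 0"
  by (simp add: reg_sq_def add_nonneg_pos)

lemma reg_sq_has_derivative: "(reg_sq \<kappa> has_derivative (\<lambda>v. 2 * (y \<bullet> v))) (at y)"
  unfolding reg_sq_def[abs_def] by (auto intro!: derivative_eq_intros simp: inner_commute)

lemma norm_le_sqrt_reg_sq: "norm y \<le> sqrt (reg_sq \<kappa> y)"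
  by (rule real_le_rsqrt) (simp add: reg_sq_def power2_norm_eq_inner)

lemma smooth_reg_sq: "smooth \<psi> \<Longrightarrow> smooth (\<lambda>x. reg_sq \<kappa> (\<psi> x))"
  unfolding reg_sq_def by (intro smooth_add smooth_inner smooth_const)

lemma smooth_trunc:
  assumes "smooth f" "\<And>x. f x > 0" "e > 0"
  shows "smooth (\<lambda>x. trunc s e (f x))"
  unfolding trunc_def using assms
  by (intro smooth_mult smooth_powr smooth_add smooth_const) (auto simp: add_pos_pos)

lemma continuous_on_reg_sq: "continuous_on S (reg_sq \<kappa>)"
  unfolding reg_sq_def[abs_def] by (intro continuous_intros)

lemma continuous_on_trunc_reg_sq:
  assumes "\<kappa> > 0" "e > 0"
  shows "continuous_on S (\<lambda>y. trunc s e (reg_sq \<kappa> y))"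
proof -
  have "reg_sq \<kappa> y > 0" "1 + e * reg_sq \<kappa> y > 0" for y :: 'a using assms reg_sq_pos[of \<kappa> y] by (auto simp: add_pos_pos)
  then show ?thesis unfolding trunc_def
    by (intro continuous_intros continuous_on_reg_sq) (auto simp: less_imp_neq[THEN not_sym])
qed

text \<open>The solution \<open>u\<close> will be tested with \<open>\<eta>\<^sup>2 test_map(u)\<close>, a truncation of \<open>\<eta>\<^sup>2 t\<^bsup>2s\<^esup> u\<close> with
  \<open>t = |u|\<^sup>2 + \<kappa>\<^sup>2\<close>.\<close>
definition test_map :: "real \<Rightarrow> real \<Rightarrow> real \<Rightarrow> 'a::real_inner \<Rightarrow> 'a" where
  "test_map s e \<kappa> y = trunc (2 * s) e (reg_sq \<kappa> y) *\<^sub>R y"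

definition test_map_deriv :: "real \<Rightarrow> real \<Rightarrow> real \<Rightarrow> 'a::real_inner \<Rightarrow> 'a \<Rightarrow> 'a" where
  "test_map_deriv s e \<kappa> y v = trunc (2 * s) e (reg_sq \<kappa> y) *\<^sub>R v +
     (2 * s * trunc (2 * s) e (reg_sq \<kappa> y) / (reg_sq \<kappa> y * (1 + e * reg_sq \<kappa> y)) * (2 * (y \<bullet> v))) *\<^sub>R y"

text \<open>A truncation of \<open>t\<^bsup>s + 1/2\<^esup>\<close>, the quantity to which the Sobolev inequality is applied. Its square
  is \<open>t\<close> times the factor in \<open>test_map\<close>, so that both occur in the same energy inequality.\<close>
definition pow_map :: "real \<Rightarrow> real \<Rightarrow> real \<Rightarrow> 'a::real_inner \<Rightarrow> real" where
  "pow_map s e \<kappa> y = sqrt (reg_sq \<kappa> y) * trunc s e (reg_sq \<kappa> y)"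

definition pow_map_deriv :: "real \<Rightarrow> real \<Rightarrow> real \<Rightarrow> 'a::real_inner \<Rightarrow> 'a \<Rightarrow> real" where
  "pow_map_deriv s e \<kappa> y v =
     (1 + 2 * s / (1 + e * reg_sq \<kappa> y)) * pow_map s e \<kappa> y * (y \<bullet> v) / reg_sq \<kappa> y"

context
  fixes s e \<kappa> :: real
  assumes s: "s \<ge> 0" and e: "e > 0" and \<kappa>: "\<kappa> > 0"
begin

lemma denom_pos: "1 + e * reg_sq \<kappa> y > 0"
  using reg_sq_pos[OF \<kappa>, of y] e by (simp add: add_pos_pos)

lemma test_map_has_derivative: "(test_map s e \<kappa> has_derivative test_map_deriv s e \<kappa> y) (at y)"
proof -
  have "((\<lambda>y. trunc (2 * s) e (reg_sq \<kappa> y)) has_derivative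
     (\<lambda>v. 2 * (y \<bullet> v) * (2 * s * trunc (2 * s) e (reg_sq \<kappa> y) / (reg_sq \<kappa> y * (1 + e * reg_sq \<kappa> y))))) (at y)"
    by (rule DERIV_compose_FDERIV[OF trunc_has_derivative[OF reg_sq_pos[OF \<kappa>] e] reg_sq_has_derivative])
  from has_derivative_scaleR[OF this has_derivative_ident] show ?thesis
    unfolding test_map_def[abs_def] test_map_deriv_def[abs_def] by (simp add: mult.commute)
qed

lemma test_map_deriv_bound: "norm (test_map_deriv s e \<kappa> y v) \<le> ((1 + 4 * s) * (1 / e) powr (2 * s)) * norm v"
proof -
  let ?t = "reg_sq \<kappa> y" and ?h = "trunc (2 * s) e (reg_sq \<kappa> y)"
  have t: "?t > 0" by (rule reg_sq_pos[OF \<kappa>])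
  have h: "?h > 0" "?h \<le> (1 / e) powr (2 * s)" using trunc_pos[OF t e] trunc_bound(1)[OF t e] s by auto
  have yt: "norm y * norm y \<le> ?t" by (simp add: reg_sq_def power2_norm_eq_inner flip: power2_eq_square)
  have "norm (test_map_deriv s e \<kappa> y v) \<le> ?h * norm v + 2 * s * ?h / (?t * (1 + e * ?t)) * (2 * \<bar>y \<bullet> v\<bar>) * norm y"
    unfolding test_map_deriv_def
    by (rule order_trans[OF norm_triangle_ineq]) (use h t s denom_pos[of y] in \<open>simp add: abs_mult abs_divide\<close>)
  also have "\<dots> \<le> ?h * norm v + 2 * s * ?h / (?t * 1) * (2 * (norm y * norm v)) * norm y"
    using h t s e mult_pos_pos[OF mult_pos_pos[OF t denom_pos[of y]] t]
    by (intro add_left_mono mult_mono divide_left_mono Cauchy_Schwarz_ineq2) auto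
  also have "\<dots> = ?h * norm v + 4 * s * ?h * norm v * (norm y * norm y / ?t)" by (simp add: field_simps)
  also have "\<dots> \<le> ?h * norm v + 4 * s * ?h * norm v * 1"
    using h s yt t by (intro add_left_mono mult_left_mono) (auto simp: divide_le_eq)
  also have "\<dots> = ?h * ((1 + 4 * s) * norm v)" by (simp add: algebra_simps)
  also have "\<dots> \<le> (1 / e) powr (2 * s) * ((1 + 4 * s) * norm v)"
    using h s by (intro mult_right_mono) auto
  finally show ?thesis by (simp add: mult_ac)
qed

lemma test_map_deriv_continuous: "continuous_on UNIV (\<lambda>y. test_map_deriv s e \<kappa> y v)"
proof -
  have "reg_sq \<kappa> y \<noteq> 0" "1 + e * reg_sq \<kappa> y \<noteq> 0" for y :: 'a
    using reg_sq_pos[OF \<kappa>, of y] denom_pos[of y] by auto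
  then show ?thesis unfolding test_map_deriv_def
    by (intro continuous_intros continuous_on_trunc_reg_sq \<kappa> e continuous_on_reg_sq) auto
qed

lemma test_map_smooth: "smooth \<psi> \<Longrightarrow> smooth (\<lambda>x. test_map s e \<kappa> (\<psi> x))"
  unfolding test_map_def
  by (intro smooth_scaleR smooth_trunc smooth_reg_sq reg_sq_pos \<kappa> e)

lemma pow_map_eq: "pow_map s e \<kappa> y = reg_sq \<kappa> y powr (1/2) * trunc s e (reg_sq \<kappa> y)"
  using reg_sq_pos[OF \<kappa>, of y] by (simp add: pow_map_def powr_half_sqrt)

lemma pow_map_pos: "pow_map s e \<kappa> y > 0"
  using reg_sq_pos[OF \<kappa>, of y] trunc_pos e by (simp add: pow_map_def)

lemma pow_map_sq: "(pow_map s e \<kappa> y)\<^sup>2 = reg_sq \<kappa> y * trunc (2 * s) e (reg_sq \<kappa> y)"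
  using reg_sq_pos[OF \<kappa>, of y] by (simp add: pow_map_def power_mult_distrib trunc_double)

lemma pow_map_has_derivative: "(pow_map s e \<kappa> has_derivative pow_map_deriv s e \<kappa> y) (at y)"
proof -
  let ?t = "reg_sq \<kappa> y"
  have t: "?t > 0" by (rule reg_sq_pos[OF \<kappa>])
  have d: "((\<lambda>t. t powr (1/2) * trunc s e t) has_real_derivative
     (1/2 * ?t powr (1/2 - 1)) * trunc s e ?t + s * trunc s e ?t / (?t * (1 + e * ?t)) * ?t powr (1/2)) (at ?t)"
    by (rule DERIV_mult[OF has_real_derivative_powr[OF t] trunc_has_derivative[OF t e]])
  have "(pow_map s e \<kappa> has_derivative (\<lambda>v. 2 * (y \<bullet> v) * ((1/2 * ?t powr (1/2 - 1)) * trunc s e ?t + s * trunc s e ?t / (?t * (1 + e * ?t)) * ?t powr (1/2)))) (at y)"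
    unfolding pow_map_eq[abs_def] by (rule DERIV_compose_FDERIV[OF d reg_sq_has_derivative])
  moreover have "(\<lambda>v. 2 * (y \<bullet> v) * ((1/2 * ?t powr (1/2 - 1)) * trunc s e ?t + s * trunc s e ?t / (?t * (1 + e * ?t)) * ?t powr (1/2)))
     = pow_map_deriv s e \<kappa> y"
  proof
    fix v
    have "?t powr (1/2 - 1) = ?t powr (1/2) / ?t" using t powr_diff[of ?t "1/2" 1] by simp
    then show "2 * (y \<bullet> v) * ((1/2 * ?t powr (1/2 - 1)) * trunc s e ?t + s * trunc s e ?t / (?t * (1 + e * ?t)) * ?t powr (1/2))
       = pow_map_deriv s e \<kappa> y v"
      using t denom_pos[of y] by (simp add: pow_map_deriv_def pow_map_eq divide_simps) (simp add: algebra_simps)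
  qed
  ultimately show ?thesis by simp
qed

lemma pow_map_deriv_bound: "\<bar>pow_map_deriv s e \<kappa> y v\<bar> \<le> ((1 + 2 * s) * (1 / e) powr s) * norm v"
proof -
  let ?t = "reg_sq \<kappa> y" and ?h = "trunc s e (reg_sq \<kappa> y)"
  have t: "?t > 0" by (rule reg_sq_pos[OF \<kappa>])
  have h: "?h > 0" "?h \<le> (1 / e) powr s" using trunc_pos[OF t e] trunc_bound(1)[OF t e s] by auto
  have yv: "\<bar>y \<bullet> v\<bar> \<le> sqrt ?t * norm v"
    by (rule order_trans[OF Cauchy_Schwarz_ineq2]) (intro mult_right_mono norm_le_sqrt_reg_sq, simp)
  have "2 * s / (1 + e * ?t) \<le> 2 * s / 1" using s t e by (intro divide_left_mono) (auto simp: add_pos_pos)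
  then have k: "0 \<le> 1 + 2 * s / (1 + e * ?t)" "1 + 2 * s / (1 + e * ?t) \<le> 1 + 2 * s"
    using s denom_pos[of y] by auto
  have "\<bar>pow_map_deriv s e \<kappa> y v\<bar> = (1 + 2 * s / (1 + e * ?t)) * (sqrt ?t * ?h / ?t * \<bar>y \<bullet> v\<bar>)"
    using k t h by (simp add: pow_map_deriv_def pow_map_def abs_mult abs_divide)
  also have "\<dots> \<le> (1 + 2 * s) * (sqrt ?t * ?h / ?t * (sqrt ?t * norm v))"
    using k s t h yv by (intro mult_mono mult_left_mono) auto
  also have "sqrt ?t * ?h / ?t * (sqrt ?t * norm v) = ?h * norm v * (sqrt ?t * sqrt ?t / ?t)" by simp
  also have "sqrt ?t * sqrt ?t / ?t = 1" using t by simp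
  also have "(1 + 2 * s) * (?h * norm v * 1) \<le> (1 + 2 * s) * ((1 / e) powr s * norm v * 1)"
    using h s by (intro mult_left_mono mult_right_mono) auto
  finally show ?thesis by (simp add: mult_ac)
qed

lemma pow_map_deriv_continuous: "continuous_on UNIV (\<lambda>y. pow_map_deriv s e \<kappa> y v)"
proof -
  have "reg_sq \<kappa> y \<noteq> 0" "1 + e * reg_sq \<kappa> y \<noteq> 0" for y :: 'a
    using reg_sq_pos[OF \<kappa>, of y] denom_pos[of y] by auto
  then show ?thesis unfolding pow_map_deriv_def pow_map_def
    by (intro continuous_intros continuous_on_trunc_reg_sq \<kappa> e continuous_on_reg_sq) auto
qed

lemma pow_map_smooth: "smooth \<psi> \<Longrightarrow> smooth (\<lambda>x. pow_map s e \<kappa> (\<psi> x))"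
  unfolding pow_map_eq
  by (intro smooth_mult smooth_powr smooth_trunc smooth_reg_sq reg_sq_pos \<kappa> e)

end

text \<open>For diagonal coefficients the form on matrices is the scalar form applied to the rows and summed.\<close>
lemma diagonal_form:
  fixes \<xi> \<zeta> :: "real^'n::finite^'d::finite"
  shows "(\<Sum>i\<in>UNIV. \<Sum>j\<in>UNIV. \<Sum>\<alpha>\<in>UNIV. \<Sum>\<beta>\<in>UNIV. (a \<alpha> \<beta> *\<^sub>R (mat 1 :: real^'d^'d)) $ i $ j * \<xi> $ j $ \<beta> * \<zeta> $ i $ \<alpha>)
    = (\<Sum>\<alpha>\<in>UNIV. \<Sum>\<beta>\<in>UNIV. a \<alpha> \<beta> * (column \<beta> \<xi> \<bullet> column \<alpha> \<zeta>))"
proof -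
  have "(\<Sum>i\<in>UNIV. \<Sum>j\<in>UNIV. \<Sum>\<alpha>\<in>UNIV. \<Sum>\<beta>\<in>UNIV. (a \<alpha> \<beta> *\<^sub>R (mat 1 :: real^'d^'d)) $ i $ j * \<xi> $ j $ \<beta> * \<zeta> $ i $ \<alpha>)
     = (\<Sum>i\<in>UNIV. \<Sum>j\<in>UNIV. if i = j then (\<Sum>\<alpha>\<in>UNIV. \<Sum>\<beta>\<in>UNIV. a \<alpha> \<beta> * \<xi> $ j $ \<beta> * \<zeta> $ i $ \<alpha>) else 0)"
    by (intro sum.cong refl) (auto simp: mat_def)
  also have "\<dots> = (\<Sum>i\<in>UNIV. \<Sum>\<alpha>\<in>UNIV. \<Sum>\<beta>\<in>UNIV. a \<alpha> \<beta> * \<xi> $ i $ \<beta> * \<zeta> $ i $ \<alpha>)"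
    by (simp add: sum.delta)
  also have "\<dots> = (\<Sum>\<alpha>\<in>UNIV. \<Sum>i\<in>UNIV. \<Sum>\<beta>\<in>UNIV. a \<alpha> \<beta> * \<xi> $ i $ \<beta> * \<zeta> $ i $ \<alpha>)"
    by (rule sum.swap)
  also have "\<dots> = (\<Sum>\<alpha>\<in>UNIV. \<Sum>\<beta>\<in>UNIV. \<Sum>i\<in>UNIV. a \<alpha> \<beta> * \<xi> $ i $ \<beta> * \<zeta> $ i $ \<alpha>)"
    by (intro sum.cong refl sum.swap)
  also have "\<dots> = (\<Sum>\<alpha>\<in>UNIV. \<Sum>\<beta>\<in>UNIV. a \<alpha> \<beta> * (column \<beta> \<xi> \<bullet> column \<alpha> \<zeta>))"
    by (intro sum.cong refl) (simp add: inner_vec_def column_def sum_distrib_left mult.assoc)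
  finally show ?thesis .
qed

text \<open>Put \<open>h = trunc s e t\<close>. Since the coefficients act on each component separately, they see the test
  function only through \<open>a(\<xi>,\<xi>)\<close> and through the scalar form on \<open>z\<^sub>\<alpha> = y \<bullet> \<xi>\<^sub>\<alpha>\<close>, which is half the
  gradient of \<open>t\<close>; tested on matrices of rank one, the hypotheses give ellipticity and boundedness of
  the scalar form. The Cauchy-Schwarz inequality \<open>|z|\<^sup>2 \<le> t |\<xi>|\<^sup>2\<close> and the monotonicity of \<open>h\<close> bound the
  form from below by a multiple of the gradient of \<open>\<eta> sqrt(t) h\<close>, up to terms where \<open>\<eta>\<close> is
  differentiated. The constant grows linearly in \<open>1 + 2 s\<close>.\<close>
lemma energy_pointwise:
  fixes \<xi> :: "real^'n::finite^'d::finite" and y b :: "real^'d" and g :: "real^'n" and a :: "'n \<Rightarrow> 'n \<Rightarrow> real"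
  assumes ell: "\<And>\<xi>::real^'n^'d. (\<Sum>\<alpha>\<in>UNIV. \<Sum>\<beta>\<in>UNIV. a \<alpha> \<beta> * (column \<beta> \<xi> \<bullet> column \<alpha> \<xi>)) \<ge> lam * (norm \<xi>)\<^sup>2"
    and bdd: "\<And>\<xi> \<zeta>::real^'n^'d. (\<Sum>\<alpha>\<in>UNIV. \<Sum>\<beta>\<in>UNIV. a \<alpha> \<beta> * (column \<beta> \<xi> \<bullet> column \<alpha> \<zeta>)) \<le> Lam * norm \<xi> * norm \<zeta>"
    and lam: "lam > 0" and Lam: "Lam > 0" and s: "s \<ge> 0" and e: "e > 0" and \<kappa>: "\<kappa> > 0" and \<eta>: "\<eta> \<ge> 0"
    and b: "norm b = 1"
  shows "(norm (of_columns (\<lambda>\<alpha>. \<eta> *\<^sub>R (pow_map_deriv s e \<kappa> y (column \<alpha> \<xi>) *\<^sub>R b) + g $ \<alpha> *\<^sub>R (pow_map s e \<kappa> y *\<^sub>R b))))\<^sup>2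
    \<le> (4 * (1 + 2 * s) / lam) * (\<Sum>\<alpha>\<in>UNIV. \<Sum>\<beta>\<in>UNIV. a \<alpha> \<beta> * (column \<beta> \<xi> \<bullet>
          (\<eta>\<^sup>2 *\<^sub>R test_map_deriv s e \<kappa> y (column \<alpha> \<xi>) + (2 * \<eta> * g $ \<alpha>) *\<^sub>R test_map s e \<kappa> y)))
      + (8 * (Lam / lam)\<^sup>2 + 2) * (1 + 2 * s) * ((pow_map s e \<kappa> y)\<^sup>2 * (norm g)\<^sup>2)"
proof -
  define t where "t = reg_sq \<kappa> y"
  define h where "h = trunc s e t"
  define m where "m = 1 / (1 + e * t)"
  define k where "k = 1 + 2 * s * m"
  define P where "P = pow_map s e \<kappa> y"
  define z where "z = (\<chi> \<alpha>. y \<bullet> column \<alpha> \<xi>)"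
  have t: "t > 0" unfolding t_def by (rule reg_sq_pos[OF \<kappa>])
  have h: "h > 0" unfolding h_def by (rule trunc_pos[OF t e])
  have m: "0 < m" "m \<le> 1" using t e by (auto simp: m_def add_pos_pos)
  have k: "1 \<le> k" "k \<le> 1 + 2 * s" using m s by (auto simp: k_def mult_left_le)
  have P: "P = sqrt t * h" by (simp add: P_def pow_map_def t_def h_def)
  define Sx where "Sx = (\<Sum>\<alpha>\<in>UNIV. \<Sum>\<beta>\<in>UNIV. a \<alpha> \<beta> * (column \<beta> \<xi> \<bullet> column \<alpha> \<xi>))"
  define Sz where "Sz = (\<Sum>\<alpha>\<in>UNIV. \<Sum>\<beta>\<in>UNIV. a \<alpha> \<beta> * (z $ \<beta> * z $ \<alpha>))"
  define Sg where "Sg = (\<Sum>\<alpha>\<in>UNIV. \<Sum>\<beta>\<in>UNIV. a \<alpha> \<beta> * (z $ \<beta> * g $ \<alpha>))"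
  have nz: "(norm v)\<^sup>2 = (\<Sum>\<alpha>\<in>UNIV. (v $ \<alpha>)\<^sup>2)" for v :: "real^'n"
    unfolding power2_norm_eq_inner inner_vec_def by (simp add: power2_eq_square)
  have rank1: "norm (of_columns (\<lambda>\<alpha>. v $ \<alpha> *\<^sub>R b)) = norm v" for v :: "real^'n"
  proof -
    have "(norm (of_columns (\<lambda>\<alpha>. v $ \<alpha> *\<^sub>R b)))\<^sup>2 = (norm v)\<^sup>2"
      using b by (simp add: norm_matrix_columns nz power_mult_distrib)
    then show ?thesis by simp
  qed
  have bb: "b \<bullet> b = 1" using b by (simp add: norm_eq_1)
  have Sx: "Sx \<ge> lam * (norm \<xi>)\<^sup>2" unfolding Sx_def by (rule ell)
  have Sz: "Sz \<ge> lam * (norm z)\<^sup>2"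
    using ell[of "of_columns (\<lambda>\<alpha>. z $ \<alpha> *\<^sub>R b)"] by (simp add: rank1 Sz_def bb mult_ac)
  have Sg: "Sg \<ge> - (Lam * norm z * norm g)"
    using bdd[of "of_columns (\<lambda>\<alpha>. z $ \<alpha> *\<^sub>R b)" "of_columns (\<lambda>\<alpha>. (- g) $ \<alpha> *\<^sub>R b)"] unfolding rank1
    by (simp add: Sg_def bb sum_negf mult_ac)
  have z\<xi>: "(norm z)\<^sup>2 \<le> t * (norm \<xi>)\<^sup>2"
  proof -
    have "(norm z)\<^sup>2 = (\<Sum>\<alpha>\<in>UNIV. (y \<bullet> column \<alpha> \<xi>)\<^sup>2)" by (simp add: nz z_def)
    also have "\<dots> \<le> (\<Sum>\<alpha>\<in>UNIV. t * (norm (column \<alpha> \<xi>))\<^sup>2)"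
    proof (intro sum_mono)
      fix \<alpha>
      have "(y \<bullet> column \<alpha> \<xi>)\<^sup>2 \<le> (y \<bullet> y) * (norm (column \<alpha> \<xi>))\<^sup>2"
        using Cauchy_Schwarz_ineq[of y "column \<alpha> \<xi>"] by (simp add: power2_norm_eq_inner)
      also have "\<dots> \<le> t * (norm (column \<alpha> \<xi>))\<^sup>2" by (intro mult_right_mono) (auto simp: t_def reg_sq_def)
      finally show "(y \<bullet> column \<alpha> \<xi>)\<^sup>2 \<le> t * (norm (column \<alpha> \<xi>))\<^sup>2" .
    qed
    finally show ?thesis by (simp add: norm_matrix_columns sum_distrib_left)
  qed
  define A where "A = (\<Sum>\<alpha>\<in>UNIV. \<Sum>\<beta>\<in>UNIV. a \<alpha> \<beta> * (column \<beta> \<xi> \<bullet>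
          (\<eta>\<^sup>2 *\<^sub>R test_map_deriv s e \<kappa> y (column \<alpha> \<xi>) + (2 * \<eta> * g $ \<alpha>) *\<^sub>R test_map s e \<kappa> y)))"
  \<comment> \<open>the two gradients to be compared: \<open>X\<close> from differentiating the power, \<open>Y\<close> from differentiating \<open>\<eta>\<close>\<close>
  define X where "X = \<eta> * h * norm z / sqrt t"
  define Y where "Y = P * norm g"
  have st: "sqrt t > 0" "sqrt t * sqrt t = t" using t by auto
  have X2: "X\<^sup>2 = \<eta>\<^sup>2 * h\<^sup>2 * (norm z)\<^sup>2 / t"
    using t by (simp add: X_def power_mult_distrib power_divide)
  have XY: "X * Y = \<eta> * h\<^sup>2 * norm z * norm g"
    using st by (simp add: X_def Y_def P power2_eq_square)
  have XYpos: "X \<ge> 0" "Y \<ge> 0" using \<eta> h st by (auto simp: X_def Y_def P)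
  have Aeq: "A = \<eta>\<^sup>2 * h\<^sup>2 * Sx + (\<eta>\<^sup>2 * (4 * s * m * h\<^sup>2 / t)) * Sz + (2 * \<eta> * h\<^sup>2) * Sg"
  proof -
    have "a \<alpha> \<beta> * (column \<beta> \<xi> \<bullet> (\<eta>\<^sup>2 *\<^sub>R test_map_deriv s e \<kappa> y (column \<alpha> \<xi>) + (2 * \<eta> * g $ \<alpha>) *\<^sub>R test_map s e \<kappa> y))
      = \<eta>\<^sup>2 * h\<^sup>2 * (a \<alpha> \<beta> * (column \<beta> \<xi> \<bullet> column \<alpha> \<xi>)) + (\<eta>\<^sup>2 * (4 * s * m * h\<^sup>2 / t)) * (a \<alpha> \<beta> * (z $ \<beta> * z $ \<alpha>))
        + (2 * \<eta> * h\<^sup>2) * (a \<alpha> \<beta> * (z $ \<beta> * g $ \<alpha>))" for \<alpha> \<beta>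
      by (simp add: test_map_deriv_def test_map_def trunc_double t_def[symmetric] h_def[symmetric] m_def z_def
          inner_add_right inner_commute[of "column \<beta> \<xi>" y]) (simp add: algebra_simps)
    then show ?thesis unfolding A_def Sx_def Sz_def Sg_def
      by (simp add: sum.distrib sum_distrib_left)
  qed
  have Alow: "A \<ge> lam * k * X\<^sup>2 - 2 * Lam * (X * Y)"
  proof -
    have "\<eta>\<^sup>2 * h\<^sup>2 * Sx \<ge> \<eta>\<^sup>2 * h\<^sup>2 * (lam * ((norm z)\<^sup>2 / t))"
    proof -
      have "(norm z)\<^sup>2 / t \<le> (norm \<xi>)\<^sup>2" using z\<xi> t by (simp add: divide_le_eq mult.commute)
      then have "lam * ((norm z)\<^sup>2 / t) \<le> Sx" using Sx lam by (meson mult_left_mono less_imp_le order_trans)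
      then show ?thesis by (intro mult_left_mono) auto
    qed
    moreover have "(\<eta>\<^sup>2 * (4 * s * m * h\<^sup>2 / t)) * Sz \<ge> (\<eta>\<^sup>2 * (4 * s * m * h\<^sup>2 / t)) * (lam * (norm z)\<^sup>2)"
      using s m t by (intro mult_left_mono Sz) auto
    moreover have "(2 * \<eta> * h\<^sup>2) * Sg \<ge> (2 * \<eta> * h\<^sup>2) * (- (Lam * norm z * norm g))"
      using \<eta> by (intro mult_left_mono Sg) auto
    ultimately have "A \<ge> \<eta>\<^sup>2 * h\<^sup>2 * (lam * ((norm z)\<^sup>2 / t)) + (\<eta>\<^sup>2 * (4 * s * m * h\<^sup>2 / t)) * (lam * (norm z)\<^sup>2)
        + (2 * \<eta> * h\<^sup>2) * (- (Lam * norm z * norm g))" unfolding Aeq by linarith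
    also have "\<eta>\<^sup>2 * h\<^sup>2 * (lam * ((norm z)\<^sup>2 / t)) + (\<eta>\<^sup>2 * (4 * s * m * h\<^sup>2 / t)) * (lam * (norm z)\<^sup>2)
        + (2 * \<eta> * h\<^sup>2) * (- (Lam * norm z * norm g)) = lam * (1 + 4 * s * m) * X\<^sup>2 - 2 * Lam * (X * Y)"
      unfolding X2 XY by (simp add: algebra_simps add_divide_distrib)
    finally have "A \<ge> lam * (1 + 4 * s * m) * X\<^sup>2 - 2 * Lam * (X * Y)" .
    moreover have "lam * k * X\<^sup>2 \<le> lam * (1 + 4 * s * m) * X\<^sup>2"
      using lam s m by (intro mult_right_mono mult_left_mono) (auto simp: k_def)
    ultimately show ?thesis by linarith
  qed
  have DW: "(norm (of_columns (\<lambda>\<alpha>. \<eta> *\<^sub>R (pow_map_deriv s e \<kappa> y (column \<alpha> \<xi>) *\<^sub>R b) + g $ \<alpha> *\<^sub>R (pow_map s e \<kappa> y *\<^sub>R b))))\<^sup>2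
     \<le> 2 * k\<^sup>2 * X\<^sup>2 + 2 * Y\<^sup>2"
  proof -
    have "\<eta> *\<^sub>R (pow_map_deriv s e \<kappa> y (column \<alpha> \<xi>) *\<^sub>R b) + g $ \<alpha> *\<^sub>R (pow_map s e \<kappa> y *\<^sub>R b)
       = (\<eta> * k * P / t * z $ \<alpha> + P * g $ \<alpha>) *\<^sub>R b" for \<alpha>
      by (simp add: pow_map_deriv_def P_def t_def[symmetric] k_def m_def z_def scaleR_add_left mult_ac)
    then have "(norm (of_columns (\<lambda>\<alpha>. \<eta> *\<^sub>R (pow_map_deriv s e \<kappa> y (column \<alpha> \<xi>) *\<^sub>R b) + g $ \<alpha> *\<^sub>R (pow_map s e \<kappa> y *\<^sub>R b))))\<^sup>2
       = (\<Sum>\<alpha>\<in>UNIV. (\<eta> * k * P / t * z $ \<alpha> + P * g $ \<alpha>)\<^sup>2)"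
      using b by (simp add: norm_matrix_columns)
    also have "\<dots> \<le> (\<Sum>\<alpha>\<in>UNIV. 2 * (\<eta> * k * P / t)\<^sup>2 * (z $ \<alpha>)\<^sup>2 + 2 * P\<^sup>2 * (g $ \<alpha>)\<^sup>2)"
    proof (intro sum_mono)
      fix \<alpha>
      have sq: "(p + q)\<^sup>2 \<le> 2 * p\<^sup>2 + 2 * q\<^sup>2" for p q :: real
        using sum_squares_bound[of p q] by (simp add: power2_sum)
      from sq[of "\<eta> * k * P / t * z $ \<alpha>" "P * g $ \<alpha>"]
      show "(\<eta> * k * P / t * z $ \<alpha> + P * g $ \<alpha>)\<^sup>2 \<le> 2 * (\<eta> * k * P / t)\<^sup>2 * (z $ \<alpha>)\<^sup>2 + 2 * P\<^sup>2 * (g $ \<alpha>)\<^sup>2"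
        by (simp only: power_mult_distrib mult.assoc)
    qed
    also have "\<dots> = 2 * (\<eta> * k * P / t)\<^sup>2 * (norm z)\<^sup>2 + 2 * P\<^sup>2 * (norm g)\<^sup>2"
      by (simp add: sum.distrib sum_distrib_left nz)
    also have "(\<eta> * k * P / t)\<^sup>2 = k\<^sup>2 * (\<eta>\<^sup>2 * h\<^sup>2 / t)"
      using t by (simp add: P power_mult_distrib power_divide power2_eq_square[of t])
    finally show ?thesis unfolding X2 Y_def by (simp add: power_mult_distrib mult_ac)
  qed
  let ?\<gamma> = "1 + 2 * s"
  define r where "r = Lam / lam"
  \<comment> \<open>the mixed term is split as \<open>8 r X Y \<le> 2 X\<^sup>2 + 8 r\<^sup>2 Y\<^sup>2\<close>; as \<open>k\<^sup>2 \<le> (1 + 2 s) k\<close>, enough of \<open>4 (1 + 2 s) k X\<^sup>2\<close> is left for \<open>2 k\<^sup>2 X\<^sup>2\<close>\<close>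
  have "2 * k\<^sup>2 * X\<^sup>2 + 2 * Y\<^sup>2 \<le> (4 * ?\<gamma> / lam) * (lam * k * X\<^sup>2 - 2 * Lam * (X * Y)) + (8 * r\<^sup>2 + 2) * ?\<gamma> * Y\<^sup>2"
  proof -
    have "(4 * ?\<gamma> / lam) * (lam * k * X\<^sup>2 - 2 * Lam * (X * Y)) = 4 * ?\<gamma> * k * X\<^sup>2 - ?\<gamma> * (8 * r * (X * Y))"
      using lam by (simp add: r_def field_simps)
    moreover have "8 * r * (X * Y) \<le> 2 * X\<^sup>2 + 8 * r\<^sup>2 * Y\<^sup>2"
      using zero_le_power2[of "X - 2 * r * Y"] by (simp add: power2_diff power_mult_distrib mult_ac)
    then have "?\<gamma> * (8 * r * (X * Y)) \<le> ?\<gamma> * (2 * X\<^sup>2 + 8 * r\<^sup>2 * Y\<^sup>2)" using s by (intro mult_left_mono) auto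
    moreover have "k * k * X\<^sup>2 \<le> ?\<gamma> * k * X\<^sup>2" using k by (intro mult_right_mono) auto
    moreover have "?\<gamma> * 1 * X\<^sup>2 \<le> ?\<gamma> * k * X\<^sup>2" using k s by (intro mult_right_mono mult_left_mono) auto
    moreover have "1 * Y\<^sup>2 \<le> ?\<gamma> * Y\<^sup>2" using s by (intro mult_right_mono) auto
    ultimately show ?thesis by (simp add: algebra_simps power2_eq_square[of k])
  qed
  also have "\<dots> \<le> (4 * ?\<gamma> / lam) * A + (8 * r\<^sup>2 + 2) * ?\<gamma> * Y\<^sup>2"
    using Alow s lam by (intro add_right_mono mult_left_mono) auto
  finally show ?thesis using DW unfolding A_def r_def Y_def P_def by (simp add: power_mult_distrib)
qed

section \<open>The reverse Hoelder inequality\<close>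

lemma ennreal_add_le: "b \<ge> 0 \<Longrightarrow> ennreal (a + b) \<le> ennreal a + ennreal b"
  by (cases "a \<ge> 0") (auto simp: ennreal_neg intro!: ennreal_leI)

lemma ennreal_integral_le_nn_integral:
  fixes g :: "'a \<Rightarrow> real"
  shows "ennreal (\<integral>x. g x \<partial>M) \<le> (\<integral>\<^sup>+x. ennreal \<bar>g x\<bar> \<partial>M)"
proof (cases "integrable M g")
  case True
  have "ennreal (\<integral>x. g x \<partial>M) \<le> ennreal (norm (\<integral>x. g x \<partial>M))" by (intro ennreal_leI) auto
  also have "\<dots> \<le> (\<integral>\<^sup>+x. ennreal (norm (g x)) \<partial>M)" by (rule integral_norm_bound_ennreal[OF True])
  finally show ?thesis by simp
qed (simp add: not_integrable_integral_eq)

text \<open>The equation is tested with \<open>\<eta>\<^sup>2 test_map(U)\<close>. The potential term is a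
  nonnegative multiple of \<open>\<langle>VU,U\<rangle>\<close>, hence can be dropped, and no quantity depending on \<open>V\<close> enters the estimate. On the
  right-hand side \<open>\<kappa> |U| \<le> t\<close> allows to write \<open>f \<bullet> U\<close> as at most \<open>(|f|/\<kappa>) t\<close>. The Sobolev
  inequality is applied to \<open>W\<close> times a fixed unit vector, so that the chain rule for vector-valued
  maps covers it.\<close>
lemma Sobolev_energy:
  fixes U :: "real^'n::finite \<Rightarrow> real^'d::finite" and a :: "'n \<Rightarrow> 'n \<Rightarrow> real^'n \<Rightarrow> real"
  assumes n: "CARD('n) \<ge> 3" and U: "smooth_limit U DU \<phi>s"
    and lam: "lam > 0" and Lam: "Lam > 0"
    and am: "\<And>\<alpha> \<beta>. a \<alpha> \<beta> \<in> borel_measurable lebesgue"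
    and ell: "elliptic (\<lambda>x \<alpha> \<beta>. a \<alpha> \<beta> x *\<^sub>R (mat 1 :: real^'d^'d)) lam"
    and bdd: "bounded_form (\<lambda>x \<alpha> \<beta>. a \<alpha> \<beta> x *\<^sub>R (mat 1 :: real^'d^'d)) Lam"
    and V: "matrix_weight V" "V \<in> Lp_loc (real CARD('n) / 2)"
    and B: "open B" "cball 0 \<rho> \<subseteq> B"
    and f: "f \<in> borel_measurable lebesgue"
    and weak: "\<forall>\<phi> D\<phi>. \<phi> \<in> W12V0 V B \<longrightarrow> has_weak_gradient \<phi> D\<phi> B \<longrightarrow>
          (LINT x:B|lebesgue. (\<Sum>\<alpha>\<in>UNIV. \<Sum>\<beta>\<in>UNIV. a \<alpha> \<beta> x * (column \<beta> (DU x) \<bullet> column \<alpha> (D\<phi> x))))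
          + (LINT x:B|lebesgue. (V x *v U x) \<bullet> \<phi> x) = (LINT x:B|lebesgue. f x \<bullet> \<phi> x)"
    and \<eta>: "smooth \<eta>" "\<And>x. 0 \<le> \<eta> x" "\<And>x. \<eta> x \<le> 1" and \<eta>0: "\<And>x. norm x \<ge> \<rho> \<Longrightarrow> \<eta> x = 0"
    and G: "G > 0" "\<And>x v. \<bar>frechet_derivative \<eta> (at x) v\<bar> \<le> G * norm v"
    and s: "s \<ge> 0" and e: "e > 0" and \<kappa>: "\<kappa> > 0"
  defines "W \<equiv> \<lambda>x. \<eta> x * pow_map s e \<kappa> (U x)"
  shows "epow (\<integral>\<^sup>+x. ennreal (W x powr crit_exp TYPE('n)) \<partial>lebesgue) ((real CARD('n) - 2) / real CARD('n))
     \<le> 16 * (ennreal (4 * (1 + 2 * s) / lam) * (\<integral>\<^sup>+x. ennreal (norm (f x) / \<kappa> * (W x)\<^sup>2) \<partial>lebesgue)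
         + ennreal ((8 * (Lam / lam)\<^sup>2 + 2) * (1 + 2 * s) * G\<^sup>2) * (\<integral>\<^sup>+x. ennreal ((pow_map s e \<kappa> (U x))\<^sup>2) * indicator (cball 0 \<rho>) x \<partial>lebesgue))"
    and "(\<integral>\<^sup>+x. ennreal (W x powr crit_exp TYPE('n)) \<partial>lebesgue) < \<infinity>"
    and "W \<in> borel_measurable lebesgue"
proof -
  define b :: "real^'d" where "b = axis undefined 1"
  have b: "norm b = 1" by (simp add: b_def)
  define g where "g x = (\<chi> \<alpha>. frechet_derivative \<eta> (at x) (axis \<alpha> 1))" for x
  have \<eta>abs: "\<bar>\<eta> x\<bar> \<le> 1" for x using \<eta>(2,3)[of x] by simp
  have \<eta>0': "\<eta> x = 0" if "norm x > \<rho>" for x using \<eta>0[of x] that by simp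
  have fd0: "frechet_derivative \<eta> (at x) v = 0" if "norm x > \<rho>" for x v
    using derivative_zero_outside_support[OF smooth_has_derivative[OF \<eta>(1)] \<eta>0' that] by simp
  have bl: "bounded_linear (\<lambda>x. x *\<^sub>R b)" by (rule bounded_linear_scaleR_left)
  define Wv where "Wv x = \<eta> x *\<^sub>R (pow_map s e \<kappa> (U x) *\<^sub>R b)" for x
  define DW where "DW x = of_columns (\<lambda>\<alpha>. \<eta> x *\<^sub>R (pow_map_deriv s e \<kappa> (U x) (column \<alpha> (DU x)) *\<^sub>R b) + frechet_derivative \<eta> (at x) (axis \<alpha> 1) *\<^sub>R (pow_map s e \<kappa> (U x) *\<^sub>R b))" for x
  have SW: "smooth_limit Wv DW (\<lambda>k x. \<eta> x *\<^sub>R (pow_map s e \<kappa> (\<phi>s k x) *\<^sub>R b))"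
    unfolding Wv_def[abs_def] DW_def[abs_def]
  proof (rule smooth_limit_chain[OF n U, where F="\<lambda>y. pow_map s e \<kappa> y *\<^sub>R b" and F'="\<lambda>y v. pow_map_deriv s e \<kappa> y v *\<^sub>R b" and M=\<rho> and L="(1 + 2 * s) * (1 / e) powr s"])
    show "((\<lambda>y. pow_map s e \<kappa> y *\<^sub>R b) has_derivative (\<lambda>v. pow_map_deriv s e \<kappa> y v *\<^sub>R b)) (at y)" for y
      by (rule bounded_linear.has_derivative[OF bl pow_map_has_derivative[OF s e \<kappa>]])
    show "norm (pow_map_deriv s e \<kappa> y v *\<^sub>R b) \<le> (1 + 2 * s) * (1 / e) powr s * norm v" for y v :: "real^'d"
      using pow_map_deriv_bound[OF s e \<kappa>, of y v] b by simp
    show "continuous_on UNIV (\<lambda>y. pow_map_deriv s e \<kappa> y v *\<^sub>R b)" for v :: "real^'d"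
      by (intro continuous_intros pow_map_deriv_continuous s e \<kappa>)
    show "smooth (\<lambda>x. pow_map s e \<kappa> (\<psi> x) *\<^sub>R b)" if "smooth \<psi>" for \<psi> :: "real^'n \<Rightarrow> real^'d"
      by (intro smooth_scaleR smooth_const pow_map_smooth that s e \<kappa>)
  qed (fact \<eta>(1) \<eta>abs \<eta>0')+
  define \<Phi> where "\<Phi> x = (\<eta> x * \<eta> x) *\<^sub>R test_map s e \<kappa> (U x)" for x
  define D\<Phi> where "D\<Phi> x = of_columns (\<lambda>\<alpha>. (\<eta> x * \<eta> x) *\<^sub>R test_map_deriv s e \<kappa> (U x) (column \<alpha> (DU x)) + frechet_derivative (\<lambda>x. \<eta> x * \<eta> x) (at x) (axis \<alpha> 1) *\<^sub>R test_map s e \<kappa> (U x))" for x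
  have \<eta>2: "smooth (\<lambda>x. \<eta> x * \<eta> x)" by (intro smooth_mult \<eta>)
  have \<eta>2': "\<bar>\<eta> x * \<eta> x\<bar> \<le> 1" "norm x > \<rho> \<Longrightarrow> \<eta> x * \<eta> x = 0" for x
    using \<eta>(2,3)[of x] \<eta>0' by (auto simp: mult_le_one)
  define \<phi>t where "\<phi>t k x = (\<eta> x * \<eta> x) *\<^sub>R test_map s e \<kappa> (\<phi>s k x)" for k x
  have SP: "smooth_limit \<Phi> D\<Phi> \<phi>t"
    unfolding \<Phi>_def[abs_def] D\<Phi>_def[abs_def] \<phi>t_def[abs_def]
    by (rule smooth_limit_chain[OF n U test_map_has_derivative[OF s e \<kappa>] test_map_deriv_bound[OF s e \<kappa>]
          test_map_deriv_continuous[OF s e \<kappa>] test_map_smooth[OF s e \<kappa>] \<eta>2 \<eta>2'])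
  have fd2: "frechet_derivative (\<lambda>x. \<eta> x * \<eta> x) (at x) v = 2 * \<eta> x * frechet_derivative \<eta> (at x) v" for x v
  proof -
    have "((\<lambda>x. \<eta> x * \<eta> x) has_derivative (\<lambda>v. \<eta> x * frechet_derivative \<eta> (at x) v + frechet_derivative \<eta> (at x) v * \<eta> x)) (at x)"
      by (intro has_derivative_mult smooth_has_derivative \<eta>)
    from fun_cong[OF frechet_derivative_at[OF this], of v] show ?thesis by simp
  qed
  have out: "\<phi>t k x = 0" "\<Phi> x = 0" "D\<Phi> x = 0" if "x \<notin> cball 0 \<rho>" for k x
    using that \<eta>0'[of x] fd0[of x] by (auto simp: \<phi>t_def \<Phi>_def D\<Phi>_def fd2 of_columns_def vec_eq_iff)
  have mem: "\<Phi> \<in> W12V0 V B"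
    by (rule smooth_limit_in_W12V0(1)[OF n V SP B(1) compact_cball B(2) out(1,2)])
  have wg: "has_weak_gradient \<Phi> D\<Phi> B" by (rule smooth_limit_weak_gradient[OF n SP])
  define A where "A x = (\<Sum>\<alpha>\<in>UNIV. \<Sum>\<beta>\<in>UNIV. a \<alpha> \<beta> x * (column \<beta> (DU x) \<bullet> column \<alpha> (D\<Phi> x)))" for x
  note Um = smooth_limitD(1)[OF U] and DUm = smooth_limitD(2)[OF U]
  note D\<Phi>m = smooth_limitD(2)[OF SP] and \<Phi>m = smooth_limitD(1)[OF SP]
  note DWm[measurable] = smooth_limitD(2)[OF SW] and Wvm[measurable] = smooth_limitD(1)[OF SW]
  have ellx: "(\<Sum>\<alpha>\<in>UNIV. \<Sum>\<beta>\<in>UNIV. a \<alpha> \<beta> x * (column \<beta> \<xi> \<bullet> column \<alpha> \<xi>)) \<ge> lam * (norm \<xi>)\<^sup>2" for x and \<xi> :: "real^'n^'d"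
    using ell unfolding elliptic_def diagonal_form by blast
  have bddx: "(\<Sum>\<alpha>\<in>UNIV. \<Sum>\<beta>\<in>UNIV. a \<alpha> \<beta> x * (column \<beta> \<xi> \<bullet> column \<alpha> \<zeta>)) \<le> Lam * norm \<xi> * norm \<zeta>" for x and \<xi> \<zeta> :: "real^'n^'d"
    using bdd unfolding bounded_form_def diagonal_form by blast
  have Am: "A \<in> borel_measurable lebesgue" unfolding A_def[abs_def]
    by (intro borel_measurable_sum borel_measurable_times am borel_measurable_inner column_measurable DUm D\<Phi>m)
  have sq_int: "integrable lebesgue (\<lambda>x. (norm (D x))\<^sup>2)" if "smooth_limit T D \<psi>" for T :: "real^'n \<Rightarrow> real^'d" and D \<psi>
  proof (rule integrableI_bounded)
    have [measurable]: "D \<in> borel_measurable lebesgue" by (rule smooth_limitD(2)[OF that])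
    show "(\<lambda>x. (norm (D x))\<^sup>2) \<in> borel_measurable lebesgue" by measurable
    show "(\<integral>\<^sup>+x. ennreal (norm ((norm (D x))\<^sup>2)) \<partial>lebesgue) < \<infinity>" using smooth_limit_Sobolev(2)[OF n that] by simp
  qed
  have Ai: "integrable lebesgue A"
  proof (rule Bochner_Integration.integrable_bound[OF integrable_mult_right[OF Bochner_Integration.integrable_add[OF sq_int[OF U] sq_int[OF SP]], of Lam] Am])
    show "AE x in lebesgue. norm (A x) \<le> norm (Lam * ((norm (DU x))\<^sup>2 + (norm (D\<Phi> x))\<^sup>2))"
    proof (intro AE_I2)
      fix x
      have "A x \<le> Lam * norm (DU x) * norm (D\<Phi> x)" unfolding A_def by (rule bddx)
      moreover have "- A x \<le> Lam * norm (DU x) * norm (D\<Phi> x)"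
        using bddx[of x "DU x" "- D\<Phi> x"] column_diff[of _ 0 "D\<Phi> x"] by (simp add: A_def sum_negf column_def zero_vec_def[symmetric])
      moreover have "norm (DU x) * norm (D\<Phi> x) \<le> (norm (DU x))\<^sup>2 + (norm (D\<Phi> x))\<^sup>2"
        using sum_squares_bound[of "norm (DU x)" "norm (D\<Phi> x)"] mult_nonneg_nonneg[OF norm_ge_zero[of "DU x"] norm_ge_zero[of "D\<Phi> x"]] by linarith
      then have "Lam * norm (DU x) * norm (D\<Phi> x) \<le> Lam * ((norm (DU x))\<^sup>2 + (norm (D\<Phi> x))\<^sup>2)"
        using Lam by (simp add: mult.assoc mult_left_mono)
      ultimately show "norm (A x) \<le> norm (Lam * ((norm (DU x))\<^sup>2 + (norm (D\<Phi> x))\<^sup>2))" by simp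
    qed
  qed
  have AB: "(LINT x:B|lebesgue. A x) = (\<integral>x. A x \<partial>lebesgue)"
    unfolding set_lebesgue_integral_def
  proof (intro Bochner_Integration.integral_cong refl)
    fix x
    have "A x = 0" if "x \<notin> B"
    proof -
      have "x \<notin> cball 0 \<rho>" using that B by blast
      from out(3)[OF this] show ?thesis by (simp add: A_def column_def zero_vec_def[symmetric])
    qed
    then show "indicator B x *\<^sub>R A x = A x" by (auto simp: indicator_def)
  qed
  have Vpos: "(LINT x:B|lebesgue. (V x *v U x) \<bullet> \<Phi> x) \<ge> 0"
    unfolding set_lebesgue_integral_def
  proof (rule integral_nonneg_AE)
    have "AE x in lebesgue. pos_semidef (V x)" using V by (simp add: matrix_weight_def)
    then show "AE x in lebesgue. 0 \<le> indicator B x *\<^sub>R ((V x *v U x) \<bullet> \<Phi> x)"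
    proof eventually_elim
      case (elim x)
      then have "(V x *v U x) \<bullet> U x \<ge> 0" by (simp add: pos_semidef_def)
      moreover have "trunc (2 * s) e (reg_sq \<kappa> (U x)) \<ge> 0" by (rule less_imp_le[OF trunc_pos[OF reg_sq_pos[OF \<kappa>] e]])
      ultimately show ?case by (simp add: \<Phi>_def test_map_def)
    qed
  qed
  define Fi where "Fi = (\<integral>\<^sup>+x. ennreal (norm (f x) / \<kappa> * (W x)\<^sup>2) \<partial>lebesgue)"
  have Aint: "ennreal (\<integral>x. A x \<partial>lebesgue) \<le> Fi"
  proof -
    have "(\<integral>x. A x \<partial>lebesgue) \<le> (LINT x:B|lebesgue. f x \<bullet> \<Phi> x)"
      using weak[rule_format, OF mem wg] Vpos unfolding A_def[symmetric] AB by linarith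
    then have "ennreal (\<integral>x. A x \<partial>lebesgue) \<le> ennreal (LINT x:B|lebesgue. f x \<bullet> \<Phi> x)" by (rule ennreal_leI)
    also have "\<dots> \<le> (\<integral>\<^sup>+x. ennreal \<bar>indicator B x *\<^sub>R (f x \<bullet> \<Phi> x)\<bar> \<partial>lebesgue)"
      unfolding set_lebesgue_integral_def by (rule ennreal_integral_le_nn_integral)
    also have "\<dots> \<le> Fi" unfolding Fi_def
    proof (intro nn_integral_mono ennreal_leI)
      fix x
      let ?t = "reg_sq \<kappa> (U x)" and ?h = "trunc (2 * s) e (reg_sq \<kappa> (U x))"
      have t: "?t > 0" by (rule reg_sq_pos[OF \<kappa>])
      have h: "?h > 0" by (rule trunc_pos[OF t e])
      have "\<kappa> \<le> sqrt ?t" by (rule real_le_rsqrt) (simp add: reg_sq_def)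
      then have "\<kappa> * norm (U x) \<le> sqrt ?t * sqrt ?t" using t norm_le_sqrt_reg_sq[of "U x" \<kappa>] by (intro mult_mono) auto
      then have kU: "norm (U x) \<le> ?t / \<kappa>" using t \<kappa> by (simp add: field_simps)
      have "\<bar>indicator B x *\<^sub>R (f x \<bullet> \<Phi> x)\<bar> \<le> \<bar>f x \<bullet> \<Phi> x\<bar>" by (auto simp: indicator_def)
      also have "\<dots> \<le> norm (f x) * norm (\<Phi> x)" by (rule Cauchy_Schwarz_ineq2)
      also have "norm (\<Phi> x) = (\<eta> x)\<^sup>2 * ?h * norm (U x)"
        using h by (simp add: \<Phi>_def test_map_def power2_eq_square)
      also have "norm (f x) * ((\<eta> x)\<^sup>2 * ?h * norm (U x)) \<le> norm (f x) * ((\<eta> x)\<^sup>2 * ?h * (?t / \<kappa>))"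
        using h by (intro mult_left_mono kU) auto
      also have "\<dots> = norm (f x) / \<kappa> * (W x)\<^sup>2"
        by (simp add: W_def power_mult_distrib pow_map_sq[OF s e \<kappa>] mult_ac)
      finally show "\<bar>indicator B x *\<^sub>R (f x \<bullet> \<Phi> x)\<bar> \<le> norm (f x) / \<kappa> * (W x)\<^sup>2" .
    qed
    finally show ?thesis .
  qed
  have normW: "norm (Wv x) = W x" for x
    using b \<eta>(2)[of x] pow_map_pos[OF s e \<kappa>, of "U x"] by (simp add: Wv_def W_def abs_mult)
  show Wm: "W \<in> borel_measurable lebesgue" unfolding normW[symmetric, abs_def] by measurable
  show "(\<integral>\<^sup>+x. ennreal (W x powr crit_exp TYPE('n)) \<partial>lebesgue) < \<infinity>"
    using smooth_limit_Sobolev(3)[OF n SW] unfolding normW .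
  define Zi where "Zi = (\<integral>\<^sup>+x. ennreal ((pow_map s e \<kappa> (U x))\<^sup>2) * indicator (cball 0 \<rho>) x \<partial>lebesgue)"
  define c1 where "c1 = 4 * (1 + 2 * s) / lam"
  define c2 where "c2 = (8 * (Lam / lam)\<^sup>2 + 2) * (1 + 2 * s)"
  have "8 * (Lam / lam)\<^sup>2 + 2 > 0" "1 + 2 * s > 0" using s by (auto intro!: add_nonneg_pos)
  then have c: "c1 \<ge> 0" "c2 > 0" using lam unfolding c1_def c2_def by (auto intro: mult_pos_pos)
  have gG: "norm (g x) \<le> G * indicator (cball 0 \<rho>) x" for x
  proof (cases "norm x \<le> \<rho>")
    case True
    interpret bounded_linear "frechet_derivative \<eta> (at x)" by (rule bounded_linear_frechet_derivative[OF \<eta>(1)])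
    have "(norm (g x))\<^sup>2 = (\<Sum>\<alpha>\<in>UNIV. g x $ \<alpha> * frechet_derivative \<eta> (at x) (axis \<alpha> 1))"
      unfolding power2_norm_eq_inner inner_vec_def by (simp add: g_def)
    also have "\<dots> = frechet_derivative \<eta> (at x) (\<Sum>\<alpha>\<in>UNIV. g x $ \<alpha> *\<^sub>R axis \<alpha> 1)"
      by (simp add: sum scaleR)
    also have "(\<Sum>\<alpha>\<in>UNIV. g x $ \<alpha> *\<^sub>R axis \<alpha> 1) = g x"
      using basis_expansion[of "g x"] by (simp only: scalar_mult_eq_scaleR)
    also have "frechet_derivative \<eta> (at x) (g x) \<le> G * norm (g x)" using G(2)[of x "g x"] by simp
    finally have "norm (g x) * norm (g x) \<le> G * norm (g x)" by (simp add: power2_eq_square)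
    then have "norm (g x) \<le> G" using G(1) by (cases "norm (g x) = 0") (auto simp: mult_le_cancel_right)
    with True show ?thesis by simp
  next
    case False
    then have "g x = 0" by (simp add: g_def fd0 vec_eq_iff)
    then show ?thesis using G(1) by (simp add: indicator_def)
  qed
  have pw: "(norm (DW x))\<^sup>2 \<le> c1 * A x + c2 * G\<^sup>2 * ((pow_map s e \<kappa> (U x))\<^sup>2 * indicator (cball 0 \<rho>) x)" for x
  proof -
    have A': "A x = (\<Sum>\<alpha>\<in>UNIV. \<Sum>\<beta>\<in>UNIV. a \<alpha> \<beta> x * (column \<beta> (DU x) \<bullet>
          ((\<eta> x)\<^sup>2 *\<^sub>R test_map_deriv s e \<kappa> (U x) (column \<alpha> (DU x)) + (2 * \<eta> x * g x $ \<alpha>) *\<^sub>R test_map s e \<kappa> (U x))))"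
      unfolding A_def D\<Phi>_def by (simp add: fd2 g_def power2_eq_square)
    have DW': "DW x = of_columns (\<lambda>\<alpha>. \<eta> x *\<^sub>R (pow_map_deriv s e \<kappa> (U x) (column \<alpha> (DU x)) *\<^sub>R b) + g x $ \<alpha> *\<^sub>R (pow_map s e \<kappa> (U x) *\<^sub>R b))"
      unfolding DW_def g_def by simp
    have "(norm (DW x))\<^sup>2 \<le> c1 * A x + c2 * ((pow_map s e \<kappa> (U x))\<^sup>2 * (norm (g x))\<^sup>2)"
      unfolding DW' A' c1_def c2_def
      by (rule energy_pointwise[where a="\<lambda>\<alpha> \<beta>. a \<alpha> \<beta> x", OF ellx bddx lam Lam s e \<kappa> \<eta>(2) b])
    also have "(norm (g x))\<^sup>2 \<le> (G * indicator (cball 0 \<rho>) x)\<^sup>2" by (intro power_mono gG) auto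
    then have "c2 * ((pow_map s e \<kappa> (U x))\<^sup>2 * (norm (g x))\<^sup>2) \<le> c2 * ((pow_map s e \<kappa> (U x))\<^sup>2 * (G * indicator (cball 0 \<rho>) x)\<^sup>2)"
      using c by (intro mult_left_mono) auto
    also have "\<dots> = c2 * G\<^sup>2 * ((pow_map s e \<kappa> (U x))\<^sup>2 * indicator (cball 0 \<rho>) x)"
      by (auto simp: indicator_def)
    finally show ?thesis by simp
  qed
  have Pm[measurable]: "(\<lambda>x. pow_map s e \<kappa> (U x)) \<in> borel_measurable lebesgue"
  proof -
    have "continuous_on UNIV (pow_map s e \<kappa> :: real^'d \<Rightarrow> real)"
      by (intro continuous_at_imp_continuous_on ballI has_derivative_continuous[OF pow_map_has_derivative[OF s e \<kappa>]])
    then show ?thesis by (intro measurable_compose[OF Um] borel_measurable_continuous_onI)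
  qed
  have [measurable]: "cball 0 \<rho> \<in> sets (lebesgue :: (real^'n) measure)" by simp
  \<comment> \<open>the term \<open>A\<close> is signed, so the pointwise inequality is integrated with real values; this requires \<open>Zi\<close> to be finite\<close>
  have DWle: "(\<integral>\<^sup>+x. ennreal ((norm (DW x))\<^sup>2) \<partial>lebesgue) \<le> ennreal c1 * Fi + ennreal (c2 * G\<^sup>2) * Zi"
  proof (cases "Zi = \<infinity>")
    case True
    then show ?thesis using c G by (simp add: ennreal_mult_top)
  next
    case False
    have Zi': "Zi = (\<integral>\<^sup>+x. ennreal ((pow_map s e \<kappa> (U x))\<^sup>2 * indicator (cball 0 \<rho>) x) \<partial>lebesgue)"
      unfolding Zi_def by (intro nn_integral_cong) (auto simp: indicator_def)
    have zi: "integrable lebesgue (\<lambda>x. (pow_map s e \<kappa> (U x))\<^sup>2 * indicator (cball 0 \<rho>) x)"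
    proof (rule integrableI_bounded)
      have "(\<integral>\<^sup>+x. ennreal (norm ((pow_map s e \<kappa> (U x))\<^sup>2 * indicator (cball 0 \<rho>) x)) \<partial>lebesgue) = Zi"
        unfolding Zi' by (intro nn_integral_cong) (auto simp: indicator_def)
      then show "(\<integral>\<^sup>+x. ennreal (norm ((pow_map s e \<kappa> (U x))\<^sup>2 * indicator (cball 0 \<rho>) x)) \<partial>lebesgue) < \<infinity>"
        using False by (simp add: less_top)
    qed measurable
    have Zr: "Zi = ennreal (\<integral>x. (pow_map s e \<kappa> (U x))\<^sup>2 * indicator (cball 0 \<rho>) x \<partial>lebesgue)"
      unfolding Zi' by (rule nn_integral_eq_integral[OF zi]) (auto simp: indicator_def)
    have "(\<integral>\<^sup>+x. ennreal ((norm (DW x))\<^sup>2) \<partial>lebesgue) = ennreal (\<integral>x. (norm (DW x))\<^sup>2 \<partial>lebesgue)"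
      by (rule nn_integral_eq_integral[OF sq_int[OF SW]]) auto
    also have "\<dots> \<le> ennreal (c1 * (\<integral>x. A x \<partial>lebesgue) + c2 * G\<^sup>2 * (\<integral>x. (pow_map s e \<kappa> (U x))\<^sup>2 * indicator (cball 0 \<rho>) x \<partial>lebesgue))"
    proof (rule ennreal_leI)
      have "(\<integral>x. (norm (DW x))\<^sup>2 \<partial>lebesgue) \<le> (\<integral>x. c1 * A x + c2 * G\<^sup>2 * ((pow_map s e \<kappa> (U x))\<^sup>2 * indicator (cball 0 \<rho>) x) \<partial>lebesgue)"
        by (intro integral_mono sq_int[OF SW] Bochner_Integration.integrable_add integrable_mult_right Ai zi pw)
      also have "\<dots> = c1 * (\<integral>x. A x \<partial>lebesgue) + c2 * G\<^sup>2 * (\<integral>x. (pow_map s e \<kappa> (U x))\<^sup>2 * indicator (cball 0 \<rho>) x \<partial>lebesgue)"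
        using Ai zi by simp
      finally show "(\<integral>x. (norm (DW x))\<^sup>2 \<partial>lebesgue) \<le> \<dots>" .
    qed
    also have "\<dots> \<le> ennreal (c1 * (\<integral>x. A x \<partial>lebesgue)) + ennreal (c2 * G\<^sup>2 * (\<integral>x. (pow_map s e \<kappa> (U x))\<^sup>2 * indicator (cball 0 \<rho>) x \<partial>lebesgue))"
      using c by (intro ennreal_add_le mult_nonneg_nonneg integral_nonneg_AE) (auto simp: indicator_def)
    also have "\<dots> = ennreal c1 * ennreal (\<integral>x. A x \<partial>lebesgue) + ennreal (c2 * G\<^sup>2) * Zi"
      unfolding Zr using c by (simp add: ennreal_mult')
    also have "\<dots> \<le> ennreal c1 * Fi + ennreal (c2 * G\<^sup>2) * Zi"
      by (intro add_right_mono mult_left_mono Aint) auto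
    finally show ?thesis .
  qed
  have "epow (\<integral>\<^sup>+x. ennreal (W x powr crit_exp TYPE('n)) \<partial>lebesgue) ((real CARD('n) - 2) / real CARD('n))
      \<le> 16 * (\<integral>\<^sup>+x. ennreal ((norm (DW x))\<^sup>2) \<partial>lebesgue)"
    using smooth_limit_Sobolev(1)[OF n SW] unfolding normW .
  also have "\<dots> \<le> 16 * (ennreal c1 * Fi + ennreal (c2 * G\<^sup>2) * Zi)"
    by (intro mult_left_mono DWle) auto
  finally show "epow (\<integral>\<^sup>+x. ennreal (W x powr crit_exp TYPE('n)) \<partial>lebesgue) ((real CARD('n) - 2) / real CARD('n))
     \<le> 16 * (ennreal (4 * (1 + 2 * s) / lam) * (\<integral>\<^sup>+x. ennreal (norm (f x) / \<kappa> * (W x)\<^sup>2) \<partial>lebesgue)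
         + ennreal ((8 * (Lam / lam)\<^sup>2 + 2) * (1 + 2 * s) * G\<^sup>2) * (\<integral>\<^sup>+x. ennreal ((pow_map s e \<kappa> (U x))\<^sup>2) * indicator (cball 0 \<rho>) x \<partial>lebesgue))"
    unfolding c1_def c2_def Fi_def Zi_def .
qed

lemma Young_powr:
  fixes a b \<theta> :: real
  assumes "a \<ge> 0" "b \<ge> 0" "0 < \<theta>" "\<theta> < 1"
  shows "a powr (1 - \<theta>) * b powr \<theta> \<le> (1 - \<theta>) * a + \<theta> * b"
proof -
  have "(\<Prod>i\<in>(UNIV::bool set). epow (if i then ennreal a else ennreal b) (if i then 1 - \<theta> else \<theta>))
      \<le> (\<Sum>i\<in>(UNIV::bool set). ennreal (if i then 1 - \<theta> else \<theta>) * (if i then ennreal a else ennreal b))"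
    by (rule weighted_arith_geo_mean_ennreal) (use assms in \<open>auto simp: UNIV_bool\<close>)
  then have "ennreal (a powr (1 - \<theta>) * b powr \<theta>) \<le> ennreal ((1 - \<theta>) * a + \<theta> * b)"
    using assms by (simp add: UNIV_bool ennreal_mult[symmetric] ennreal_plus[symmetric] mult.commute add.commute del: ennreal_plus)
  then show ?thesis using assms by (subst (asm) ennreal_le_iff) auto
qed

text \<open>Young's inequality absorbs the smaller power of \<open>x\<close> into the left-hand side.\<close>
lemma absorb_powr:
  fixes x q m K \<theta> :: real
  assumes "x \<ge> 0" "q \<ge> 0" "K > 0" "0 < \<theta>" "\<theta> < 1"
    and x: "x \<le> K * (q powr (1 - \<theta>) * x powr \<theta>) + m"
  shows "x \<le> 2 * (2 * K) powr (1 / (1 - \<theta>)) * q + 2 * m"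
proof -
  define D where "D = (2 * K) powr (1 / (1 - \<theta>))"
  have D: "D \<ge> 0" "D powr (1 - \<theta>) = 2 * K" using assms by (auto simp: D_def powr_powr)
  \<comment> \<open>the factor \<open>2\<close> in \<open>2 K\<close> allows to replace \<open>x\<close> by \<open>x / 2\<close> in Youngs inequality\<close>
  have h: "(1/2) powr \<theta> \<ge> (1/2 :: real)" using assms powr_mono'[of \<theta> 1 "1/2::real"] by simp
  have "K * (q powr (1 - \<theta>) * x powr \<theta>) = (2 * K) * (1/2) * (q powr (1 - \<theta>) * x powr \<theta>)" by simp
  also have "\<dots> \<le> (2 * K) * (1/2) powr \<theta> * (q powr (1 - \<theta>) * x powr \<theta>)"
    using h assms by (intro mult_right_mono mult_left_mono) auto
  also have "\<dots> = (D * q) powr (1 - \<theta>) * (x / 2) powr \<theta>"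
    using assms D by (simp add: powr_mult powr_divide)
  also have "\<dots> \<le> (1 - \<theta>) * (D * q) + \<theta> * (x / 2)"
    using assms D by (intro Young_powr) auto
  also have "\<dots> \<le> 1 * (D * q) + 1 * (x / 2)"
    using assms D by (intro add_mono mult_right_mono) auto
  finally show ?thesis using x unfolding D_def[symmetric] by simp
qed

text \<open>A choice of the constant for cut-off functions, fixed so that later constants can be given by
  formulas that do not involve the solution.\<close>
definition cutoff_const :: "'a::euclidean_space itself \<Rightarrow> real" where
  "cutoff_const _ = (SOME c. c > 0 \<and> (\<forall>r \<rho>. 0 < r \<longrightarrow> r < \<rho> \<longrightarrow> (\<exists>\<eta>::'a \<Rightarrow> real. smooth \<eta> \<and> (\<forall>x. 0 \<le> \<eta> x \<and> \<eta> x \<le> 1) \<and>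
     (\<forall>x. norm x \<le> r \<longrightarrow> \<eta> x = 1) \<and> (\<forall>x. \<rho> \<le> norm x \<longrightarrow> \<eta> x = 0) \<and>
     (\<forall>x v. \<bar>frechet_derivative \<eta> (at x) v\<bar> \<le> c / (\<rho> - r) * norm v))))"

lemma cutoff_const:
  shows "cutoff_const TYPE('a::euclidean_space) > 0"
    and "0 < r \<Longrightarrow> r < \<rho> \<Longrightarrow> \<exists>\<eta>::'a \<Rightarrow> real. smooth \<eta> \<and> (\<forall>x. 0 \<le> \<eta> x \<and> \<eta> x \<le> 1) \<and>
     (\<forall>x. norm x \<le> r \<longrightarrow> \<eta> x = 1) \<and> (\<forall>x. \<rho> \<le> norm x \<longrightarrow> \<eta> x = 0) \<and>
     (\<forall>x v. \<bar>frechet_derivative \<eta> (at x) v\<bar> \<le> cutoff_const TYPE('a) / (\<rho> - r) * norm v)"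
proof -
  have "\<exists>c>0. \<forall>r \<rho>. 0 < r \<longrightarrow> r < \<rho> \<longrightarrow> (\<exists>\<eta>::'a \<Rightarrow> real. smooth \<eta> \<and> (\<forall>x. 0 \<le> \<eta> x \<and> \<eta> x \<le> 1) \<and>
     (\<forall>x. norm x \<le> r \<longrightarrow> \<eta> x = 1) \<and> (\<forall>x. \<rho> \<le> norm x \<longrightarrow> \<eta> x = 0) \<and>
     (\<forall>x v. \<bar>frechet_derivative \<eta> (at x) v\<bar> \<le> c / (\<rho> - r) * norm v))" by (rule cutoff_exists)
  from someI_ex[OF this] show "cutoff_const TYPE('a) > 0" 
    "0 < r \<Longrightarrow> r < \<rho> \<Longrightarrow> \<exists>\<eta>::'a \<Rightarrow> real. smooth \<eta> \<and> (\<forall>x. 0 \<le> \<eta> x \<and> \<eta> x \<le> 1) \<and>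
     (\<forall>x. norm x \<le> r \<longrightarrow> \<eta> x = 1) \<and> (\<forall>x. \<rho> \<le> norm x \<longrightarrow> \<eta> x = 0) \<and>
     (\<forall>x v. \<bar>frechet_derivative \<eta> (at x) v\<bar> \<le> cutoff_const TYPE('a) / (\<rho> - r) * norm v)"
    unfolding cutoff_const_def by blast+
qed

definition moser_const :: "real \<Rightarrow> real \<Rightarrow> real \<Rightarrow> real" where
  "moser_const lam Lam \<sigma> = 2 * (128 / lam) powr \<sigma> + 32 * (8 * (Lam / lam)\<^sup>2 + 2)"

text \<open>The data of the iteration, with the solution replaced by its globally defined representative \<open>U\<close> and
  with \<open>f\<close> extended by zero. The last hypothesis says that \<open>\<kappa>\<close> dominates
  \<open>R\<^bsup>2-n/l\<^esup>\<close> times the norm of \<open>f\<close>; by it the norm of the potential \<open>|f|/\<kappa>\<close> in \<open>L\<^sup>l\<close> is at most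
  \<open>R\<^bsup>n/l-2\<^esup>\<close>, which is the scaling of the equation.\<close>
locale moser =
  fixes U :: "real^'n::finite \<Rightarrow> real^'d::finite" and DU :: "real^'n \<Rightarrow> real^'n^'d" and \<phi>s :: "nat \<Rightarrow> real^'n \<Rightarrow> real^'d"
    and a :: "'n \<Rightarrow> 'n \<Rightarrow> real^'n \<Rightarrow> real" and V :: "real^'n \<Rightarrow> real^'d^'d" and B :: "(real^'n) set"
    and f :: "real^'n \<Rightarrow> real^'d" and lam Lam \<kappa> R l :: real
    and N p ccut :: real
  assumes N_def: "N = real CARD('n)" and p_def: "p = crit_exp TYPE('n)"
    and ccut_def: "ccut = cutoff_const TYPE(real^'n)"
    and n: "CARD('n) \<ge> 3" and U: "smooth_limit U DU \<phi>s"
    and lam: "lam > 0" and Lam: "Lam > 0"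
    and am: "\<And>\<alpha> \<beta>. a \<alpha> \<beta> \<in> borel_measurable lebesgue"
    and ell: "elliptic (\<lambda>x \<alpha> \<beta>. a \<alpha> \<beta> x *\<^sub>R (mat 1 :: real^'d^'d)) lam"
    and bdd: "bounded_form (\<lambda>x \<alpha> \<beta>. a \<alpha> \<beta> x *\<^sub>R (mat 1 :: real^'d^'d)) Lam"
    and V: "matrix_weight V" "V \<in> Lp_loc (N / 2)"
    and B: "open B"
    and f: "f \<in> borel_measurable lebesgue"
    and weak: "\<forall>\<phi> D\<phi>. \<phi> \<in> W12V0 V B \<longrightarrow> has_weak_gradient \<phi> D\<phi> B \<longrightarrow>
          (LINT x:B|lebesgue. (\<Sum>\<alpha>\<in>UNIV. \<Sum>\<beta>\<in>UNIV. a \<alpha> \<beta> x * (column \<beta> (DU x) \<bullet> column \<alpha> (D\<phi> x))))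
          + (LINT x:B|lebesgue. (V x *v U x) \<bullet> \<phi> x) = (LINT x:B|lebesgue. f x \<bullet> \<phi> x)"
    and \<kappa>: "\<kappa> > 0" and R: "R > 0" and l: "l > N / 2"
    and F: "epow (\<integral>\<^sup>+x. ennreal ((norm (f x) / \<kappa>) powr l) \<partial>lebesgue) (1 / l) \<le> ennreal (R powr (- (2 - N / l)))"
begin

definition "\<theta> = N / (2 * l)"
definition "\<sigma> = 1 / (1 - \<theta>)"
definition "\<tau> x = reg_sq \<kappa> (U x)"

lemma N3: "N \<ge> 3" using n by (simp add: N_def)

lemma p2: "p > 2" unfolding p_def by (rule crit_exp_gt_2[OF n])

lemma p_eq: "p = 2 * N / (N - 2)" by (simp add: p_def N_def crit_exp_def)

lemmas energy = Sobolev_energy[OF n U lam Lam am ell bdd V[unfolded N_def] B _ f weak, folded p_def N_def]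

lemma l0: "l > 0" using l N3 by simp

lemma \<theta>: "0 < \<theta>" "\<theta> < 1" "\<theta> - 1 / l > 0" "(N - 2) / N * \<theta> = \<theta> - 1 / l" "p * (\<theta> - 1 / l) = 2 * \<theta>"
proof -
  show "0 < \<theta>" "\<theta> < 1" using l l0 N3 by (auto simp: \<theta>_def divide_less_eq)
  have e: "\<theta> - 1 / l = (N - 2) / (2 * l)" using l0 by (simp add: \<theta>_def field_simps)
  show "\<theta> - 1 / l > 0" unfolding e using l0 N3 by simp
  show "(N - 2) / N * \<theta> = \<theta> - 1 / l" unfolding e using l0 N3 by (simp add: \<theta>_def)
  show "p * (\<theta> - 1 / l) = 2 * \<theta>" unfolding e p_eq using l0 N3 by (simp add: \<theta>_def)
qed

lemma \<sigma>: "\<sigma> \<ge> 1" using \<theta> by (simp add: \<sigma>_def)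

lemma \<tau>_pos: "\<tau> x > 0" unfolding \<tau>_def by (rule reg_sq_pos[OF \<kappa>])

lemma \<tau>_measurable [measurable]: "\<tau> \<in> borel_measurable lebesgue"
  unfolding \<tau>_def[abs_def]
  by (rule measurable_compose[OF smooth_limitD(1)[OF U] borel_measurable_continuous_onI[OF continuous_on_reg_sq]])

text \<open>Let \<open>X\<close> be the left-hand side and \<open>Y\<close> the integral of \<open>W\<^sup>2\<close>. Because \<open>l > n/2\<close>, the exponent
  \<open>\<theta> = n/(2 l)\<close> is less than \<open>1\<close> and Hoelder's inequality with the exponents \<open>1/l\<close>, \<open>1 - \<theta>\<close> and
  \<open>\<theta> - 1/l\<close> bounds the integral of \<open>(|f|/\<kappa>) W\<^sup>2\<close> by \<open>(Y/R\<^sup>2)\<^bsup>1-\<theta>\<^esup> X\<^sup>\<theta>\<close>. The truncation makes \<open>X\<close> finite,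
  so that this term can be absorbed; the price is the power \<open>\<sigma> = 1/(1-\<theta>)\<close> of \<open>1 + 2 s\<close>.\<close>
lemma moser_step_truncated:
  assumes \<rho>: "cball 0 \<rho> \<subseteq> B"
    and \<eta>: "smooth \<eta>" "\<And>x. 0 \<le> \<eta> x" "\<And>x. \<eta> x \<le> 1" and \<eta>0: "\<And>x. norm x \<ge> \<rho> \<Longrightarrow> \<eta> x = 0"
    and G: "G > 0" "\<And>x v. \<bar>frechet_derivative \<eta> (at x) v\<bar> \<le> G * norm v"
    and s: "s \<ge> 0" and e: "e > 0"
  shows "epow (\<integral>\<^sup>+x. ennreal ((\<eta> x * pow_map s e \<kappa> (U x)) powr p) \<partial>lebesgue) ((N - 2) / N)
    \<le> ennreal (moser_const lam Lam \<sigma> * (1 + 2 * s) powr \<sigma> * (1 / R\<^sup>2 + G\<^sup>2))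
       * (\<integral>\<^sup>+x. ennreal (\<tau> x powr (1 + 2 * s)) * indicator (cball 0 \<rho>) x \<partial>lebesgue)"
proof -
  let ?\<gamma> = "1 + 2 * s"
  define W where "W x = \<eta> x * pow_map s e \<kappa> (U x)" for x
  define Ip where "Ip = (\<integral>\<^sup>+x. ennreal (W x powr p) \<partial>lebesgue)"
  define Z0 where "Z0 = (\<integral>\<^sup>+x. ennreal ((pow_map s e \<kappa> (U x))\<^sup>2) * indicator (cball 0 \<rho>) x \<partial>lebesgue)"
  define Z where "Z = (\<integral>\<^sup>+x. ennreal (\<tau> x powr ?\<gamma>) * indicator (cball 0 \<rho>) x \<partial>lebesgue)"
  define Fi where "Fi = (\<integral>\<^sup>+x. ennreal (norm (f x) / \<kappa> * (W x)\<^sup>2) \<partial>lebesgue)"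
  define Y where "Y = (\<integral>\<^sup>+x. ennreal ((W x)\<^sup>2) \<partial>lebesgue)"
  define X where "X = epow Ip ((N - 2) / N)"
  define c2 where "c2 = 8 * (Lam / lam)\<^sup>2 + 2"
  have c2: "c2 > 0" unfolding c2_def by (intro add_nonneg_pos) auto
  have \<gamma>: "?\<gamma> \<ge> 1" using s by simp
  note SE = energy[OF \<rho> \<eta> \<eta>0 G s e \<kappa>, folded W_def]
  have Wm[measurable]: "W \<in> borel_measurable lebesgue" using SE(3) unfolding W_def[abs_def] .
  have W0: "W x \<ge> 0" for x using \<eta>(2) pow_map_pos[OF s e \<kappa>, of "U x"] by (simp add: W_def)
  have main: "X \<le> 16 * (ennreal (4 * ?\<gamma> / lam) * Fi + ennreal (c2 * ?\<gamma> * G\<^sup>2) * Z0)"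
    using SE(1) unfolding X_def Ip_def Fi_def c2_def Z0_def W_def .
  have Ifin: "Ip < \<infinity>" using SE(2) unfolding Ip_def W_def .
  have P2: "(pow_map s e \<kappa> (U x))\<^sup>2 \<le> \<tau> x powr ?\<gamma>" for x
  proof -
    have "(pow_map s e \<kappa> (U x))\<^sup>2 = \<tau> x * trunc (2 * s) e (\<tau> x)" by (simp add: pow_map_sq[OF s e \<kappa>] \<tau>_def)
    also have "\<dots> \<le> \<tau> x * \<tau> x powr (2 * s)"
      using \<tau>_pos[of x] trunc_bound(2)[OF \<tau>_pos e, of "2 * s"] s by (intro mult_left_mono) auto
    also have "\<dots> = \<tau> x powr ?\<gamma>" using \<tau>_pos[of x] by (simp add: powr_add)
    finally show ?thesis .
  qed
  have Z0: "Z0 \<le> Z" unfolding Z0_def Z_def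
    by (intro nn_integral_mono mult_right_mono ennreal_leI P2) auto
  have YZ: "Y \<le> Z" unfolding Y_def Z_def
  proof (intro nn_integral_mono)
    fix x
    show "ennreal ((W x)\<^sup>2) \<le> ennreal (\<tau> x powr ?\<gamma>) * indicator (cball 0 \<rho>) x"
    proof (cases "norm x \<le> \<rho>")
      case True
      have "(W x)\<^sup>2 \<le> 1 * (pow_map s e \<kappa> (U x))\<^sup>2"
        unfolding W_def power_mult_distrib using \<eta>(2,3)[of x] by (intro mult_right_mono) (auto simp: power_le_one)
      with P2[of x] True show ?thesis by (simp add: ennreal_leI)
    next
      case False then show ?thesis using \<eta>0[of x] by (simp add: W_def)
    qed
  qed
  have FiX: "Fi \<le> ennreal (R powr (- (2 - N / l))) * epow Y (1 - \<theta>) * epow X \<theta>"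
  proof -
    have "Fi = (\<integral>\<^sup>+x. epow (ennreal ((norm (f x) / \<kappa>) powr l)) (1 / l) * epow (ennreal ((W x)\<^sup>2)) (1 - \<theta>) * epow (ennreal (W x powr p)) (\<theta> - 1 / l) \<partial>lebesgue)"
      unfolding Fi_def
    proof (intro nn_integral_cong)
      fix x
      have "((W x)\<^sup>2) powr (1 - \<theta>) * W x powr (p * (\<theta> - 1 / l)) = (W x)\<^sup>2"
      proof (cases "W x = 0")
        case False
        then have w: "W x > 0" using W0[of x] by simp
        have "((W x)\<^sup>2) powr (1 - \<theta>) * W x powr (p * (\<theta> - 1 / l)) = W x powr (2 * (1 - \<theta>)) * W x powr (2 * \<theta>)"
          using w by (simp add: \<theta>(5) powr_powr flip: powr_numeral)
        also have "\<dots> = W x powr 2" by (subst powr_add[symmetric]) (simp add: algebra_simps)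
        finally show ?thesis using w by (simp add: powr_numeral)
      qed (use \<theta> in auto)
      then show "ennreal (norm (f x) / \<kappa> * (W x)\<^sup>2) = epow (ennreal ((norm (f x) / \<kappa>) powr l)) (1 / l) * epow (ennreal ((W x)\<^sup>2)) (1 - \<theta>) * epow (ennreal (W x powr p)) (\<theta> - 1 / l)"
        using l0 \<kappa> by (simp add: powr_powr ennreal_mult[symmetric] mult.assoc)
    qed
    also have "\<dots> \<le> epow (\<integral>\<^sup>+x. ennreal ((norm (f x) / \<kappa>) powr l) \<partial>lebesgue) (1 / l) * epow Y (1 - \<theta>) * epow Ip (\<theta> - 1 / l)"
      unfolding Y_def Ip_def by (rule nn_integral_Hoelder3) (use \<theta> l0 f in auto)
    also have "epow Ip (\<theta> - 1 / l) = epow X \<theta>" unfolding X_def epow_epow \<theta>(4) ..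
    also have "epow (\<integral>\<^sup>+x. ennreal ((norm (f x) / \<kappa>) powr l) \<partial>lebesgue) (1 / l) * epow Y (1 - \<theta>) * epow X \<theta>
        \<le> ennreal (R powr (- (2 - N / l))) * epow Y (1 - \<theta>) * epow X \<theta>"
      by (intro mult_right_mono F) auto
    finally show ?thesis .
  qed
  define M where "M = moser_const lam Lam \<sigma> * ?\<gamma> powr \<sigma> * (1 / R\<^sup>2 + G\<^sup>2)"
  have Mpos: "M > 0" unfolding M_def moser_const_def
    using lam s G R by (intro mult_pos_pos add_pos_pos add_nonneg_pos) (auto simp: add_nonneg_pos intro!: add_pos_pos mult_pos_pos)
  have "X \<le> ennreal M * Z"
  proof (cases "Z = \<infinity>")
    case True then show ?thesis using Mpos by (simp add: ennreal_mult_top)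
  next
    case False
    obtain z where z: "Z = ennreal z" "z \<ge> 0" using False by (cases Z) auto
    obtain y where y: "Y = ennreal y" "y \<ge> 0" using YZ z by (cases Y) (auto simp: top_unique)
    obtain z0 where z0: "Z0 = ennreal z0" "z0 \<ge> 0" using Z0 z by (cases Z0) (auto simp: top_unique)
    have yz: "y \<le> z" "z0 \<le> z" using YZ Z0 y z z0 by (auto simp: ennreal_le_iff)
    have "X < \<infinity>" unfolding X_def using Ifin by (simp add: epow_less_top)
    then obtain x where x: "X = ennreal x" "x \<ge> 0" by (cases X) auto
    have Rp: "R powr (- (2 - N / l)) = (1 / R\<^sup>2) powr (1 - \<theta>)"
    proof -
      have "1 / R\<^sup>2 = R powr (- 2)" using R by (simp add: powr_minus_divide powr_numeral)
      moreover have "- (2 - N / l) = - 2 * (1 - \<theta>)" using l0 by (simp add: \<theta>_def field_simps)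
      ultimately show ?thesis by (simp only: powr_powr)
    qed
    define K where "K = 64 * ?\<gamma> / lam"
    have "X \<le> 16 * (ennreal (4 * ?\<gamma> / lam) * (ennreal (R powr (- (2 - N / l))) * epow Y (1 - \<theta>) * epow X \<theta>) + ennreal (c2 * ?\<gamma> * G\<^sup>2) * Z0)"
      by (intro order_trans[OF main] mult_left_mono add_right_mono FiX) auto
    also have "\<dots> = ennreal 16 * (ennreal (4 * ?\<gamma> / lam) * (ennreal (R powr (- (2 - N / l))) * ennreal (y powr (1 - \<theta>)) * ennreal (x powr \<theta>)) + ennreal (c2 * ?\<gamma> * G\<^sup>2) * ennreal z0)"
      by (simp add: x y z0)
    also have "\<dots> = ennreal (16 * (4 * ?\<gamma> / lam * (R powr (- (2 - N / l)) * y powr (1 - \<theta>) * x powr \<theta>) + c2 * ?\<gamma> * G\<^sup>2 * z0))"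
      using s lam c2 z0(2) x(2) y(2)
      by (simp only: ennreal_mult[symmetric] ennreal_plus[symmetric] powr_ge_zero mult_nonneg_nonneg zero_le_power2 divide_nonneg_pos
          add_nonneg_nonneg zero_le_numeral zero_le_one less_imp_le)
    finally have "x \<le> 16 * (4 * ?\<gamma> / lam * (R powr (- (2 - N / l)) * y powr (1 - \<theta>) * x powr \<theta>) + c2 * ?\<gamma> * G\<^sup>2 * z0)"
      unfolding x(1) by (subst (asm) ennreal_le_iff) (use s lam c2 z0 in auto)
    also have "\<dots> = K * ((y / R\<^sup>2) powr (1 - \<theta>) * x powr \<theta>) + 16 * c2 * ?\<gamma> * G\<^sup>2 * z0"
    proof -
      have "R powr (- (2 - N / l)) * y powr (1 - \<theta>) = (y / R\<^sup>2) powr (1 - \<theta>)"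
        unfolding Rp using y R by (simp add: powr_mult[symmetric])
      then have "R powr (- (2 - N / l)) * y powr (1 - \<theta>) * x powr \<theta> = (y / R\<^sup>2) powr (1 - \<theta>) * x powr \<theta>" by simp
      then show ?thesis unfolding K_def by (simp only:) (simp add: algebra_simps)
    qed
    finally have "x \<le> 2 * (2 * K) powr (1 / (1 - \<theta>)) * (y / R\<^sup>2) + 2 * (16 * c2 * ?\<gamma> * G\<^sup>2 * z0)"
      using x y \<theta> s lam by (intro absorb_powr) (auto simp: K_def)
    also have "(2 * K) powr (1 / (1 - \<theta>)) = (128 / lam) powr \<sigma> * ?\<gamma> powr \<sigma>"
      using s lam by (subst powr_mult[symmetric]) (auto simp: K_def \<sigma>_def)
    also have "2 * ((128 / lam) powr \<sigma> * ?\<gamma> powr \<sigma>) * (y / R\<^sup>2) + 2 * (16 * c2 * ?\<gamma> * G\<^sup>2 * z0)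
       \<le> 2 * ((128 / lam) powr \<sigma> * ?\<gamma> powr \<sigma>) * (z / R\<^sup>2) + 2 * (16 * c2 * ?\<gamma> powr \<sigma> * G\<^sup>2 * z)"
    proof -
      have "?\<gamma> powr 1 \<le> ?\<gamma> powr \<sigma>" using \<gamma> \<sigma> by (intro powr_mono) auto
      then have "?\<gamma> \<le> ?\<gamma> powr \<sigma>" using s by simp
      then show ?thesis
        using yz c2 z0 z s R by (intro add_mono mult_mono mult_left_mono divide_right_mono) auto
    qed
    also have "\<dots> = ((2 * (128 / lam) powr \<sigma>) * (1 / R\<^sup>2) + (32 * c2) * G\<^sup>2) * (?\<gamma> powr \<sigma> * z)"
      by (simp add: algebra_simps)
    also have "\<dots> \<le> (moser_const lam Lam \<sigma> * (1 / R\<^sup>2 + G\<^sup>2)) * (?\<gamma> powr \<sigma> * z)"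
    proof (intro mult_right_mono)
      have "(2 * (128 / lam) powr \<sigma>) * (1 / R\<^sup>2) + (32 * c2) * G\<^sup>2 \<le> moser_const lam Lam \<sigma> * (1 / R\<^sup>2) + moser_const lam Lam \<sigma> * G\<^sup>2"
        using c2 lam by (intro add_mono mult_right_mono) (auto simp: moser_const_def c2_def)
      then show "(2 * (128 / lam) powr \<sigma>) * (1 / R\<^sup>2) + (32 * c2) * G\<^sup>2 \<le> moser_const lam Lam \<sigma> * (1 / R\<^sup>2 + G\<^sup>2)"
        by (simp add: distrib_left)
    qed (use z in auto)
    also have "\<dots> = M * z" by (simp add: M_def mult_ac)
    finally have "x \<le> M * z" .
    then show ?thesis using x z Mpos by (simp add: ennreal_mult[symmetric] ennreal_leI)
  qed
  then show ?thesis unfolding X_def Ip_def W_def M_def Z_def .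
qed

text \<open>The truncation is removed by Fatou's lemma on the left-hand side; the right-hand side already bounds
  all truncated powers.\<close>
lemma moser_step:
  assumes \<rho>: "cball 0 \<rho> \<subseteq> B"
    and \<eta>: "smooth \<eta>" "\<And>x. 0 \<le> \<eta> x" "\<And>x. \<eta> x \<le> 1" and \<eta>0: "\<And>x. norm x \<ge> \<rho> \<Longrightarrow> \<eta> x = 0"
    and G: "G > 0" "\<And>x v. \<bar>frechet_derivative \<eta> (at x) v\<bar> \<le> G * norm v"
    and \<gamma>: "\<gamma> \<ge> 1"
  shows "epow (\<integral>\<^sup>+x. ennreal ((\<eta> x * \<tau> x powr (\<gamma> / 2)) powr p) \<partial>lebesgue) ((N - 2) / N)
    \<le> ennreal (moser_const lam Lam \<sigma> * \<gamma> powr \<sigma> * (1 / R\<^sup>2 + G\<^sup>2))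
       * (\<integral>\<^sup>+x. ennreal (\<tau> x powr \<gamma>) * indicator (cball 0 \<rho>) x \<partial>lebesgue)"
proof -
  define s where "s = (\<gamma> - 1) / 2"
  have s: "s \<ge> 0" "1 + 2 * s = \<gamma>" "1/2 + s = \<gamma> / 2" using \<gamma> by (auto simp: s_def field_simps)
  define e where "e j = inverse (real (Suc j))" for j
  have e: "e j > 0" for j by (simp add: e_def)
  let ?t = "(N - 2) / N"
  have t: "?t > 0" using N3 by simp
  define Z where "Z = ennreal (moser_const lam Lam \<sigma> * \<gamma> powr \<sigma> * (1 / R\<^sup>2 + G\<^sup>2))
       * (\<integral>\<^sup>+x. ennreal (\<tau> x powr \<gamma>) * indicator (cball 0 \<rho>) x \<partial>lebesgue)"
  define w where "w j x = \<eta> x * pow_map s (e j) \<kappa> (U x)" for j x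
  have st: "epow (\<integral>\<^sup>+x. ennreal (w j x powr p) \<partial>lebesgue) ?t \<le> Z" for j
    using moser_step_truncated[OF \<rho> \<eta> \<eta>0 G s(1) e] unfolding s(2) w_def Z_def .
  have wm: "w j \<in> borel_measurable lebesgue" for j
    unfolding w_def[abs_def] by (rule energy(3)[OF \<rho> \<eta> \<eta>0 G s(1) e \<kappa>])
  have st': "(\<integral>\<^sup>+x. ennreal (w j x powr p) \<partial>lebesgue) \<le> epow Z (1 / ?t)" for j
  proof -
    have "(\<integral>\<^sup>+x. ennreal (w j x powr p) \<partial>lebesgue) = epow (epow (\<integral>\<^sup>+x. ennreal (w j x powr p) \<partial>lebesgue) ?t) (1 / ?t)"
      using t N3 by (simp add: epow_epow)
    also have "\<dots> \<le> epow Z (1 / ?t)" using N3 by (intro epow_mono st) auto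
    finally show ?thesis .
  qed
  have lim: "(\<lambda>j. ennreal (w j x powr p)) \<longlonglongrightarrow> ennreal ((\<eta> x * \<tau> x powr (\<gamma> / 2)) powr p)" for x
  proof -
    have "(\<lambda>j. \<eta> x * (\<tau> x powr (1/2) * trunc s (e j) (\<tau> x))) \<longlonglongrightarrow> \<eta> x * (\<tau> x powr (1/2) * \<tau> x powr s)"
      unfolding e_def by (intro tendsto_mult tendsto_const trunc_tendsto \<tau>_pos)
    moreover have "\<eta> x * (\<tau> x powr (1/2) * trunc s (e j) (\<tau> x)) = w j x" for j
      unfolding w_def pow_map_eq[OF s(1) e \<kappa>] \<tau>_def ..
    moreover have "\<tau> x powr (1/2) * \<tau> x powr s = \<tau> x powr (\<gamma> / 2)" by (simp only: powr_add[symmetric] s(3))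
    ultimately have "(\<lambda>j. w j x) \<longlonglongrightarrow> \<eta> x * \<tau> x powr (\<gamma> / 2)" by simp
    then show ?thesis using p2 \<eta>(2)[of x] pow_map_pos[OF s(1) e \<kappa>, where y="U x"]
      by (intro tendsto_ennrealI tendsto_powr' tendsto_const) (auto simp: w_def less_imp_le)
  qed
  have "(\<integral>\<^sup>+x. ennreal ((\<eta> x * \<tau> x powr (\<gamma> / 2)) powr p) \<partial>lebesgue) = (\<integral>\<^sup>+x. liminf (\<lambda>j. ennreal (w j x powr p)) \<partial>lebesgue)"
    by (intro nn_integral_cong) (rule lim_imp_Liminf[OF sequentially_bot lim, symmetric])
  also have "\<dots> \<le> liminf (\<lambda>j. \<integral>\<^sup>+x. ennreal (w j x powr p) \<partial>lebesgue)"
    using wm by (intro nn_integral_liminf) measurable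
  also have "\<dots> \<le> liminf (\<lambda>j::nat. epow Z (1 / ?t))"
    by (intro Liminf_mono always_eventually allI st')
  also have "\<dots> = epow Z (1 / ?t)" by (simp add: Liminf_const)
  finally have "epow (\<integral>\<^sup>+x. ennreal ((\<eta> x * \<tau> x powr (\<gamma> / 2)) powr p) \<partial>lebesgue) ?t \<le> epow (epow Z (1 / ?t)) ?t"
    using t by (intro epow_mono) auto
  also have "\<dots> = Z" using t N3 by (simp add: epow_epow)
  finally show ?thesis unfolding Z_def .
qed

definition "chi = N / (N - 2)"
definition "ball_const = moser_const lam Lam \<sigma> * (4 + ccut\<^sup>2)"

lemma chi: "chi > 1" "1 / chi = (N - 2) / N" "p / 2 = chi" unfolding chi_def p_eq using N3 by (auto simp: divide_simps)

text \<open>One step of the iteration: the exponent grows by the factor \<open>n/(n-2)\<close>, at the price of the constant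
  \<open>(\<rho> - r)\<^bsup>-2\<^esup>\<close> from the gradient of the cut-off function. It dominates \<open>R\<^bsup>-2\<^esup>\<close> since
  \<open>\<rho> - r \<le> 2 R\<close>.\<close>
lemma moser_step_balls:
  assumes r: "0 < r" "r < \<rho>" "\<rho> - r \<le> 2 * R" and \<rho>: "cball 0 \<rho> \<subseteq> B" and \<gamma>: "\<gamma> \<ge> 1"
  shows "epow (\<integral>\<^sup>+x. ennreal (\<tau> x powr (\<gamma> * chi)) * indicator (cball 0 r) x \<partial>lebesgue) (1 / chi)
    \<le> ennreal (ball_const * \<gamma> powr \<sigma> / (\<rho> - r)\<^sup>2) * (\<integral>\<^sup>+x. ennreal (\<tau> x powr \<gamma>) * indicator (cball 0 \<rho>) x \<partial>lebesgue)"
proof -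
  let ?c = ccut
  obtain \<eta> :: "real^'n \<Rightarrow> real" where \<eta>: "smooth \<eta>" "\<And>x. 0 \<le> \<eta> x" "\<And>x. \<eta> x \<le> 1" "\<And>x. norm x \<le> r \<Longrightarrow> \<eta> x = 1"
    "\<And>x. \<rho> \<le> norm x \<Longrightarrow> \<eta> x = 0" "\<And>x v. \<bar>frechet_derivative \<eta> (at x) v\<bar> \<le> ?c / (\<rho> - r) * norm v"
    using cutoff_const(2)[OF r(1,2), where 'a="real^'n"] unfolding ccut_def by blast
  have G: "?c / (\<rho> - r) > 0" using r cutoff_const(1)[where 'a="real^'n"] by (simp add: ccut_def)
  have mc: "moser_const lam Lam \<sigma> \<ge> 0" unfolding moser_const_def by (intro add_nonneg_nonneg mult_nonneg_nonneg) auto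
  have "epow (\<integral>\<^sup>+x. ennreal (\<tau> x powr (\<gamma> * chi)) * indicator (cball 0 r) x \<partial>lebesgue) (1 / chi)
     \<le> epow (\<integral>\<^sup>+x. ennreal ((\<eta> x * \<tau> x powr (\<gamma> / 2)) powr p) \<partial>lebesgue) (1 / chi)"
  proof (intro epow_mono nn_integral_mono)
    fix x
    show "ennreal (\<tau> x powr (\<gamma> * chi)) * indicator (cball 0 r) x \<le> ennreal ((\<eta> x * \<tau> x powr (\<gamma> / 2)) powr p)"
    proof (cases "norm x \<le> r")
      case True
      have "(\<tau> x powr (\<gamma> / 2)) powr p = \<tau> x powr (\<gamma> * chi)"
        unfolding powr_powr chi(3)[symmetric] by simp
      with True show ?thesis by (simp add: \<eta>(4))
    qed simp
  qed (use chi(1) in simp)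
  also have "\<dots> \<le> ennreal (moser_const lam Lam \<sigma> * \<gamma> powr \<sigma> * (1 / R\<^sup>2 + (?c / (\<rho> - r))\<^sup>2))
       * (\<integral>\<^sup>+x. ennreal (\<tau> x powr \<gamma>) * indicator (cball 0 \<rho>) x \<partial>lebesgue)"
    unfolding chi(2) by (rule moser_step[OF \<rho> \<eta>(1,2,3,5) G \<eta>(6) \<gamma>])
  also have "\<dots> \<le> ennreal (ball_const * \<gamma> powr \<sigma> / (\<rho> - r)\<^sup>2) * (\<integral>\<^sup>+x. ennreal (\<tau> x powr \<gamma>) * indicator (cball 0 \<rho>) x \<partial>lebesgue)"
  proof (intro mult_right_mono ennreal_leI)
    have "(\<rho> - r)\<^sup>2 \<le> (2 * R)\<^sup>2" using r by (intro power_mono) auto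
    then have "1 / R\<^sup>2 \<le> 4 / (\<rho> - r)\<^sup>2" using r R by (simp add: field_simps)
    then have "1 / R\<^sup>2 + (?c / (\<rho> - r))\<^sup>2 \<le> (4 + ?c\<^sup>2) / (\<rho> - r)\<^sup>2" by (simp add: power_divide add_divide_distrib)
    then have "moser_const lam Lam \<sigma> * \<gamma> powr \<sigma> * (1 / R\<^sup>2 + (?c / (\<rho> - r))\<^sup>2) \<le> moser_const lam Lam \<sigma> * \<gamma> powr \<sigma> * ((4 + ?c\<^sup>2) / (\<rho> - r)\<^sup>2)"
      using mc by (intro mult_left_mono) auto
    then show "moser_const lam Lam \<sigma> * \<gamma> powr \<sigma> * (1 / R\<^sup>2 + (?c / (\<rho> - r))\<^sup>2) \<le> ball_const * \<gamma> powr \<sigma> / (\<rho> - r)\<^sup>2"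
      by (simp add: ball_const_def mult_ac)
  qed simp
  finally show ?thesis .
qed

end

section \<open>Iteration and local boundedness\<close>

text \<open>If \<open>g\<close> exceeded \<open>m\<close> by a fixed factor on a set of positive measure, its powers would grow faster
  than the bounds allow.\<close>
lemma AE_le_of_power_bounds:
  fixes g :: "'a \<Rightarrow> real"
  assumes g[measurable]: "g \<in> borel_measurable M" and S[measurable]: "S \<in> sets M"
    and M: "m > 0" and q: "filterlim q at_top sequentially" "\<And>k. q k > 0"
    and b: "\<And>k. (\<integral>\<^sup>+x. ennreal (g x powr q k) * indicator S x \<partial>M) \<le> ennreal (c * m powr q k)"
  shows "AE x in M. x \<in> S \<longrightarrow> g x \<le> m"
proof -
  have "AE x in M. x \<in> S \<longrightarrow> g x \<le> m * (1 + 1 / real (Suc j))" for j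
  proof -
    define d where "d = 1 + 1 / real (Suc j)"
    have d: "d > 1" by (simp add: d_def)
    define E where "E = {x \<in> space M. x \<in> S \<and> g x > m * d}"
    have E[measurable]: "E \<in> sets M" unfolding E_def by measurable
    have le: "emeasure M E \<le> ennreal (\<bar>c\<bar> / d powr q k)" for k
    proof -
      have "ennreal ((m * d) powr q k) * emeasure M E = (\<integral>\<^sup>+x. ennreal ((m * d) powr q k) * indicator E x \<partial>M)"
        by (simp add: nn_integral_cmult_indicator)
      also have "\<dots> \<le> (\<integral>\<^sup>+x. ennreal (g x powr q k) * indicator S x \<partial>M)"
      proof (intro nn_integral_mono)
        fix x
        have "(m * d) powr q k \<le> g x powr q k" if "x \<in> E"
          using that M d q(2)[of k] by (intro powr_mono2) (auto simp: E_def less_imp_le)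
        then show "ennreal ((m * d) powr q k) * indicator E x \<le> ennreal (g x powr q k) * indicator S x"
          by (auto simp: indicator_def E_def intro!: ennreal_leI)
      qed
      also have "\<dots> \<le> ennreal (c * m powr q k)" by (rule b)
      also have "\<dots> \<le> ennreal (\<bar>c\<bar> * m powr q k)" by (intro ennreal_leI mult_right_mono) auto
      finally have *: "ennreal ((m * d) powr q k) * emeasure M E \<le> ennreal (\<bar>c\<bar> * m powr q k)" .
      have md: "(m * d) powr q k > 0" using M d by simp
      obtain v where v: "emeasure M E = ennreal v" "v \<ge> 0"
        using * md by (cases "emeasure M E") (auto simp: ennreal_mult_top top_unique)
      have "(m * d) powr q k * v \<le> \<bar>c\<bar> * m powr q k"
        using * v by (simp add: ennreal_mult[symmetric] ennreal_le_iff)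
      then have "v \<le> \<bar>c\<bar> / d powr q k" using M d by (simp add: powr_mult field_simps)
      then show ?thesis using v by (simp add: ennreal_leI)
    qed
    have "(\<lambda>k. \<bar>c\<bar> * d powr (- q k)) \<longlonglongrightarrow> \<bar>c\<bar> * 0"
    proof (intro tendsto_mult tendsto_const)
      have "filterlim (\<lambda>k. ln d * q k) at_top sequentially"
        using d by (intro filterlim_tendsto_pos_mult_at_top[OF tendsto_const _ q(1)]) auto
      then have "filterlim (\<lambda>k. - (ln d * q k)) at_bot sequentially" by (simp add: filterlim_uminus_at_top)
      then have "(\<lambda>k. exp (- (ln d * q k))) \<longlonglongrightarrow> 0" by (rule filterlim_compose[OF exp_at_bot])
      then show "(\<lambda>k. d powr (- q k)) \<longlonglongrightarrow> 0" using d by (simp add: powr_def mult.commute)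
    qed
    then have "(\<lambda>k. ennreal (\<bar>c\<bar> / d powr q k)) \<longlonglongrightarrow> ennreal 0"
      by (intro tendsto_ennrealI) (simp add: powr_minus_divide)
    then have "emeasure M E \<le> ennreal 0" by (rule LIMSEQ_le_const) (use le in auto)
    then have "E \<in> null_sets M" by (simp add: null_sets_def)
    then have "AE x in M. x \<notin> E" by (rule AE_not_in)
    then show ?thesis using AE_space by eventually_elim (auto simp: E_def d_def not_less)
  qed
  then have "AE x in M. \<forall>j. x \<in> S \<longrightarrow> g x \<le> m * (1 + 1 / real (Suc j))"
    by (intro AE_all_countable[THEN iffD2] allI)
  then show ?thesis
  proof eventually_elim
    case (elim x)
    show ?case
    proof
      assume "x \<in> S"
      have "(\<lambda>j. m * (1 + inverse (real (Suc j)))) \<longlonglongrightarrow> m * (1 + 0)"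
        by (intro tendsto_intros LIMSEQ_inverse_real_of_nat)
      then have "(\<lambda>j. m * (1 + 1 / real (Suc j))) \<longlonglongrightarrow> m" by (simp add: inverse_eq_divide)
      then show "g x \<le> m" by (rule LIMSEQ_le_const) (use elim \<open>x \<in> S\<close> in auto)
    qed
  qed
qed

text \<open>The infinite product of the constants \<open>(D b\<^sup>k)\<^bsup>1/q^k\<^esup>\<close> of the single steps.\<close>
definition iteration_const :: "real \<Rightarrow> real \<Rightarrow> real \<Rightarrow> real" where
  "iteration_const D b q = exp (\<Sum>k. q powr (- real k) * (ln D + real k * ln b))"

lemma iteration_bound:
  fixes m :: "nat \<Rightarrow> real"
  assumes q: "q > 1" and D: "D \<ge> 1" "b \<ge> 1" and m0: "m 0 \<ge> 0"
    and m: "\<And>k. m (Suc k) = (D * b powr real k) powr (q powr (- real k)) * m k"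
  shows "m k \<le> iteration_const D b q * m 0"
proof -
  define c where "c k = q powr (- real k) * (ln D + real k * ln b)" for k
  have c0: "c k \<ge> 0" for k using D by (simp add: c_def)
  have qk: "q powr (- real k) = (1 / q) ^ k" for k
    using q by (simp add: powr_minus_divide powr_realpow power_divide)
  have "summable c"
  proof -
    have "norm (1 / q) < 1" using q by simp
    then have s1: "summable (\<lambda>k. (1 / q) ^ k)" and s2: "summable (\<lambda>k. of_nat (Suc k) * (1 / q) ^ k)"
      using summable_geometric geometric_deriv_sums sums_summable by blast+
    from summable_diff[OF s2 s1] have s3: "summable (\<lambda>k. real k * (1 / q) ^ k)"
      by (simp add: algebra_simps)
    have "summable (\<lambda>k. ln D * (1 / q) ^ k + ln b * (real k * (1 / q) ^ k))"
      by (intro summable_add summable_mult s1 s3)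
    moreover have "(\<lambda>k. ln D * (1 / q) ^ k + ln b * (real k * (1 / q) ^ k)) = c"
      by (simp add: c_def qk fun_eq_iff algebra_simps)
    ultimately show ?thesis by simp
  qed
  have "m k = exp (\<Sum>j<k. c j) * m 0"
  proof (induction k)
    case (Suc k)
    have "(D * b powr real k) powr (q powr (- real k)) = exp (c k)"
      using D by (simp add: powr_def[of "D * b powr real k"] c_def ln_mult ln_powr)
    with Suc show ?case by (simp add: m exp_add)
  qed simp
  also have "\<dots> \<le> exp (suminf c) * m 0"
    using sum_le_suminf[OF \<open>summable c\<close>, of "{..<k}"] c0 m0 by (intro mult_right_mono) auto
  finally show ?thesis by (simp add: iteration_const_def c_def[abs_def])
qed

lemma iteration_const_pos: "iteration_const D b q > 0" by (simp add: iteration_const_def)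

context moser
begin

definition "it_const = iteration_const (max 1 (4 * ball_const)) (4 * chi powr \<sigma>) chi"

text \<open>The exponents \<open>(n/(n-2))\<^sup>k\<close> are reached on balls whose radii decrease geometrically from \<open>\<rho>\<close> to \<open>r\<close>.
  After normalisation by \<open>(\<rho> - r)\<^sup>n\<close>, upper bounds \<open>m\<^sub>k\<close> for the norms of \<open>\<tau>\<close> satisfy the recursion of \<open>iteration_bound\<close>, since
  \<open>(n - 2) n/(n-2) = n\<close> makes all powers of \<open>\<rho> - r\<close> cancel.\<close>
lemma local_boundedness_L2:
  assumes r: "0 < r" "r < \<rho>" "\<rho> - r \<le> 2 * R" and \<rho>: "cball 0 \<rho> \<subseteq> B"
    and m0: "m0 > 0" "(\<integral>\<^sup>+x. ennreal (\<tau> x) * indicator (cball 0 \<rho>) x \<partial>lebesgue) \<le> ennreal ((\<rho> - r) powr N * m0)"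
  shows "AE x in lebesgue. x \<in> cball 0 r \<longrightarrow> \<tau> x \<le> it_const * m0"
proof -
  define \<delta> where "\<delta> = \<rho> - r"
  have \<delta>: "\<delta> > 0" "\<delta> \<le> 2 * R" using r by (auto simp: \<delta>_def)
  define rr where "rr k = r + \<delta> / 2 ^ k" for k :: nat
  define D where "D = max 1 (4 * ball_const)"
  define b where "b = 4 * chi powr \<sigma>"
  \<comment> \<open>the \<open>k\<close>-th step has \<open>\<gamma> = chi\<^sup>k\<close> and radii at distance \<open>\<delta> / 2\<^bsup>k+1\<^esup>\<close>, hence the constant \<open>D b\<^sup>k / \<delta>\<^sup>2\<close>\<close>
  define m where "m = rec_nat m0 (\<lambda>k y. (D * b powr real k) powr (chi powr (- real k)) * y)"
  have m: "m 0 = m0" "\<And>k. m (Suc k) = (D * b powr real k) powr (chi powr (- real k)) * m k"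
    by (auto simp: m_def)
  have D: "D \<ge> 1" "4 * ball_const \<le> D" by (auto simp: D_def)
  have "1 \<le> chi powr \<sigma>" using chi(1) \<sigma> by (simp add: ge_one_powr_ge_zero)
  then have b: "b \<ge> 1" "b > 0" by (auto simp: b_def)
  have mpos: "m k > 0" for k
    using D b m0 by (induction k) (auto simp: m intro!: mult_pos_pos)
  have mle: "m k \<le> it_const * m0" for k
    using iteration_bound[of chi D b m k] chi(1) D b m m0 by (simp add: it_const_def D_def b_def)
  have rr: "rr k > r" "rr (Suc k) < rr k" "rr k - rr (Suc k) = \<delta> / 2 ^ Suc k" "rr k \<le> \<rho>" for k
  proof -
    show "rr k > r" using \<delta> by (simp add: rr_def)
    show "rr (Suc k) < rr k" using \<delta> by (simp add: rr_def field_simps)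
    show "rr k - rr (Suc k) = \<delta> / 2 ^ Suc k" by (simp add: rr_def field_simps)
    have "\<delta> / 2 ^ k \<le> \<delta> / 1" using \<delta> by (intro divide_left_mono) auto
    then show "rr k \<le> \<rho>" by (simp add: rr_def \<delta>_def)
  qed
  define q where "q k = chi powr real k" for k :: nat
  have q1: "q k \<ge> 1" for k using chi(1) by (simp add: q_def ge_one_powr_ge_zero)
  have qS: "q (Suc k) = q k * chi" for k using chi(1) by (simp add: q_def powr_add)
  define J where "J k = (\<integral>\<^sup>+x. ennreal (\<tau> x powr q k) * indicator (cball 0 (rr k)) x \<partial>lebesgue)" for k
  have Jle: "J k \<le> ennreal (\<delta> powr N * m k powr q k)" for k
  proof (induction k)
    case 0
    have "J 0 = (\<integral>\<^sup>+x. ennreal (\<tau> x) * indicator (cball 0 \<rho>) x \<partial>lebesgue)"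
      unfolding J_def using chi(1) \<tau>_pos by (intro nn_integral_cong) (simp add: q_def rr_def \<delta>_def less_imp_le)
    then show ?case using m0 chi(1) by (simp add: m q_def \<delta>_def)
  next
    case (Suc k)
    have c: "cball 0 (rr k) \<subseteq> B" using \<rho> rr(4)[of k] subset_cball[of "rr k" \<rho> "0::real^'n"] by blast
    have "rr k - rr (Suc k) \<le> \<delta> / 1" unfolding rr(3) using \<delta> one_le_power[of "2::real" "Suc k"] by (intro divide_left_mono) auto
    then have d2: "rr k - rr (Suc k) \<le> 2 * R" using \<delta> by simp
    have "0 < rr (Suc k)" using rr(1)[of "Suc k"] r by simp
    from moser_step_balls[OF this rr(2) d2 c q1]
    have "epow (J (Suc k)) (1 / chi) \<le> ennreal (ball_const * q k powr \<sigma> / (\<delta> / 2 ^ Suc k)\<^sup>2) * J k"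
      unfolding J_def qS rr(3) .
    also have "\<dots> \<le> ennreal (D * b powr real k / \<delta>\<^sup>2) * ennreal (\<delta> powr N * m k powr q k)"
    proof (intro mult_mono ennreal_leI Suc.IH)
      have "ball_const * q k powr \<sigma> / (\<delta> / 2 ^ Suc k)\<^sup>2 = (4 * ball_const) * (4 ^ k * q k powr \<sigma>) / \<delta>\<^sup>2"
        by (simp add: power_divide power_mult_distrib power_mult[symmetric] power2_eq_square power_mult_distrib[symmetric] field_simps)
      also have "4 ^ k * q k powr \<sigma> = b powr real k"
      proof -
        have "b powr real k = 4 powr real k * (chi powr \<sigma>) powr real k"
          unfolding b_def by (rule powr_mult)
        moreover have "(chi powr \<sigma>) powr real k = q k powr \<sigma>" unfolding q_def powr_powr by (simp only: mult.commute)
        moreover have "4 powr real k = (4::real) ^ k" by (rule powr_realpow) simp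
        ultimately show ?thesis by (simp only:)
      qed
      finally show "ball_const * q k powr \<sigma> / (\<delta> / 2 ^ Suc k)\<^sup>2 \<le> D * b powr real k / \<delta>\<^sup>2"
        using D by (simp add: divide_right_mono mult_right_mono)
    qed auto
    also have "\<dots> = ennreal (D * b powr real k * m k powr q k * \<delta> powr (N - 2))"
      using D \<delta> by (simp add: ennreal_mult[symmetric] powr_diff powr_numeral mult_ac)
    finally have "epow (epow (J (Suc k)) (1 / chi)) chi \<le> epow (ennreal (D * b powr real k * m k powr q k * \<delta> powr (N - 2))) chi"
      using chi(1) by (intro epow_mono) auto
    then have "J (Suc k) \<le> ennreal ((D * b powr real k * m k powr q k * \<delta> powr (N - 2)) powr chi)"
      using chi(1) D by (simp add: epow_epow)
    also have "(D * b powr real k * m k powr q k * \<delta> powr (N - 2)) powr chi = \<delta> powr N * m (Suc k) powr q (Suc k)"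
    proof -
      have 1: "(N - 2) * chi = N" using N3 by (simp add: chi_def)
      have "chi powr (- real k) * q k = 1"
        unfolding q_def powr_add[symmetric] using chi(1) by simp
      then have 2: "chi powr (- real k) * q (Suc k) = chi" by (simp add: qS mult.assoc[symmetric])
      have "m (Suc k) powr q (Suc k) = (D * b powr real k) powr (chi powr (- real k) * q (Suc k)) * m k powr q (Suc k)"
        by (simp only: m powr_mult powr_powr mult.assoc)
      then have "m (Suc k) powr q (Suc k) = (D * b powr real k) powr chi * m k powr q (Suc k)" unfolding 2 .
      moreover have "(D * b powr real k * m k powr q k * \<delta> powr (N - 2)) powr chi = (D * b powr real k) powr chi * m k powr q (Suc k) * \<delta> powr ((N - 2) * chi)"
        by (simp only: powr_mult powr_powr mult.assoc qS)
      ultimately show ?thesis unfolding 1 by simp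
    qed
    finally show ?case .
  qed
  have K: "it_const * m0 > 0" using m0 by (simp add: it_const_def iteration_const_pos)
  show ?thesis
  proof (rule AE_le_of_power_bounds[where q=q and c="\<delta> powr N"])
    show "filterlim q at_top sequentially"
    proof -
      have "filterlim (\<lambda>k. ln chi * real k) at_top sequentially"
        using chi(1) by (intro filterlim_tendsto_pos_mult_at_top[OF tendsto_const _ filterlim_real_sequentially]) auto
      then have "filterlim (\<lambda>k. exp (ln chi * real k)) at_top sequentially"
        by (rule filterlim_compose[OF exp_at_top])
      moreover have "q = (\<lambda>k. exp (ln chi * real k))"
        using chi(1) by (simp only: fun_eq_iff q_def powr_def mult.commute[of "ln chi"]) auto
      ultimately show ?thesis by (simp only:)
    qed
    show "q k > 0" for k using q1[of k] by simp
    show "(\<integral>\<^sup>+x. ennreal (\<tau> x powr q k) * indicator (cball 0 r) x \<partial>lebesgue) \<le> ennreal (\<delta> powr N * (it_const * m0) powr q k)" for k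
    proof -
      have "(\<integral>\<^sup>+x. ennreal (\<tau> x powr q k) * indicator (cball 0 r) x \<partial>lebesgue) \<le> J k"
        unfolding J_def using rr(1)[of k] by (intro nn_integral_mono) (auto simp: indicator_def)
      also have "\<dots> \<le> ennreal (\<delta> powr N * m k powr q k)" by (rule Jle)
      also have "\<dots> \<le> ennreal (\<delta> powr N * (it_const * m0) powr q k)"
        using mle[of k] mpos[of k] q1[of k] by (intro ennreal_leI mult_left_mono powr_mono2) auto
      finally show ?thesis .
    qed
  qed (use K in auto)
qed

end

context moser
begin

text \<open>The solution is locally square integrable as \<open>2\<close> is less than the Sobolev exponent; this starts the
  iteration.\<close>
lemma \<tau>_locally_integrable: "(\<integral>\<^sup>+x. ennreal (\<tau> x) * indicator (cball 0 \<rho>) x \<partial>lebesgue) < \<infinity>"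
proof -
  note Um[measurable] = smooth_limitD(1)[OF U]
  have K[measurable]: "cball 0 \<rho> \<in> sets (lebesgue :: (real^'n) measure)" by simp
  have Kf: "emeasure lebesgue (cball 0 \<rho> :: (real^'n) set) < \<infinity>"
    by (simp add: fmeasurable_compact fmeasurableD2 less_top[symmetric])
  have "(\<integral>\<^sup>+x. ennreal (\<tau> x) * indicator (cball 0 \<rho>) x \<partial>lebesgue)
     = (\<integral>\<^sup>+x. ennreal (norm (U x) powr 2) * indicator (cball 0 \<rho>) x + ennreal (\<kappa>\<^sup>2) * indicator (cball 0 \<rho>) x \<partial>lebesgue)"
  proof (intro nn_integral_cong)
    fix x
    have "ennreal (\<tau> x) = ennreal (norm (U x) powr 2) + ennreal (\<kappa>\<^sup>2)"
      by (simp add: \<tau>_def reg_sq_def powr_numeral power2_norm_eq_inner)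
    then show "ennreal (\<tau> x) * indicator (cball 0 \<rho>) x = ennreal (norm (U x) powr 2) * indicator (cball 0 \<rho>) x + ennreal (\<kappa>\<^sup>2) * indicator (cball 0 \<rho>) x"
      by (simp add: distrib_right)
  qed
  also have "\<dots> = (\<integral>\<^sup>+x. ennreal (norm (U x) powr 2) * indicator (cball 0 \<rho>) x \<partial>lebesgue) + ennreal (\<kappa>\<^sup>2) * emeasure lebesgue (cball 0 \<rho> :: (real^'n) set)"
    by (simp add: nn_integral_add nn_integral_cmult_indicator)
  also have "\<dots> < \<infinity>"
  proof -
    have "(\<integral>\<^sup>+x. ennreal (norm (U x) powr 2) * indicator (cball 0 \<rho>) x \<partial>lebesgue)
       \<le> epow (\<integral>\<^sup>+x. ennreal (norm (U x) powr p) \<partial>lebesgue) (2 / p) * epow (emeasure lebesgue (cball 0 \<rho> :: (real^'n) set)) (1 - 2 / p)"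
      using p2 by (intro nn_integral_norm_powr_le Um K) auto
    also have "\<dots> < \<infinity>" using smooth_limit_Sobolev(3)[OF n U] Kf
      by (simp add: p_def ennreal_mult_less_top epow_less_top)
    finally show ?thesis using Kf by (simp add: ennreal_mult_less_top)
  qed
  finally show ?thesis .
qed

text \<open>The bound in terms of the integral of \<open>\<tau>\<close> improves itself. If \<open>(\<rho>1 - r)\<^sup>n sqrt(\<tau>) \<le> \<Theta>\<close> holds on every
  smaller ball, then estimating one factor \<open>sqrt(\<tau>)\<close> of \<open>\<tau>\<close> by its supremum on the ball of radius
  \<open>(r + \<rho>1)/2\<close> gives the same statement with \<open>sqrt(Q \<Theta>)\<close>. The iterates of \<open>\<Theta> \<mapsto> sqrt(Q \<Theta>)\<close> tend to
  \<open>Q\<close> from any positive start.\<close>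
lemma local_boundedness_L1:
  assumes \<rho>: "0 < \<rho>1" "\<rho>1 < \<rho>0" "\<rho>0 \<le> 2 * R" "cball 0 \<rho>0 \<subseteq> B"
    and I: "I > 0" "(\<integral>\<^sup>+x. ennreal (sqrt (\<tau> x)) * indicator (cball 0 \<rho>1) x \<partial>lebesgue) \<le> ennreal I"
    and r: "0 < r" "r < \<rho>1"
  shows "AE x in lebesgue. x \<in> cball 0 r \<longrightarrow> (\<rho>1 - r) powr N * sqrt (\<tau> x) \<le> 4 powr N * it_const * I"
proof -
  define Q where "Q = 4 powr N * it_const * I"
  have K: "it_const > 0" by (simp add: it_const_def iteration_const_pos)
  have Q: "Q > 0" using K I by (simp add: Q_def)
  define good where "good \<Theta> \<longleftrightarrow> (\<forall>r. 0 < r \<longrightarrow> r < \<rho>1 \<longrightarrow>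
     (AE x in lebesgue. x \<in> cball 0 r \<longrightarrow> (\<rho>1 - r) powr N * sqrt (\<tau> x) \<le> \<Theta>))" for \<Theta>
  have step: "good (sqrt (Q * \<Theta>))" if g: "good \<Theta>" and \<Theta>: "\<Theta> > 0" for \<Theta>
    unfolding good_def
  proof (intro allI impI)
    fix r assume r: "0 < r" "r < \<rho>1"
    \<comment> \<open>the midpoint makes both the gap \<open>\<rho> - r\<close> of the estimate and the remaining gap \<open>\<rho>1 - \<rho>\<close> equal to \<open>\<delta>\<close>\<close>
    define \<rho> where "\<rho> = (r + \<rho>1) / 2"
    define \<delta> where "\<delta> = (\<rho>1 - r) / 2"
    have \<rho>': "r < \<rho>" "\<rho> < \<rho>1" "\<rho> - r = \<delta>" "\<rho>1 - \<rho> = \<delta>" and \<delta>: "\<delta> > 0" "\<rho>1 - r = 2 * \<delta>"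
      using r by (auto simp: \<rho>_def \<delta>_def field_simps)
    have \<delta>N: "\<delta> powr N > 0" using \<delta> by simp
    define m where "m = \<Theta> / \<delta> powr N"
    have m: "m > 0" using \<Theta> \<delta>N by (simp add: m_def)
    have "AE x in lebesgue. x \<in> cball 0 \<rho> \<longrightarrow> (\<rho>1 - \<rho>) powr N * sqrt (\<tau> x) \<le> \<Theta>"
      by (rule g[unfolded good_def, rule_format]) (use \<rho>' r in auto)
    then have ae: "AE x in lebesgue. x \<in> cball 0 \<rho> \<longrightarrow> sqrt (\<tau> x) \<le> m"
      unfolding \<rho>'(4) m_def by eventually_elim (use \<delta>N in \<open>simp add: field_simps\<close>)
    have "(\<integral>\<^sup>+x. ennreal (\<tau> x) * indicator (cball 0 \<rho>) x \<partial>lebesgue)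
       \<le> (\<integral>\<^sup>+x. ennreal m * (ennreal (sqrt (\<tau> x)) * indicator (cball 0 \<rho>1) x) \<partial>lebesgue)"
    proof (rule nn_integral_mono_AE)
      show "AE x in lebesgue. ennreal (\<tau> x) * indicator (cball 0 \<rho>) x \<le> ennreal m * (ennreal (sqrt (\<tau> x)) * indicator (cball 0 \<rho>1) x)"
        using ae
      proof eventually_elim
        case (elim x)
        show ?case
        proof (cases "x \<in> cball 0 \<rho>")
          case True
          have "\<tau> x = sqrt (\<tau> x) * sqrt (\<tau> x)" using \<tau>_pos[of x] by simp
          also have "\<dots> \<le> m * sqrt (\<tau> x)" using elim True \<tau>_pos[of x] by (intro mult_right_mono) auto
          finally have "ennreal (\<tau> x) \<le> ennreal m * ennreal (sqrt (\<tau> x))" using m \<tau>_pos[of x]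
            by (simp add: ennreal_mult[symmetric] ennreal_leI)
          with True \<rho>' show ?thesis by (simp add: indicator_def)
        qed simp
      qed
    qed
    also have "\<dots> = ennreal m * (\<integral>\<^sup>+x. ennreal (sqrt (\<tau> x)) * indicator (cball 0 \<rho>1) x \<partial>lebesgue)"
    proof -
      have [measurable]: "cball 0 \<rho>1 \<in> sets (lebesgue :: (real^'n) measure)" by simp
      show ?thesis by (rule nn_integral_cmult) measurable
    qed
    also have "\<dots> \<le> ennreal m * ennreal I" by (intro mult_left_mono I) auto
    also have "\<dots> = ennreal ((\<rho> - r) powr N * (m * I / \<delta> powr N))"
      unfolding \<rho>'(3) using m I \<delta>N by (simp add: ennreal_mult[symmetric])
    finally have "AE x in lebesgue. x \<in> cball 0 r \<longrightarrow> \<tau> x \<le> it_const * (m * I / \<delta> powr N)"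
    proof (intro local_boundedness_L2[where \<rho>=\<rho>])
      show "cball 0 \<rho> \<subseteq> B" using \<rho> \<rho>' subset_cball[of \<rho> \<rho>0 "0::real^'n"] by auto
    qed (use r \<rho> \<rho>' m I \<delta>N in auto)
    then show "AE x in lebesgue. x \<in> cball 0 r \<longrightarrow> (\<rho>1 - r) powr N * sqrt (\<tau> x) \<le> sqrt (Q * \<Theta>)"
    proof eventually_elim
      case (elim x)
      show ?case
      proof
        assume "x \<in> cball 0 r"
        with elim have "\<tau> x \<le> it_const * (m * I / \<delta> powr N)" by blast
        then have "((2 * \<delta>) powr N)\<^sup>2 * \<tau> x \<le> ((2 * \<delta>) powr N)\<^sup>2 * (it_const * (m * I / \<delta> powr N))"
          by (intro mult_left_mono) auto
        also have "\<dots> = Q * \<Theta>"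
        proof -
          have "((2 * \<delta>) powr N)\<^sup>2 = (2 powr N * 2 powr N) * (\<delta> powr N)\<^sup>2"
            using \<delta> by (simp add: powr_mult power_mult_distrib power2_eq_square)
          moreover have "2 powr N * 2 powr N = (4::real) powr N" by (subst powr_mult[symmetric]) auto
          ultimately show ?thesis unfolding m_def Q_def using \<delta>N by (simp add: power2_eq_square)
        qed
        finally have "sqrt (((2 * \<delta>) powr N)\<^sup>2 * \<tau> x) \<le> sqrt (Q * \<Theta>)" by (rule real_sqrt_le_mono)
        then show "(\<rho>1 - r) powr N * sqrt (\<tau> x) \<le> sqrt (Q * \<Theta>)"
          unfolding \<delta>(2) by (simp add: real_sqrt_mult)
      qed
    qed
  qed
  obtain \<Theta>0 where \<Theta>0: "\<Theta>0 > 0" "good \<Theta>0"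
  proof -
    define J where "J = (\<integral>\<^sup>+x. ennreal (\<tau> x) * indicator (cball 0 \<rho>0) x \<partial>lebesgue)"
    obtain j where j: "J = ennreal j" "j \<ge> 0"
      using \<tau>_locally_integrable[of \<rho>0] unfolding J_def[symmetric] by (cases J) auto
    have d: "(\<rho>0 - \<rho>1) powr N > 0" using \<rho> by simp
    define m0 where "m0 = (j + 1) / (\<rho>0 - \<rho>1) powr N"
    have m0: "m0 > 0" "J \<le> ennreal ((\<rho>0 - \<rho>1) powr N * m0)"
      using j d by (auto simp: m0_def intro!: ennreal_leI)
    have ae: "AE x in lebesgue. x \<in> cball 0 \<rho>1 \<longrightarrow> \<tau> x \<le> it_const * m0"
      by (rule local_boundedness_L2[where \<rho>=\<rho>0]) (use \<rho> m0 J_def in auto)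
    have "good (\<rho>1 powr N * sqrt (it_const * m0))" unfolding good_def
    proof (intro allI impI)
      fix r assume r: "0 < r" "r < \<rho>1"
      show "AE x in lebesgue. x \<in> cball 0 r \<longrightarrow> (\<rho>1 - r) powr N * sqrt (\<tau> x) \<le> \<rho>1 powr N * sqrt (it_const * m0)"
        using ae
      proof eventually_elim
        case (elim x)
        show ?case
        proof
          assume "x \<in> cball 0 r"
          then have "\<tau> x \<le> it_const * m0" using elim r by auto
          then show "(\<rho>1 - r) powr N * sqrt (\<tau> x) \<le> \<rho>1 powr N * sqrt (it_const * m0)"
            using r N3 \<tau>_pos[of x] by (intro mult_mono powr_mono2 real_sqrt_le_mono) auto
        qed
      qed
    qed
    moreover have "\<rho>1 powr N * sqrt (it_const * m0) > 0" using \<rho> K m0 by simp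
    ultimately show ?thesis using that by blast
  qed
  \<comment> \<open>the orbit of \<open>\<Theta>0\<close> under \<open>\<Theta> \<mapsto> sqrt(Q \<Theta>)\<close>\<close>
  define T where "T j = Q * (\<Theta>0 / Q) powr (1 / 2 ^ j)" for j :: nat
  have T: "good (T j)" "T j > 0" for j
  proof -
    show Tp: "T j > 0" for j using Q \<Theta>0 by (simp add: T_def)
    show "good (T j)"
    proof (induction j)
      case 0 show ?case using \<Theta>0 Q by (simp add: T_def)
    next
      case (Suc j)
      have "sqrt (Q * T j) = sqrt (Q\<^sup>2 * (\<Theta>0 / Q) powr (1 / 2 ^ j))" by (simp add: T_def power2_eq_square)
      also have "\<dots> = Q * ((\<Theta>0 / Q) powr (1 / 2 ^ j)) powr (1 / 2)"
        using Q by (simp add: real_sqrt_mult powr_half_sqrt)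
      also have "\<dots> = T (Suc j)" unfolding T_def powr_powr by (simp add: mult.commute)
      finally show ?case using step[OF Suc Tp] by simp
    qed
  qed
  have lim: "T \<longlonglongrightarrow> Q"
  proof -
    have "(\<lambda>j. (1 / 2) ^ j) \<longlonglongrightarrow> (0::real)" by (rule LIMSEQ_power_zero) simp
    then have "(\<lambda>j. Q * (\<Theta>0 / Q) powr ((1 / 2) ^ j)) \<longlonglongrightarrow> Q * (\<Theta>0 / Q) powr 0"
      using \<Theta>0 Q by (intro tendsto_intros) auto
    then show ?thesis using \<Theta>0 Q by (simp add: T_def[abs_def] power_divide)
  qed
  have "AE x in lebesgue. \<forall>j. x \<in> cball 0 r \<longrightarrow> (\<rho>1 - r) powr N * sqrt (\<tau> x) \<le> T j"
    using T(1) r unfolding good_def by (intro AE_all_countable[THEN iffD2] allI) blast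
  then show ?thesis unfolding Q_def[symmetric]
  proof eventually_elim
    case (elim x)
    show ?case
    proof
      assume "x \<in> cball 0 r"
      with elim have "(\<rho>1 - r) powr N * sqrt (\<tau> x) \<le> T j" for j by blast
      then show "(\<rho>1 - r) powr N * sqrt (\<tau> x) \<le> Q"
        by (intro LIMSEQ_le_const[OF lim]) auto
    qed
  qed
qed

lemma it_const_eq:
  "it_const = iteration_const (max 1 (4 * (moser_const lam Lam (1 / (1 - N / (2 * l))) * (4 + ccut\<^sup>2))))
     (4 * (N / (N - 2)) powr (1 / (1 - N / (2 * l)))) (N / (N - 2))"
  unfolding it_const_def ball_const_def chi_def \<sigma>_def \<theta>_def ..

lemma bounded_on_ball:
  assumes B2: "B = ball 0 (2 * R)"
    and A: "(\<integral>\<^sup>+x. ennreal (norm (U x)) * indicator B x \<partial>lebesgue) \<le> ennreal A" "A \<ge> 0"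
    and vol: "emeasure lebesgue (B :: (real^'n) set) = ennreal v" "v \<ge> 0"
  shows "AE x in lebesgue. x \<in> ball 0 R \<longrightarrow> norm (U x) \<le> 8 powr N * it_const * R powr (- N) * (A + \<kappa> * v)"
proof -
  note Um[measurable] = smooth_limitD(1)[OF U]
  have Bm[measurable]: "B \<in> sets lebesgue" using B by simp
  have v: "v > 0"
  proof -
    have "emeasure lebesgue B \<noteq> 0"
      using R emeasure_lborel_ball_finite unfolding B2
      by (simp add: emeasure_ball unit_ball_vol_pos less_imp_neq[THEN not_sym])
    then show ?thesis using vol by (cases "v = 0") auto
  qed
  have "(\<integral>\<^sup>+x. ennreal (sqrt (\<tau> x)) * indicator (cball 0 (3 * R / 2)) x \<partial>lebesgue)
     \<le> (\<integral>\<^sup>+x. ennreal (norm (U x)) * indicator B x + ennreal \<kappa> * indicator B x \<partial>lebesgue)"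
  proof (intro nn_integral_mono)
    fix x
    have "sqrt (\<tau> x) \<le> norm (U x) + \<kappa>"
      using sqrt_sum_squares_le_sum[of "norm (U x)" \<kappa>] \<kappa>
      by (simp add: \<tau>_def reg_sq_def power2_norm_eq_inner)
    then have "ennreal (sqrt (\<tau> x)) \<le> ennreal (norm (U x) + \<kappa>)" by (rule ennreal_leI)
    also have "\<dots> = ennreal (norm (U x)) + ennreal \<kappa>" using \<kappa> by (intro ennreal_plus) auto
    finally have "ennreal (sqrt (\<tau> x)) \<le> ennreal (norm (U x)) + ennreal \<kappa>" .
    then show "ennreal (sqrt (\<tau> x)) * indicator (cball 0 (3 * R / 2)) x \<le> ennreal (norm (U x)) * indicator B x + ennreal \<kappa> * indicator B x"
      using R by (auto simp: indicator_def B2)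
  qed
  also have "\<dots> = (\<integral>\<^sup>+x. ennreal (norm (U x)) * indicator B x \<partial>lebesgue) + ennreal \<kappa> * ennreal v"
    by (simp add: nn_integral_add nn_integral_cmult_indicator vol(1)[symmetric])
  also have "\<dots> \<le> ennreal A + ennreal \<kappa> * ennreal v" by (intro add_right_mono A)
  also have "\<dots> = ennreal (A + \<kappa> * v)" using A \<kappa> vol by (simp add: ennreal_mult)
  finally have I: "(\<integral>\<^sup>+x. ennreal (sqrt (\<tau> x)) * indicator (cball 0 (3 * R / 2)) x \<partial>lebesgue) \<le> ennreal (A + \<kappa> * v)" .
  have "AE x in lebesgue. x \<in> cball 0 R \<longrightarrow> (3 * R / 2 - R) powr N * sqrt (\<tau> x) \<le> 4 powr N * it_const * (A + \<kappa> * v)"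
  \<comment> \<open>any radii with \<open>R < \<rho>1 < \<rho>0 < 2 R\<close> would do; the distance \<open>\<rho>1 - R = R / 2\<close> turns \<open>4\<^sup>n\<close> into \<open>8\<^sup>n\<close>\<close>
  proof (rule local_boundedness_L1[where ?\<rho>0.0="7 * R / 4", OF _ _ _ _ _ I])
    show "A + \<kappa> * v > 0" using A \<kappa> v by (intro add_nonneg_pos) auto
  qed (use R B2 in auto)
  then show ?thesis
  proof eventually_elim
    case (elim x)
    show ?case
    proof
      assume "x \<in> ball 0 R"
      then have "(R / 2) powr N * sqrt (\<tau> x) \<le> 4 powr N * it_const * (A + \<kappa> * v)" using elim by (simp add: field_simps)
      then have "(2 powr N * R powr (- N)) * ((R / 2) powr N * sqrt (\<tau> x)) \<le> (2 powr N * R powr (- N)) * (4 powr N * it_const * (A + \<kappa> * v))"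
        by (intro mult_left_mono) auto
      moreover have "(2 powr N * R powr (- N)) * ((R / 2) powr N * sqrt (\<tau> x)) = sqrt (\<tau> x)"
      proof -
        have "(2 powr N * R powr (- N)) * (R / 2) powr N = 1"
          using R by (simp add: powr_divide powr_minus field_simps)
        then show ?thesis by (simp only: mult.assoc[symmetric] mult_1)
      qed
      moreover have "(2 powr N * R powr (- N)) * (4 powr N * it_const * (A + \<kappa> * v))
          = (2 powr N * 4 powr N) * it_const * R powr (- N) * (A + \<kappa> * v)" by (simp only: mult_ac)
      moreover have "2 powr N * 4 powr N = (8::real) powr N" by (subst powr_mult[symmetric]) auto
      ultimately have "sqrt (\<tau> x) \<le> 8 powr N * it_const * R powr (- N) * (A + \<kappa> * v)"
        by (simp only:)
      then show "norm (U x) \<le> 8 powr N * it_const * R powr (- N) * (A + \<kappa> * v)"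
        using norm_le_sqrt_reg_sq[of "U x" \<kappa>] by (simp add: \<tau>_def)
    qed
  qed
qed

end

section \<open>The estimate for weak solutions\<close>

text \<open>Solutions and their gradients are only known up to null sets, and the definition of a weak
  solution contains integrals without any measurability statement; completeness of the Lebesgue
  measure supplies it.\<close>
lemma lebesgue_measurable_cong_AE:
  fixes f g :: "'a::euclidean_space \<Rightarrow> 'b::topological_space"
  assumes f: "f \<in> borel_measurable lebesgue" and eq: "AE x in lebesgue. f x = g x"
  shows "g \<in> borel_measurable lebesgue"
proof (rule measurableI)
  obtain Z where Z0: "{x \<in> space lebesgue. \<not> f x = g x} \<subseteq> Z" "emeasure lebesgue Z = 0" "Z \<in> sets lebesgue"
    using eq by (rule AE_E)
  have Z: "Z \<in> null_sets lebesgue" "{x. f x \<noteq> g x} \<subseteq> Z"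
    using null_setsI[OF Z0(2,3)] Z0(1) by auto
  fix S :: "'b set" assume S: "S \<in> sets borel"
  have fg: "f x = g x" if "x \<notin> Z" for x using Z(2) that by blast
  have split: "g -` S = (f -` S - Z) \<union> (g -` S \<inter> Z)" by (auto simp: fg)
  have "f -` S \<in> sets lebesgue" using measurable_sets[OF f S] by simp
  moreover have "g -` S \<inter> Z \<in> null_sets lebesgue"
    by (rule null_sets_completion_subset[OF _ Z(1)]) auto
  ultimately have "(f -` S - Z) \<union> (g -` S \<inter> Z) \<in> sets lebesgue"
    using null_setsD2[OF Z(1)] by (intro sets.Un sets.Diff null_setsD2[of "g -` S \<inter> Z"])
  then have "g -` S \<in> sets lebesgue" unfolding split[symmetric] .
  then show "g -` S \<inter> space lebesgue \<in> sets lebesgue" by simp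
qed simp

lemma integral_lebesgue_cong_AE:
  fixes f g :: "'a::euclidean_space \<Rightarrow> real"
  assumes eq: "AE x in lebesgue. f x = g x"
  shows "(\<integral>x. f x \<partial>lebesgue) = (\<integral>x. g x \<partial>lebesgue)"
proof (cases "f \<in> borel_measurable lebesgue")
  case True
  then show ?thesis using lebesgue_measurable_cong_AE[OF True eq] eq by (intro integral_cong_AE)
next
  case False
  have "AE x in lebesgue. g x = f x" using eq by eventually_elim simp
  then have "g \<notin> borel_measurable lebesgue" using False lebesgue_measurable_cong_AE by blast
  with False show ?thesis by (metis borel_measurable_integrable not_integrable_integral_eq)
qed

lemma set_integral_lebesgue_cong_AE:
  fixes f g :: "'a::euclidean_space \<Rightarrow> real"
  assumes "AE x in lebesgue. x \<in> B \<longrightarrow> f x = g x"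
  shows "(LINT x:B|lebesgue. f x) = (LINT x:B|lebesgue. g x)"
  unfolding set_lebesgue_integral_def
  by (rule integral_lebesgue_cong_AE, use assms in eventually_elim) (auto simp: indicator_def)

text \<open>The iteration constant as an explicit function of the data, which makes its independence of the
  solution, the coefficients, the weight and the radius visible.\<close>
definition local_bound_const :: "real \<Rightarrow> real \<Rightarrow> real \<Rightarrow> real \<Rightarrow> real \<Rightarrow> real" where
  "local_bound_const N lam Lam l c =
    iteration_const (max 1 (4 * (moser_const lam Lam (1 / (1 - N / (2 * l))) * (4 + c\<^sup>2))))
      (4 * (N / (N - 2)) powr (1 / (1 - N / (2 * l)))) (N / (N - 2))"

text \<open>The solution is replaced by its global representative, its weak gradient by the one of the
  approximating test functions, and \<open>f\<close> by its extension by zero.\<close>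
lemma weak_solution_bounded:
  fixes u f :: "real^'n::finite \<Rightarrow> real^'d::finite" and a :: "'n \<Rightarrow> 'n \<Rightarrow> real^'n \<Rightarrow> real"
    and V :: "real^'n \<Rightarrow> real^'d^'d" and lam Lam l R \<kappa> A v N :: real
  defines "N \<equiv> real CARD('n)"
  assumes n: "CARD('n) \<ge> 3" and lam: "lam > 0" and Lam: "Lam > 0" and l: "l > N / 2" and R: "R > 0"
    and am: "\<And>\<alpha> \<beta>. a \<alpha> \<beta> \<in> borel_measurable lebesgue"
    and ell: "elliptic (\<lambda>x \<alpha> \<beta>. a \<alpha> \<beta> x *\<^sub>R (mat 1 :: real^'d^'d)) lam"
    and bdd: "bounded_form (\<lambda>x \<alpha> \<beta>. a \<alpha> \<beta> x *\<^sub>R (mat 1 :: real^'d^'d)) Lam"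
    and V: "matrix_weight V" "V \<in> Lp_loc (N / 2)"
    and f: "f \<in> borel_measurable (lebesgue_on (ball 0 (2 * R)))"
    and u: "u \<in> W12V V (ball 0 (4 * R))"
    and sol: "weak_solution a V f (ball 0 (2 * R)) u"
    and \<kappa>: "\<kappa> > 0"
    and F: "epow (\<integral>\<^sup>+x. ennreal ((norm (f x) / \<kappa>) powr l) \<partial>lebesgue_on (ball 0 (2 * R))) (1 / l) \<le> ennreal (R powr (- (2 - N / l)))"
    and A: "(\<integral>\<^sup>+x. ennreal (norm (u x)) \<partial>lebesgue_on (ball 0 (2 * R))) \<le> ennreal A" "A \<ge> 0"
    and vol: "emeasure lebesgue (ball 0 (2 * R) :: (real^'n) set) = ennreal v" "v \<ge> 0"
  shows "Linf_norm (ball 0 R) u \<le> ennreal (8 powr N * local_bound_const N lam Lam l (cutoff_const TYPE(real^'n)) * R powr (- N) * (A + \<kappa> * v))"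
proof -
  let ?B = "ball 0 (2 * R) :: (real^'n) set"
  have Bm: "?B \<in> sets lebesgue" by simp
  obtain U where U: "U \<in> W12V0 V UNIV" and uU: "AE x in lebesgue_on (ball 0 (4 * R)). u x = U x"
    using u by (auto simp: W12V_def)
  have eq4: "AE x in lebesgue. x \<in> ball 0 (4 * R) \<longrightarrow> u x = U x"
    using uU by (subst (asm) AE_restrict_space_iff) auto
  have eq2: "AE x in lebesgue. x \<in> ?B \<longrightarrow> u x = U x"
    using eq4 by eventually_elim (use R in auto)
  obtain DU \<phi>s where SU: "smooth_limit U DU \<phi>s" using W12V0_UNIV_smooth_limit[OF n V(1) U] by blast
  obtain Du where Du: "has_weak_gradient u Du ?B"
    and wk: "\<And>\<phi> D\<phi>. \<phi> \<in> W12V0 V ?B \<Longrightarrow> has_weak_gradient \<phi> D\<phi> ?B \<Longrightarrow>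
          (LINT x:?B|lebesgue. (\<Sum>\<alpha>\<in>UNIV. \<Sum>\<beta>\<in>UNIV. a \<alpha> \<beta> x * (column \<beta> (Du x) \<bullet> column \<alpha> (D\<phi> x))))
          + (LINT x:?B|lebesgue. (V x *v u x) \<bullet> \<phi> x) = (LINT x:?B|lebesgue. f x \<bullet> \<phi> x)"
    using sol unfolding weak_solution_def by blast
  have eqD: "AE x in lebesgue. x \<in> ?B \<longrightarrow> Du x = DU x"
    by (rule weak_gradient_unique[OF open_ball Du smooth_limit_weak_gradient[OF n SU] eq2])
  define g where "g x = indicator ?B x *\<^sub>R f x" for x
  have gm: "g \<in> borel_measurable lebesgue"
    using f Bm by (simp add: g_def[abs_def] borel_measurable_restrict_space_iff)
  have wk': "\<forall>\<phi> D\<phi>. \<phi> \<in> W12V0 V ?B \<longrightarrow> has_weak_gradient \<phi> D\<phi> ?B \<longrightarrow>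
          (LINT x:?B|lebesgue. (\<Sum>\<alpha>\<in>UNIV. \<Sum>\<beta>\<in>UNIV. a \<alpha> \<beta> x * (column \<beta> (DU x) \<bullet> column \<alpha> (D\<phi> x))))
          + (LINT x:?B|lebesgue. (V x *v U x) \<bullet> \<phi> x) = (LINT x:?B|lebesgue. g x \<bullet> \<phi> x)"
  proof (intro allI impI)
    fix \<phi> D\<phi> assume \<phi>: "\<phi> \<in> W12V0 V ?B" "has_weak_gradient \<phi> D\<phi> ?B"
    have 1: "(LINT x:?B|lebesgue. (\<Sum>\<alpha>\<in>UNIV. \<Sum>\<beta>\<in>UNIV. a \<alpha> \<beta> x * (column \<beta> (Du x) \<bullet> column \<alpha> (D\<phi> x))))
       = (LINT x:?B|lebesgue. (\<Sum>\<alpha>\<in>UNIV. \<Sum>\<beta>\<in>UNIV. a \<alpha> \<beta> x * (column \<beta> (DU x) \<bullet> column \<alpha> (D\<phi> x))))"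
      by (rule set_integral_lebesgue_cong_AE, use eqD in eventually_elim) auto
    have 2: "(LINT x:?B|lebesgue. (V x *v u x) \<bullet> \<phi> x) = (LINT x:?B|lebesgue. (V x *v U x) \<bullet> \<phi> x)"
      by (rule set_integral_lebesgue_cong_AE, use eq2 in eventually_elim) auto
    have 3: "(LINT x:?B|lebesgue. f x \<bullet> \<phi> x) = (LINT x:?B|lebesgue. g x \<bullet> \<phi> x)"
      by (rule set_integral_lebesgue_cong_AE) (simp add: g_def)
    from wk[OF \<phi>] show "(LINT x:?B|lebesgue. (\<Sum>\<alpha>\<in>UNIV. \<Sum>\<beta>\<in>UNIV. a \<alpha> \<beta> x * (column \<beta> (DU x) \<bullet> column \<alpha> (D\<phi> x))))
          + (LINT x:?B|lebesgue. (V x *v U x) \<bullet> \<phi> x) = (LINT x:?B|lebesgue. g x \<bullet> \<phi> x)"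
      unfolding 1 2 3 .
  qed
  have Fg: "epow (\<integral>\<^sup>+x. ennreal ((norm (g x) / \<kappa>) powr l) \<partial>lebesgue) (1 / l) \<le> ennreal (R powr (- (2 - N / l)))"
  proof -
    have "(\<integral>\<^sup>+x. ennreal ((norm (g x) / \<kappa>) powr l) \<partial>lebesgue) = (\<integral>\<^sup>+x. ennreal ((norm (f x) / \<kappa>) powr l) \<partial>lebesgue_on ?B)"
      using Bm by (subst nn_integral_restrict_space) (auto simp: g_def indicator_def intro!: nn_integral_cong)
    with F show ?thesis by simp
  qed
  interpret moser U DU \<phi>s a V ?B g lam Lam \<kappa> R l N "crit_exp TYPE('n)" "cutoff_const TYPE(real^'n)"
    by unfold_locales (use n SU lam Lam am ell bdd V gm wk' \<kappa> R l Fg in \<open>auto simp: N_def\<close>)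
  have AU: "(\<integral>\<^sup>+x. ennreal (norm (U x)) * indicator ?B x \<partial>lebesgue) \<le> ennreal A"
  proof -
    have "(\<integral>\<^sup>+x. ennreal (norm (U x)) * indicator ?B x \<partial>lebesgue) = (\<integral>\<^sup>+x. ennreal (norm (u x)) * indicator ?B x \<partial>lebesgue)"
      by (rule nn_integral_cong_AE, use eq2 in eventually_elim) (auto simp: indicator_def)
    also have "\<dots> = (\<integral>\<^sup>+x. ennreal (norm (u x)) \<partial>lebesgue_on ?B)"
      using Bm by (subst nn_integral_restrict_space) auto
    finally show ?thesis using A by simp
  qed
  have bnd: "AE x in lebesgue. x \<in> ball 0 R \<longrightarrow> norm (U x) \<le> 8 powr N * local_bound_const N lam Lam l (cutoff_const TYPE(real^'n)) * R powr (- N) * (A + \<kappa> * v)"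
    using bounded_on_ball[OF refl AU A(2) vol] unfolding it_const_eq local_bound_const_def .
  have Rm: "ball 0 R \<in> sets (lebesgue :: (real^'n) measure)" by simp
  have um: "u \<in> borel_measurable (lebesgue_on (ball 0 R))"
  proof -
    have "(\<lambda>x. indicator (ball 0 R) x *\<^sub>R U x) \<in> borel_measurable lebesgue"
      using smooth_limitD(1)[OF SU] Rm by (intro borel_measurable_scaleR borel_measurable_indicator)
    moreover have "AE x in lebesgue. indicator (ball 0 R) x *\<^sub>R U x = indicator (ball 0 R) x *\<^sub>R u x"
      using eq2 by eventually_elim (use R in \<open>auto simp: indicator_def\<close>)
    ultimately have "(\<lambda>x. indicator (ball 0 R) x *\<^sub>R u x) \<in> borel_measurable lebesgue"
      by (rule lebesgue_measurable_cong_AE)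
    then show ?thesis using Rm by (simp add: borel_measurable_restrict_space_iff)
  qed
  show ?thesis unfolding Linf_norm_def
  proof (rule esssup_I)
    show "(\<lambda>x. ennreal (norm (u x))) \<in> borel_measurable (lebesgue_on (ball 0 R))" using um by measurable
    have "AE x in lebesgue. x \<in> ball 0 R \<longrightarrow> ennreal (norm (u x)) \<le> ennreal (8 powr N * local_bound_const N lam Lam l (cutoff_const TYPE(real^'n)) * R powr (- N) * (A + \<kappa> * v))"
      using bnd eq2 by eventually_elim (use R in \<open>auto intro!: ennreal_leI\<close>)
    then show "AE x in lebesgue_on (ball 0 R). ennreal (norm (u x)) \<le> ennreal (8 powr N * local_bound_const N lam Lam l (cutoff_const TYPE(real^'n)) * R powr (- N) * (A + \<kappa> * v))"
      using Rm by (subst AE_restrict_space_iff) auto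
  qed
qed

text \<open>By this an estimate with the norm of \<open>L\<^sup>1\<close> implies the estimate for every \<open>q \<ge> 1\<close>.\<close>
lemma L1_le_Lq:
  fixes u :: "real^'n::finite \<Rightarrow> real^'d::finite"
  assumes u: "u \<in> borel_measurable (lebesgue_on B)" and B: "B \<in> sets lebesgue" and q: "q \<ge> 1"
    and vol: "emeasure lebesgue B = ennreal v" "v > 0"
  shows "(\<integral>\<^sup>+x. ennreal (norm (u x)) \<partial>lebesgue_on B) \<le> Lp_norm q B u * ennreal (v powr (1 - 1 / q))"
proof (cases "q = 1")
  case True
  have "v powr (1 - 1 / q) = 1" using True vol by simp
  then show ?thesis by (simp add: Lp_norm_epow True)
next
  case False
  then have q: "q > 1" using q by simp
  have e: "emeasure (lebesgue_on B) B = ennreal v" using vol B by (simp add: emeasure_restrict_space)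
  have "(\<integral>\<^sup>+x. ennreal (norm (u x) powr 1) * indicator B x \<partial>lebesgue_on B)
     \<le> epow (\<integral>\<^sup>+x. ennreal (norm (u x) powr q) \<partial>lebesgue_on B) (1 / q) * epow (emeasure (lebesgue_on B) B) (1 - 1 / q)"
    by (rule nn_integral_norm_powr_le) (use u q B in auto)
  moreover have "(\<integral>\<^sup>+x. ennreal (norm (u x) powr 1) * indicator B x \<partial>lebesgue_on B) = (\<integral>\<^sup>+x. ennreal (norm (u x)) \<partial>lebesgue_on B)"
    by (intro nn_integral_cong) (auto simp: indicator_def)
  ultimately show ?thesis unfolding e Lp_norm_epow using vol by simp
qed

theorem proposition7p2:
  fixes lam Lam q l :: real
  assumes "CARD('n::finite) \<ge> 3" and "CARD('d::finite) \<ge> 2"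
    and "0 < lam" and "0 < Lam" and "q \<ge> 1" and "l > real CARD('n) / 2"
  shows "\<exists>C::real. C > 0 \<and>
    (\<forall>(\<Omega>::(real^'n) set) (R::real) (a::'n \<Rightarrow> 'n \<Rightarrow> real^'n \<Rightarrow> real)
      (V::real^'n \<Rightarrow> real^'d^'d) (f::real^'n \<Rightarrow> real^'d) (u::real^'n \<Rightarrow> real^'d).
      open \<Omega> \<longrightarrow> connected \<Omega> \<longrightarrow> R > 0 \<longrightarrow> ball 0 (4 * R) \<subseteq> \<Omega> \<longrightarrow>
      (\<forall>\<alpha> \<beta>. a \<alpha> \<beta> \<in> borel_measurable lebesgue \<and> bounded (range (a \<alpha> \<beta>))) \<longrightarrow>
      elliptic (\<lambda>x \<alpha> \<beta>. a \<alpha> \<beta> x *\<^sub>R (mat 1 :: real^'d^'d)) lam \<longrightarrow>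
      bounded_form (\<lambda>x \<alpha> \<beta>. a \<alpha> \<beta> x *\<^sub>R (mat 1 :: real^'d^'d)) Lam \<longrightarrow>
      matrix_weight V \<longrightarrow> V \<in> Lp_loc (real CARD('n) / 2) \<longrightarrow> nondegenerate V \<longrightarrow>
      f \<in> Lp_space l (ball 0 (2 * R)) \<longrightarrow>
      u \<in> W12V V (ball 0 (4 * R)) \<longrightarrow>
      weak_solution a V f (ball 0 (2 * R)) u \<longrightarrow>
      Linf_norm (ball 0 R) u
        \<le> ennreal C * (ennreal (R powr (- (real CARD('n) / q))) * Lp_norm q (ball 0 (2 * R)) u
            + ennreal (R powr (2 - real CARD('n) / l)) * Lp_norm l (ball 0 (2 * R)) f))"
proof -
  define N where "N = real CARD('n)"
  define K where "K = 8 powr N * local_bound_const N lam Lam l (cutoff_const TYPE(real^'n))"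
  define w where "w = unit_ball_vol N * 2 ^ CARD('n)"
  define C where "C = K * (w powr (1 - 1 / q) + w)"
  have N: "N \<ge> 3" using assms(1) by (simp add: N_def)
  have l: "l > 0" using assms(6) N by (simp add: N_def)
  have K: "K > 0" by (simp add: K_def local_bound_const_def iteration_const_pos)
  have w: "w > 0" using N by (simp add: w_def unit_ball_vol_pos)
  have C: "C > 0" unfolding C_def using K w by (intro mult_pos_pos add_pos_pos) auto
  show ?thesis
  proof (intro exI[of _ C] conjI C allI impI)
    fix \<Omega> :: "(real^'n) set" and R :: real and a :: "'n \<Rightarrow> 'n \<Rightarrow> real^'n \<Rightarrow> real"
      and V :: "real^'n \<Rightarrow> real^'d^'d" and f u :: "real^'n \<Rightarrow> real^'d"
    assume R: "R > 0"
      and a: "\<forall>\<alpha> \<beta>. a \<alpha> \<beta> \<in> borel_measurable lebesgue \<and> bounded (range (a \<alpha> \<beta>))"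
      and ell: "elliptic (\<lambda>x \<alpha> \<beta>. a \<alpha> \<beta> x *\<^sub>R (mat 1 :: real^'d^'d)) lam"
      and bdd: "bounded_form (\<lambda>x \<alpha> \<beta>. a \<alpha> \<beta> x *\<^sub>R (mat 1 :: real^'d^'d)) Lam"
      and V: "matrix_weight V" "V \<in> Lp_loc (real CARD('n) / 2)"
      and f: "f \<in> Lp_space l (ball 0 (2 * R))"
      and u: "u \<in> W12V V (ball 0 (4 * R))"
      and sol: "weak_solution a V f (ball 0 (2 * R)) u"
    let ?B = "ball 0 (2 * R) :: (real^'n) set"
    define v where "v = w * R powr N"
    have v: "v > 0" using w R by (simp add: v_def)
    have vol: "emeasure lebesgue ?B = ennreal v"
    proof -
      have "emeasure lebesgue ?B = ennreal (unit_ball_vol N * (2 * R) ^ CARD('n))"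
        using R by (simp add: emeasure_ball N_def)
      also have "unit_ball_vol N * (2 * R) ^ CARD('n) = v"
        using R by (simp add: v_def w_def N_def power_mult_distrib powr_realpow)
      finally show ?thesis .
    qed
    have fm: "f \<in> borel_measurable (lebesgue_on ?B)" using f by (simp add: Lp_space_def)
    have um: "u \<in> borel_measurable (lebesgue_on ?B)"
    proof -
      obtain U where U: "U \<in> W12V0 V UNIV" "AE x in lebesgue_on (ball 0 (4 * R)). u x = U x"
        using u by (auto simp: W12V_def)
      have Um: "U \<in> borel_measurable lebesgue"
        using U(1) by (simp add: W12V0_def Lp_space_def Let_def lebesgue_on_UNIV_eq)
      have "AE x in lebesgue. x \<in> ball 0 (4 * R) \<longrightarrow> u x = U x"
        using U(2) by (subst (asm) AE_restrict_space_iff) auto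
      then have eq: "AE x in lebesgue. indicator ?B x *\<^sub>R U x = indicator ?B x *\<^sub>R u x"
        by eventually_elim (use R in \<open>auto simp: indicator_def\<close>)
      have "(\<lambda>x. indicator ?B x *\<^sub>R U x) \<in> borel_measurable lebesgue"
        using Um by (intro borel_measurable_scaleR borel_measurable_indicator) auto
      from lebesgue_measurable_cong_AE[OF this eq]
      have "(\<lambda>x. indicator ?B x *\<^sub>R u x) \<in> borel_measurable lebesgue" .
      then show ?thesis by (simp add: borel_measurable_restrict_space_iff)
    qed
    define Fl where "Fl = enn2real (Lp_norm l ?B f)"
    have Fl: "Lp_norm l ?B f = ennreal Fl" "Fl \<ge> 0"
    proof -
      have "(\<integral>\<^sup>+x. ennreal (norm (norm (f x) powr l)) \<partial>lebesgue_on ?B) < \<infinity>"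
        using f by (simp add: Lp_space_def integrable_iff_bounded)
      then have "Lp_norm l ?B f < \<infinity>" by (simp add: Lp_norm_epow epow_less_top)
      then show "Lp_norm l ?B f = ennreal Fl" by (simp add: Fl_def)
    qed (simp add: Fl_def)
    define P where "P = ennreal (R powr (- (N / q))) * Lp_norm q ?B u + ennreal (R powr (2 - N / l)) * Lp_norm l ?B f"
    have "Linf_norm (ball 0 R) u \<le> ennreal C * P"
    proof (cases "Lp_norm q ?B u = \<infinity>")
      case True
      then have "P = \<infinity>" using R by (simp add: P_def ennreal_mult_top)
      then show ?thesis using C by (simp add: ennreal_mult_top)
    next
      case False
      then obtain Y where Y: "Lp_norm q ?B u = ennreal Y" "Y \<ge> 0" by (cases "Lp_norm q ?B u") auto
      define A where "A = Y * v powr (1 - 1 / q)"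
      have A: "(\<integral>\<^sup>+x. ennreal (norm (u x)) \<partial>lebesgue_on ?B) \<le> ennreal A" "A \<ge> 0"
        using L1_le_Lq[OF um _ assms(5) vol v] Y by (auto simp: A_def ennreal_mult)
      define Q where "Q = R powr (- (N / q)) * Y + R powr (2 - N / l) * Fl"
      have PQ: "P = ennreal Q" using Y Fl by (simp add: P_def Q_def ennreal_mult)
      have Q: "Q \<ge> 0" using Y Fl by (simp add: Q_def)
      have "Linf_norm (ball 0 R) u \<le> ennreal (C * Q) + ennreal e" if e: "e > 0" for e
      proof -
        define \<epsilon> where "\<epsilon> = e / C"
        have \<epsilon>: "\<epsilon> > 0" using e C by (simp add: \<epsilon>_def)
        \<comment> \<open>\<open>\<kappa>\<close> has to be positive even if \<open>f\<close> vanishes\<close>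
        define \<kappa> where "\<kappa> = R powr (2 - N / l) * Fl + \<epsilon>"
        have \<kappa>: "\<kappa> > 0" using Fl \<epsilon> by (simp add: \<kappa>_def add_nonneg_pos)
        have F: "epow (\<integral>\<^sup>+x. ennreal ((norm (f x) / \<kappa>) powr l) \<partial>lebesgue_on ?B) (1 / l) \<le> ennreal (R powr (- (2 - N / l)))"
        proof -
          have [measurable]: "f \<in> borel_measurable (lebesgue_on ?B)" by (rule fm)
          have "(\<integral>\<^sup>+x. ennreal ((norm (f x) / \<kappa>) powr l) \<partial>lebesgue_on ?B)
              = (\<integral>\<^sup>+x. ennreal ((1 / \<kappa>) powr l) * ennreal (norm (f x) powr l) \<partial>lebesgue_on ?B)"
            using \<kappa> by (intro nn_integral_cong) (simp add: ennreal_mult[symmetric] powr_divide)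
          also have "\<dots> = ennreal ((1 / \<kappa>) powr l) * (\<integral>\<^sup>+x. ennreal (norm (f x) powr l) \<partial>lebesgue_on ?B)"
            by (rule nn_integral_cmult) measurable
          finally have "epow (\<integral>\<^sup>+x. ennreal ((norm (f x) / \<kappa>) powr l) \<partial>lebesgue_on ?B) (1 / l)
              = epow (ennreal ((1 / \<kappa>) powr l)) (1 / l) * Lp_norm l ?B f"
            using l by (simp add: epow_mult Lp_norm_epow)
          also have "\<dots> = ennreal (1 / \<kappa>) * ennreal Fl"
            using l \<kappa> Fl by (simp add: powr_powr)
          also have "\<dots> = ennreal (1 / \<kappa> * Fl)"
            using \<kappa> Fl by (intro ennreal_mult[symmetric]) auto
          also have "\<dots> \<le> ennreal (R powr (- (2 - N / l)))"
          proof (rule ennreal_leI)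
            have "R powr (2 - N / l) * Fl \<le> \<kappa>" using \<epsilon> by (simp add: \<kappa>_def)
            then have "R powr (- (2 - N / l)) * (R powr (2 - N / l) * Fl) \<le> R powr (- (2 - N / l)) * \<kappa>"
              by (intro mult_left_mono) auto
            moreover have "R powr (- (2 - N / l)) * (R powr (2 - N / l) * Fl) = Fl"
            proof -
              have "R powr (- (2 - N / l)) * R powr (2 - N / l) = 1"
                unfolding powr_add[symmetric] using R by simp
              then show ?thesis by (simp only: mult.assoc[symmetric] mult_1)
            qed
            ultimately have "Fl \<le> R powr (- (2 - N / l)) * \<kappa>" by (simp only:)
            then show "1 / \<kappa> * Fl \<le> R powr (- (2 - N / l))" using \<kappa> by (simp add: divide_le_eq)
          qed
          finally show ?thesis .
        qed
        have "Linf_norm (ball 0 R) u \<le> ennreal (K * R powr (- N) * (A + \<kappa> * v))"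
          unfolding K_def N_def
          by (rule weak_solution_bounded[OF assms(1,3,4,6) R _ ell bdd V fm u sol \<kappa> F[unfolded N_def] A vol less_imp_le[OF v]])
            (use a in auto)
        also have "K * R powr (- N) * (A + \<kappa> * v) = K * (w powr (1 - 1 / q) * (R powr (- (N / q)) * Y) + w * \<kappa>)"
        proof -
          have "R powr (- N) * v powr (1 - 1 / q) = w powr (1 - 1 / q) * R powr (- (N / q))"
          proof -
            have "v powr (1 - 1 / q) = w powr (1 - 1 / q) * R powr (N * (1 - 1 / q))"
              unfolding v_def powr_mult powr_powr ..
            moreover have "R powr (- N) * R powr (N * (1 - 1 / q)) = R powr (- (N / q))"
              unfolding powr_add[symmetric] by (simp add: right_diff_distrib)
            ultimately show ?thesis by (simp add: mult_ac)
          qed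
          moreover have "R powr (- N) * v = w" using R by (simp add: v_def powr_minus)
          ultimately show ?thesis unfolding A_def by (simp add: distrib_left mult_ac)
        qed
        also have "\<dots> \<le> K * ((w powr (1 - 1 / q) + w) * (Q + \<epsilon>))"
        proof (intro mult_left_mono)
          have "R powr (- (N / q)) * Y \<le> Q + \<epsilon>" "\<kappa> \<le> Q + \<epsilon>"
            using Fl Y \<epsilon> by (auto simp: Q_def \<kappa>_def)
          then show "w powr (1 - 1 / q) * (R powr (- (N / q)) * Y) + w * \<kappa> \<le> (w powr (1 - 1 / q) + w) * (Q + \<epsilon>)"
            unfolding distrib_right using w by (intro add_mono mult_left_mono) auto
        qed (use K in auto)
        also have "\<dots> = C * (Q + \<epsilon>)" by (simp only: C_def mult.assoc)
        also have "\<dots> = C * Q + e" using C by (simp add: \<epsilon>_def distrib_left)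
        finally have "Linf_norm (ball 0 R) u \<le> ennreal (C * Q + e)" by (simp add: ennreal_leI)
        also have "\<dots> = ennreal (C * Q) + ennreal e" using C Q e by (intro ennreal_plus) auto
        finally show ?thesis .
      qed
      then have "Linf_norm (ball 0 R) u \<le> ennreal (C * Q)" by (rule ennreal_le_epsilon)
      then show ?thesis using C Q unfolding PQ by (simp add: ennreal_mult)
    qed
    then show "Linf_norm (ball 0 R) u
        \<le> ennreal C * (ennreal (R powr (- (real CARD('n) / q))) * Lp_norm q ?B u
            + ennreal (R powr (2 - real CARD('n) / l)) * Lp_norm l ?B f)"
      unfolding P_def N_def .
  qed
qed

end
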